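(* Let $E\subset\mathbb{C}$ be a compact set that is symmetric with respect to the real axis, regular for the Dirichlet problem, and satisfies $\mathrm{cap}(E)=1$. Let $\{\alpha_n\}$ be a sequence of distinct algebraic integers, let $P_n\in\mathbb{Z}[z]$ denote the (monic) minimal polynomial of $\alpha_n$, let $\operatorname{Gal}(\alpha_n)\subset\mathbb{C}$ be the set of all Galois conjugates of $\alpha_n$ (the set of complex roots of $P_n$), and assume that $$\operatorname{dist}(\operatorname{Gal}(\alpha_n),E):=\max_{\zeta\in\operatorname{Gal}(\alpha_n)}\ \min_{w\in E}|\zeta-w|\longrightarrow 0\quad\text{as } n\to\infty.$$ Then for every algebraic number $\alpha\in\overline{\mathbb{Q}}$, $$\lim_{n\to\infty}\hat h_{P_n}(\alpha)=h_E(\alpha),$$ where $\hat h_{P_n}$ is the canonical (dynamical) height of $P_n$ and $h_E$ is the Rumely height associated to $E$.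
   Context: $\mathrm{cap}(E)$ is the logarithmic capacity: $-\log\mathrm{cap}(E)=\inf_{\nu}\iint\log\frac{1}{|z-w|}\,d\nu(z)\,d\nu(w)$ over Borel probability measures $\nu$ on $E$; when $\mathrm{cap}(E)>0$ the unique minimizer is the equilibrium measure $\mu_E$. The Green function is $g_E(z)=\int\log|z-\zeta|\,d\mu_E(\zeta)-\log\mathrm{cap}(E)$ for $z\in\mathbb{C}$. $E$ is regular for the Dirichlet problem if it is non-polar and the unbounded component of $\widehat{\mathbb{C}}\setminus E$ is a regular domain for the Dirichlet problem; equivalently, $\mathrm{cap}(E)>0$ and $g_E$ is continuous on $\mathbb{C}$ and vanishes identically on the polynomially convex hull of $E$ (the complement in $\mathbb{C}$ of the unbounded component of $\mathbb{C}\setminus E$). Heights. For a number field $K$ let $M_K$ be its set of places; for $v\in M_K$ let $N_v=[K_v:\mathbb{Q}_v]$ be the local degree, and let $|\cdot|_v$ extend the standard absolute value on $\mathbb{Q}$, so that $\prod_v|\alpha|_v^{N_v}=1$ for $\alpha\in K^\times$. The absolute logarithmic Weil height of $\alpha\in K$ is $h(\alpha)=\frac{1}{[K:\mathbb{Q}]}\sum_{v\in M_K}N_v\log^+|\alpha|_v$, with $\log^+t=\max\{\log t,0\}$. The Rumely height of $\alpha\in K$ is obtained by replacing $\log^+|\cdot|$ by $g_E$ at Archimedean places: $$h_E(\alpha)=\frac{1}{[K:\mathbb{Q}]}\Bigl(\sum_{\sigma:K\hookrightarrow\mathbb{C}}g_E(\sigma(\alpha))+\sum_{v\in M_K,\ v\nmid\infty}N_v\log^+|\alpha|_v\Bigr).$$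 Both are independent of the choice of $K\ni\alpha$. For a polynomial $P$ of degree $d\ge2$ with coefficients in a number field, the canonical height is $\hat h_P(\alpha)=\lim_{k\to\infty}d^{-k}h(P^{\circ k}(\alpha))$ for $\alpha\in\overline{\mathbb{Q}}$, where $P^{\circ k}$ is the $k$-th iterate (the limit exists by Call–Silverman). Since it is defined only for degree $\ge2$, the limit in $n$ is understood along those $n$ with $\deg P_n\ge2$. *)

theory Defs
  imports
    "HOL-Algebra.Algebraic_Closure_Type"
    "HOL-Probability.Probability"
begin

section \<open>Logarithmic capacity and the Green function\<close>

definition borel_prob_on :: "complex set \<Rightarrow> complex measure set" where
  "borel_prob_on E = {\<nu>. sets \<nu> = sets borel \<and> prob_space \<nu> \<and> emeasure \<nu> E = 1}"

definition log_kernel :: "complex \<Rightarrow> complex \<Rightarrow> ereal" where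
  "log_kernel z w = (if z = w then \<infinity> else ereal (ln (1 / cmod (z - w))))"

(* The double integral of the kernel, as the integral of its positive part minus that of its
   negative part. If the measure has bounded support, the negative part is bounded, so the
   difference is never of the form infinity - infinity. *)
definition energy :: "complex measure \<Rightarrow> ereal" where
  "energy \<nu> =
     enn2ereal (\<integral>\<^sup>+ z. (\<integral>\<^sup>+ w. e2ennreal (log_kernel z w) \<partial>\<nu>) \<partial>\<nu>) -
     enn2ereal (\<integral>\<^sup>+ z. (\<integral>\<^sup>+ w. e2ennreal (- log_kernel z w) \<partial>\<nu>) \<partial>\<nu>)"

definition robin_constant :: "complex set \<Rightarrow> ereal" where
  "robin_constant E = (INF \<nu> \<in> borel_prob_on E. energy \<nu>)"

(* For bounded E the Robin constant is not -infinity. *)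
definition log_capacity :: "complex set \<Rightarrow> real" where
  "log_capacity E =
     (if robin_constant E = \<infinity> then 0 else exp (- real_of_ereal (robin_constant E)))"

(* For compact E of positive capacity the minimiser exists and is unique. *)
definition equilibrium_measure :: "complex set \<Rightarrow> complex measure" where
  "equilibrium_measure E = (ARG_MIN energy \<nu>. \<nu> \<in> borel_prob_on E)"

(* For compact E of positive capacity the integrand is integrable for every z (Frostman), and
   the convention ln 0 = 0 is harmless because the equilibrium measure has no atoms. *)
definition green_function :: "complex set \<Rightarrow> complex \<Rightarrow> real" where
  "green_function E z =
     (\<integral>\<zeta>. ln (cmod (z - \<zeta>)) \<partial>(equilibrium_measure E)) - ln (log_capacity E)"

(* For compact E, the set outside E is the unbounded component of the complement. *)
definition polynomial_hull :: "complex set \<Rightarrow> complex set" where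
  "polynomial_hull E = - outside E"

definition dirichlet_regular :: "complex set \<Rightarrow> bool" where
  "dirichlet_regular E \<longleftrightarrow>
     log_capacity E > 0 \<and> continuous_on UNIV (green_function E) \<and>
     (\<forall>z \<in> polynomial_hull E. green_function E z = 0)"


section \<open>Number fields and their places\<close>

text \<open>Number fields are realised as subfields of the complex numbers, which contain every
  number field up to isomorphism.\<close>

abbreviation complex_field :: "complex ring" where
  "complex_field \<equiv> ring_of_type_algebra"

definition number_field :: "complex set \<Rightarrow> bool" where
  "number_field K \<longleftrightarrow>
     subfield K complex_field \<and> ring.finite_dimension complex_field \<rat> K"

context
begin

interpretation C: field complex_field
  by (rule field_from_type_algebra)

lemma complex_field_simps:
  "carrier complex_field = UNIV"
  "x \<otimes>\<^bsub>complex_field\<^esub> y = x * y"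
  "x \<oplus>\<^bsub>complex_field\<^esub> y = x + y"
  "\<one>\<^bsub>complex_field\<^esub> = 1"
  "\<zero>\<^bsub>complex_field\<^esub> = 0"
  by (simp_all add: ring_of_type_algebra_def)

lemma complex_field_pow: "x [^]\<^bsub>complex_field\<^esub> (n::nat) = x ^ n"
  by (induction n) (simp_all add: complex_field_simps mult.commute)

lemma complex_field_uminus: "\<ominus>\<^bsub>complex_field\<^esub> x = - x"
  by (rule C.minus_equality) (simp_all add: complex_field_simps)

lemma complex_field_inv: "x \<noteq> 0 \<Longrightarrow> inv\<^bsub>complex_field\<^esub> x = inverse x"
  by (rule C.comm_inv_char) (simp_all add: complex_field_simps)

lemma subfield_Rats: "subfield \<rat> complex_field"
proof (rule C.subfieldI')
  show "subring \<rat> complex_field"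
    by (rule C.subringI) (auto simp: complex_field_simps complex_field_uminus)
  show "inv\<^bsub>complex_field\<^esub> k \<in> \<rat>" if "k \<in> \<rat> - {\<zero>\<^bsub>complex_field\<^esub>}" for k
    using that by (auto simp: complex_field_inv complex_field_simps)
qed

lemma complex_field_eval: "ring.eval complex_field xs x = poly (Poly (rev xs)) x"
proof (induction xs)
  case Nil
  then show ?case by (simp add: complex_field_simps)
next
  case (Cons a xs)
  have "Poly (rev xs @ [a]) = Poly (rev xs) + Polynomial.monom a (length xs)"
    by (simp add: Poly_append smult_monom)
  then show ?case
    using Cons by (simp add: complex_field_simps complex_field_pow poly_monom)
qed

lemma algebraic_imp_in_number_field:
  assumes "algebraic \<alpha>"
  shows "\<exists>K. number_field K \<and> \<alpha> \<in> K"
proof -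
  obtain p where p: "\<forall>i. Polynomial.coeff p i \<in> \<int>" "p \<noteq> 0" "poly p \<alpha> = 0"
    using assms by (auto simp: algebraic_def)
  let ?xs = "rev (coeffs p)"
  have "set ?xs \<subseteq> \<rat>"
    using p Ints_subset_Rats by (force simp: coeffs_def)
  moreover have "hd ?xs \<noteq> 0"
    using p by (simp add: hd_rev last_coeffs_eq_coeff_degree)
  ultimately have "?xs \<in> carrier (univ_poly complex_field \<rat>)"
    unfolding univ_poly_def polynomial_def by (auto simp: complex_field_simps)
  then have alg: "(C.algebraic over \<rat>) \<alpha>"
    by (rule C.algebraicI) (use p in \<open>auto simp: complex_field_eval complex_field_simps\<close>)
  show ?thesis
    unfolding number_field_def
    using C.simple_extension_mem[OF subfieldE(1)[OF subfield_Rats]]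
      C.simple_extension_is_subfield[OF subfield_Rats]
      C.finite_dimension_simple_extension[OF subfield_Rats] alg
    by (intro exI[of _ "C.simple_extension \<rat> \<alpha>"]) (auto simp: complex_field_simps)
qed

end

definition field_degree :: "complex set \<Rightarrow> nat" where
  "field_degree K = ring.dim complex_field \<rat> K"

definition embeddings :: "complex set \<Rightarrow> (complex \<Rightarrow> complex) set" where
  "embeddings K = ring_hom (complex_field\<lparr>carrier := K\<rparr>) complex_field \<inter> extensional K"

definition absolute_value :: "complex set \<Rightarrow> (complex \<Rightarrow> real) \<Rightarrow> bool" where
  "absolute_value K v \<longleftrightarrow>
     (\<forall>x \<in> K. 0 \<le> v x \<and> (v x = 0 \<longleftrightarrow> x = 0)) \<and>
     (\<forall>x \<in> K. \<forall>y \<in> K. v (x * y) = v x * v y) \<and>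
     (\<forall>x \<in> K. \<forall>y \<in> K. v (x + y) \<le> v x + v y)"

definition padic_abs :: "nat \<Rightarrow> rat \<Rightarrow> real" where
  "padic_abs p q =
     (if q = 0 then 0
      else real p powi (int (multiplicity (int p) (snd (quotient_of q))) -
                        int (multiplicity (int p) (fst (quotient_of q)))))"

text \<open>A place is represented by the unique absolute value in its class that extends a standard
  absolute value of the rationals.  Extensionality makes this representation unique as a
  function on all complex numbers.\<close>

definition infinite_places :: "complex set \<Rightarrow> (complex \<Rightarrow> real) set" where
  "infinite_places K =
     {v \<in> extensional K. absolute_value K v \<and> (\<forall>q. v (of_rat q) = real_of_rat \<bar>q\<bar>)}"

definition finite_places :: "complex set \<Rightarrow> (complex \<Rightarrow> real) set" where
  "finite_places K =
     {v \<in> extensional K. absolute_value K v \<and>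
        (\<exists>p. prime p \<and> (\<forall>q. v (of_rat q) = padic_abs p q))}"


text \<open>The completion at a place is the ring of Cauchy sequences modulo null sequences.\<close>

definition cauchy_seqs :: "complex set \<Rightarrow> (complex \<Rightarrow> real) \<Rightarrow> (nat \<Rightarrow> complex) set" where
  "cauchy_seqs K v =
     {x. range x \<subseteq> K \<and> (\<forall>e>0. \<exists>N. \<forall>m\<ge>N. \<forall>n\<ge>N. v (x m - x n) < e)}"

definition null_seqs :: "complex set \<Rightarrow> (complex \<Rightarrow> real) \<Rightarrow> (nat \<Rightarrow> complex) set" where
  "null_seqs K v = {x. range x \<subseteq> K \<and> (\<lambda>n. v (x n)) \<longlonglongrightarrow> 0}"

definition cauchy_ring :: "complex set \<Rightarrow> (complex \<Rightarrow> real) \<Rightarrow> (nat \<Rightarrow> complex) ring" where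
  "cauchy_ring K v =
     \<lparr>carrier = cauchy_seqs K v, monoid.mult = (\<lambda>x y n. x n * y n), one = (\<lambda>_. 1),
      ring.zero = (\<lambda>_. 0), add = (\<lambda>x y n. x n + y n)\<rparr>"

definition completion :: "complex set \<Rightarrow> (complex \<Rightarrow> real) \<Rightarrow> (nat \<Rightarrow> complex) set ring" where
  "completion K v = cauchy_ring K v Quot null_seqs K v"

(* The closure of the rationals inside the completion of K, i.e. the completion of the rationals
   at the place below v. *)
definition rat_completion ::
    "complex set \<Rightarrow> (complex \<Rightarrow> real) \<Rightarrow> (nat \<Rightarrow> complex) set set" where
  "rat_completion K v =
     (\<lambda>x. null_seqs K v +>\<^bsub>cauchy_ring K v\<^esub> x) ` {x \<in> cauchy_seqs K v. range x \<subseteq> \<rat>}"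

definition local_degree :: "complex set \<Rightarrow> (complex \<Rightarrow> real) \<Rightarrow> nat" where
  "local_degree K v =
     ring.dim (completion K v) (rat_completion K v) (carrier (completion K v))"


section \<open>Heights\<close>

(* log^+; note that ln 0 = 0. *)
definition log_plus :: "real \<Rightarrow> real" where
  "log_plus t = max (ln t) 0"

text \<open>The heights of an element of a number field \<open>K\<close>, computed in \<open>K\<close>.  The values do not
  depend on the choice of \<open>K\<close>.  Only finitely many terms of the sums over the finite places
  are nonzero.\<close>

definition finite_height_sum :: "complex set \<Rightarrow> complex \<Rightarrow> real" where
  "finite_height_sum K \<alpha> =
     (\<Sum>\<^sub>\<infinity>v \<in> finite_places K. real (local_degree K v) * log_plus (v \<alpha>))"

definition weil_height :: "complex set \<Rightarrow> complex \<Rightarrow> real" where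
  "weil_height K \<alpha> =
     ((\<Sum>v \<in> infinite_places K. real (local_degree K v) * log_plus (v \<alpha>)) +
      finite_height_sum K \<alpha>) / real (field_degree K)"

definition rumely_height :: "complex set \<Rightarrow> complex set \<Rightarrow> complex \<Rightarrow> real" where
  "rumely_height E K \<alpha> =
     ((\<Sum>\<sigma> \<in> embeddings K. green_function E (\<sigma> \<alpha>)) + finite_height_sum K \<alpha>)
     / real (field_degree K)"

text \<open>Here \<open>P\<close> has coefficients in \<open>K\<close> and degree at least 2; the limit then exists
  (Call--Silverman).\<close>

definition canonical_height :: "complex set \<Rightarrow> complex poly \<Rightarrow> complex \<Rightarrow> real" where
  "canonical_height K P \<alpha> =
     lim (\<lambda>k. weil_height K ((poly P ^^ k) \<alpha>) / real (Polynomial.degree P) ^ k)"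


section \<open>Minimal polynomials and Galois conjugates\<close>

definition is_minimal_poly :: "rat poly \<Rightarrow> complex \<Rightarrow> bool" where
  "is_minimal_poly p \<alpha> \<longleftrightarrow>
     Polynomial.lead_coeff p = 1 \<and> poly (map_poly of_rat p) \<alpha> = 0 \<and>
     (\<forall>q. q \<noteq> 0 \<longrightarrow> poly (map_poly of_rat q) \<alpha> = 0 \<longrightarrow>
        Polynomial.degree p \<le> Polynomial.degree q)"

abbreviation complex_poly :: "int poly \<Rightarrow> complex poly" where
  "complex_poly p \<equiv> map_poly of_int p"

definition galois_conjugates :: "int poly \<Rightarrow> complex set" where
  "galois_conjugates p = {z. poly (complex_poly p) z = 0}"

(* infdist z E is the minimum of the distances from z to the points of a nonempty compact E. *)
definition max_dist :: "complex set \<Rightarrow> complex set \<Rightarrow> real" where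
  "max_dist A E = Max ((\<lambda>z. infdist z E) ` A)"

end

theory Submission
  imports Defs "Jordan_Normal_Form.Char_Poly" "HOL-Real_Asymp.Real_Asymp"
begin

text \<open>For a monic integral polynomial \<open>p\<close> of degree \<open>d\<close> the non-archimedean local canonical heights
  are the naive ones, because \<open>log\<^sup>+ |p(x)|\<^sub>v = d log\<^sup>+ |x|\<^sub>v\<close>.  So only the archimedean places
  matter, and there the canonical height is the escape rate of \<open>p\<close>, which differs from
  \<open>log\<^sup>+ |p(z)| / d\<close> by \<open>O(1/d)\<close> as long as the roots stay bounded.  It remains to show that
  \<open>log\<^sup>+ |P\<^sub>n(z)| / d\<^sub>n\<close> tends to the Green function at every \<open>z\<close>.

  The discriminant of \<open>P\<^sub>n\<close> is a nonzero integer, so the root measures \<open>\<mu>\<^sub>n\<close> have asymptotically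
  nonpositive logarithmic energy.  The regularised kernel \<open>- ln (\<epsilon> + |x - y|\<^sup>2)\<close> is conditionally
  positive definite, and the potential of the equilibrium measure \<open>\<mu>\<close> is almost nonnegative near
  \<open>E\<close>; hence the regularised energy of \<open>\<mu>\<^sub>n - \<mu>\<close> tends to \<open>0\<close>, and by the Cauchy--Schwarz inequality
  the regularised potentials of \<open>\<mu>\<^sub>n\<close> converge pointwise to those of \<open>\<mu>\<close>.  Off \<open>E\<close> the
  regularisation can be removed, and on \<open>E\<close> the upper bound it provides is all that is needed.\<close>

section \<open>Escape rates of monic polynomials\<close>

text \<open>Root measures have atoms, so their plain logarithmic energy is infinite. With \<epsilon>
  fixed, the diagonal costs only \<open>- ln e / d\<close>, which vanishes as the degree d grows.
  Definiteness is algebraic: after stereographic projection \<open>e + |x - y|^2\<close> is, up to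
  factors in one variable each, 1 minus a finite-rank semidefinite kernel of modulus below 1, and -
  ln (1 - t) has nonnegative Taylor coefficients. The same series shows that the energy of a
  mass-zero functional grows as \<epsilon> shrinks, so it may be bounded at a smaller parameter. The
  definitions pose two further obstacles. \<open>equilibrium_measure\<close> is an
  \<open>ARG_MIN\<close>, so a minimiser has to be produced; weak compactness in the plane is
  reduced to Helly's theorem on the line. \<open>weil_height\<close> sums over places weighted by
  dimensions of completions, so every archimedean absolute value has to be realised by an embedding,
  and its local degree has to count embeddings. For this the square of the absolute value is shown
  to be a multiplicative quadratic form, from which real and imaginary parts are read off; no
  primitive element is chosen.\<close>

lemma log_plus_nonneg: "0 \<le> log_plus t"
  by (simp add: log_plus_def)

lemma log_plus_eq_ln_max: "t \<ge> 0 \<Longrightarrow> log_plus t = ln (max 1 t)"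
  by (cases "t = 0") (auto simp: log_plus_def max_def)

lemma log_plus_mono: "0 \<le> s \<Longrightarrow> s \<le> t \<Longrightarrow> log_plus s \<le> log_plus t"
  by (auto simp: log_plus_eq_ln_max)

lemma log_plus_power: "0 \<le> t \<Longrightarrow> log_plus (t ^ n) = real n * log_plus t"
proof (cases "n = 0 \<or> t \<le> 1")
  case True
  moreover assume "0 \<le> t"
  ultimately show ?thesis
    by (auto simp: log_plus_eq_ln_max power_le_one max_absorb1)
next
  case False
  moreover assume "0 \<le> t"
  ultimately have "max 1 t = t" "max 1 (t ^ n) = t ^ n"
    by (auto simp: max_absorb2 one_le_power)
  then show ?thesis
    using \<open>0 \<le> t\<close> False by (simp add: log_plus_eq_ln_max ln_realpow)
qed

lemma log_plus_mult_le:
  assumes "s \<ge> 0" "t \<ge> 1"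
  shows "log_plus (s * t) \<le> log_plus s + ln t"
proof -
  have "max 1 (s * t) \<le> max 1 s * t"
    using assms by (auto simp: max_def mult_le_cancel_right1 intro: order_trans mult_right_mono)
  then have "ln (max 1 (s * t)) \<le> ln (max 1 s * t)"
    by simp
  then show ?thesis
    using assms by (simp add: log_plus_eq_ln_max ln_mult_pos)
qed

text \<open>For |w| > 2R every factor agrees with |w| up to a factor 2R. For smaller w the product
  may be tiny or zero, but then \<open>log_plus (cmod w)\<close> is itself at most ln (2R), so the
  bound holds uniformly in w.\<close>

lemma log_plus_prod_linear:
  fixes Z :: "complex set" and R :: real
  assumes "finite Z" "Z \<subseteq> cball 0 R" "R \<ge> 1"
  shows "\<bar>log_plus (cmod (\<Prod>\<zeta>\<in>Z. w - \<zeta>)) - real (card Z) * log_plus (cmod w)\<bar>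
           \<le> real (card Z) * ln (2 * R)"
proof (rule abs_leI)
  let ?M = "max 1 (cmod w)"
  have "cmod (w - \<zeta>) \<le> ?M * (2 * R)" if "\<zeta> \<in> Z" for \<zeta>
  proof -
    have "cmod (w - \<zeta>) \<le> cmod w + cmod \<zeta>"
      by (rule norm_triangle_ineq4)
    also have "\<dots> \<le> ?M * R + ?M * R"
    proof (rule add_mono)
      show "cmod w \<le> ?M * R"
        using mult_mono[of "cmod w" ?M 1 R] assms by simp
      show "cmod \<zeta> \<le> ?M * R"
        using mult_mono[of 1 ?M "cmod \<zeta>" R] assms that by auto
    qed
    finally show ?thesis by (simp add: algebra_simps)
  qed
  then have "cmod (\<Prod>\<zeta>\<in>Z. w - \<zeta>) \<le> (\<Prod>\<zeta>\<in>Z. ?M * (2 * R))"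
    unfolding prod_norm[symmetric] by (intro prod_mono) auto
  then have "cmod (\<Prod>\<zeta>\<in>Z. w - \<zeta>) \<le> (?M * (2 * R)) ^ card Z"
    by simp
  then have "log_plus (cmod (\<Prod>\<zeta>\<in>Z. w - \<zeta>)) \<le> real (card Z) * log_plus (?M * (2 * R))"
    using assms by (subst log_plus_power[symmetric]) (auto intro!: log_plus_mono)
  also have "\<dots> \<le> real (card Z) * (log_plus ?M + ln (2 * R))"
    using assms by (intro mult_left_mono log_plus_mult_le) auto
  also have "log_plus ?M = log_plus (cmod w)"
    by (simp add: log_plus_eq_ln_max)
  finally show "log_plus (cmod (\<Prod>\<zeta>\<in>Z. w - \<zeta>)) - real (card Z) * log_plus (cmod w)
      \<le> real (card Z) * ln (2 * R)"
    by (simp add: algebra_simps)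
next
  have "real (card Z) * log_plus (cmod w)
      \<le> real (card Z) * ln (2 * R) + log_plus (cmod (\<Prod>\<zeta>\<in>Z. w - \<zeta>))"
  proof (cases "cmod w \<le> 2 * R")
    case True
    then have "log_plus (cmod w) \<le> ln (2 * R)"
      using assms by (simp add: log_plus_eq_ln_max)
    then have "real (card Z) * log_plus (cmod w) \<le> real (card Z) * ln (2 * R)"
      by (intro mult_left_mono) auto
    then show ?thesis
      using log_plus_nonneg[of "cmod (\<Prod>\<zeta>\<in>Z. w - \<zeta>)"] by linarith
  next
    case False
    have "cmod w / (2 * R) \<le> cmod (w - \<zeta>)" if "\<zeta> \<in> Z" for \<zeta>
    proof -
      have "cmod w / (2 * R) \<le> cmod w / 2"
        using assms by (intro divide_left_mono) auto
      also have "\<dots> \<le> cmod w - cmod \<zeta>"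
        using False assms(2) that by auto
      also have "\<dots> \<le> cmod (w - \<zeta>)"
        by (rule norm_triangle_ineq2)
      finally show ?thesis .
    qed
    then have "(\<Prod>\<zeta>\<in>Z. cmod w / (2 * R)) \<le> cmod (\<Prod>\<zeta>\<in>Z. w - \<zeta>)"
      unfolding prod_norm[symmetric] using assms by (intro prod_mono) auto
    then have "(cmod w / (2 * R)) ^ card Z \<le> cmod (\<Prod>\<zeta>\<in>Z. w - \<zeta>)"
      by simp
    then have "real (card Z) * log_plus (cmod w / (2 * R)) \<le> log_plus (cmod (\<Prod>\<zeta>\<in>Z. w - \<zeta>))"
      using assms by (subst log_plus_power[symmetric]) (auto intro!: log_plus_mono)
    moreover have "log_plus (cmod w) \<le> log_plus (cmod w / (2 * R)) + ln (2 * R)"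
      using log_plus_mult_le[of "cmod w / (2 * R)" "2 * R"] assms by simp
    then have "real (card Z) * log_plus (cmod w) 
        \<le> real (card Z) * (log_plus (cmod w / (2 * R)) + ln (2 * R))"
      by (intro mult_left_mono) auto
    ultimately show ?thesis
      by (simp add: algebra_simps)
  qed
  then show "- (log_plus (cmod (\<Prod>\<zeta>\<in>Z. w - \<zeta>)) - real (card Z) * log_plus (cmod w))
      \<le> real (card Z) * ln (2 * R)"
    by simp
qed

text \<open>Consecutive terms differ by at most C / d^k. Comparing the limit with the first iterate
  instead of the starting point leaves the geometric tail from k = 1 on, which is of order C / d.
  This decay in d allows a single application of f to replace the whole iteration.\<close>

lemma escape_rate_limit:
  fixes f :: "complex \<Rightarrow> complex" and d :: nat and C :: real
  assumes d: "d \<ge> 2"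
    and step: "\<And>w. \<bar>log_plus (cmod (f w)) - real d * log_plus (cmod w)\<bar> \<le> real d * C"
  obtains g where
    "(\<lambda>k. log_plus (cmod ((f ^^ k) z)) / real d ^ k) \<longlonglongrightarrow> g"
    "\<bar>g - log_plus (cmod (f z)) / real d\<bar> \<le> 2 * C / real d"
proof -
  define a where "a k = log_plus (cmod ((f ^^ k) z)) / real d ^ k" for k
  have diff: "\<bar>a (Suc k) - a k\<bar> \<le> C * (1 / real d) ^ k" for k
  proof -
    have "a (Suc k) - a k = (log_plus (cmod (f ((f ^^ k) z))) - 
        real d * log_plus (cmod ((f ^^ k) z))) / real d ^ Suc k"
      using d by (simp add: a_def diff_divide_distrib)
    also have "\<bar>\<dots>\<bar> \<le> (real d * C) / real d ^ Suc k"
      unfolding abs_divide using step[of "(f ^^ k) z"] d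
      by (simp only: abs_of_nonneg[OF zero_le_power[OF of_nat_0_le_iff]])
         (intro divide_right_mono, auto)
    also have "\<dots> = C * (1 / real d) ^ k"
      using d by (simp add: power_divide)
    finally show ?thesis .
  qed
  have C: "C \<ge> 0"
    using order_trans[OF abs_ge_zero diff[of 0]] by simp
  have q: "norm (1 / real d) < 1"
    using d by simp
  have geo: "summable (\<lambda>k. C * (1 / real d) ^ k)"
    using q by (intro summable_mult summable_geometric)
  have summ: "summable (\<lambda>k. a (Suc k) - a k)"
    using diff by (intro summable_comparison_test[OF _ geo]) auto
  define g where "g = a 0 + (\<Sum>k. a (Suc k) - a k)"
  have "(\<lambda>n. a 0 + (\<Sum>k<n. a (Suc k) - a k)) \<longlonglongrightarrow> g"
    unfolding g_def by (intro tendsto_add tendsto_const summable_LIMSEQ summ)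
  then have lim: "a \<longlonglongrightarrow> g"
    by (simp add: sum_lessThan_telescope)
  have "g - a 1 = (\<Sum>k. a (Suc (Suc k)) - a (Suc k))"
    unfolding g_def using suminf_split_head[OF summ] by simp
  also have "\<bar>\<dots>\<bar> \<le> (\<Sum>k. C * (1 / real d) ^ Suc k)"
  proof -
    have "norm (\<Sum>k. a (Suc (Suc k)) - a (Suc k)) \<le> (\<Sum>k. C * (1 / real d) ^ Suc k)"
    proof (rule norm_suminf_le)
      show "summable (\<lambda>k. C * (1 / real d) ^ Suc k)"
        using geo by (rule summable_Suc_iff[THEN iffD2])
      show "norm (a (Suc (Suc k)) - a (Suc k)) \<le> C * (1 / real d) ^ Suc k" for k
        using diff[of "Suc k"] by simp
    qed
    then show ?thesis by simp
  qed
  also have "(\<Sum>k. C * (1 / real d) ^ Suc k) = (C / real d) * (1 / (1 - 1 / real d))"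
    using suminf_mult[of "\<lambda>k. (1 / real d) ^ k" "C / real d"] suminf_geometric[OF q]
      summable_geometric[OF q] by (simp add: algebra_simps)
  also have "\<dots> \<le> (C / real d) * 2"
  proof (intro mult_left_mono)
    show "1 / (1 - 1 / real d) \<le> 2"
      using d by (simp add: field_simps)
  qed (use C in auto)
  finally have "\<bar>g - log_plus (cmod (f z)) / real d\<bar> \<le> 2 * C / real d"
    by (simp add: a_def mult.commute[of 2])
  with lim that show ?thesis
    unfolding a_def by blast
qed


section \<open>Roots of minimal polynomials\<close>

text \<open>Pseudo-division scales the dividend by a power of the leading coefficient, here 1, so it
  is genuine division over the integers. Positive degree keeps the degree bound strict for a zero
  remainder too.\<close>

lemma monic_int_poly_mod:
  fixes p :: "int poly"
  assumes "Polynomial.lead_coeff p = 1" "Polynomial.degree p \<ge> 1"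
  obtains q r where "f = p * q + r" "Polynomial.degree r < Polynomial.degree p"
proof -
  obtain q r where qr: "pseudo_divmod f p = (q, r)"
    by fastforce
  have "p \<noteq> 0"
    using assms by auto
  from pseudo_divmod[OF this qr] assms show ?thesis
    by (intro that[of q r]) auto
qed

text \<open>A kernel vector is the coefficient vector of a polynomial of degree below d with d
  distinct roots.\<close>

lemma vandermonde_det_nonzero:
  fixes z :: "nat \<Rightarrow> complex"
  assumes "inj_on z {..<d}"
  shows "det (mat d d (\<lambda>(i, j). z i ^ j)) \<noteq> 0"
proof
  let ?V = "mat d d (\<lambda>(i, j). z i ^ j)"
  assume "det ?V = 0"
  then obtain v where v: "v \<in> carrier_vec d" "v \<noteq> 0\<^sub>v d" "?V *\<^sub>v v = 0\<^sub>v d"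
    using det_0_iff_vec_prod_zero[of ?V d] by auto
  define f where "f = (\<Sum>j<d. Polynomial.monom (v $ j) j)"
  have coeff: "Polynomial.coeff f j = (if j < d then v $ j else 0)" for j
    by (simp add: f_def coeff_sum if_distrib[of "\<lambda>x. x = j"] sum.delta cong: if_cong)
  have "poly f (z i) = 0" if "i < d" for i
  proof -
    have "(?V *\<^sub>v v) $ i = (\<Sum>j<d. z i ^ j * v $ j)"
      using that v(1) by (simp add: scalar_prod_def atLeast0LessThan)
    also have "\<dots> = poly f (z i)"
      by (simp add: f_def poly_sum poly_monom mult.commute)
    finally show ?thesis
      using v(3) that by simp
  qed
  then have sub: "z ` {..<d} \<subseteq> {x. poly f x = 0}"
    by auto
  have "f \<noteq> 0"
  proof
    assume "f = 0"
    then have "v $ j = 0" if "j < d" for j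
      using coeff[of j] that by simp
    then have "v = 0\<^sub>v d"
      using v(1) by (intro eq_vecI) auto
    with v(2) show False by simp
  qed
  then have "Polynomial.degree f < d"
    using coeff[of "Polynomial.degree f"] by (auto split: if_splits)
  moreover have "card (z ` {..<d}) = d"
    using assms by (simp add: card_image)
  moreover have "card {x. poly f x = 0} \<le> Polynomial.degree f"
    using \<open>f \<noteq> 0\<close> by (rule card_poly_roots_bound)
  ultimately show False
    using card_mono[OF poly_roots_finite[OF \<open>f \<noteq> 0\<close>] sub] by simp
qed

text \<open>Multiplication by \<open>q\<close> on the integral quotient ring modulo \<open>p\<close> has an integral matrix
  \<open>M\<close>, and the Vandermonde matrix of the roots conjugates \<open>M\<close> into the diagonal
  matrix with entries \<open>q \<zeta>\<close>.\<close>

lemma prod_poly_roots_Ints: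
  fixes p q :: "int poly" and Z :: "complex set"
  assumes monic: "Polynomial.lead_coeff p = 1" and fin: "finite Z" 
    and card: "card Z = Polynomial.degree p"
    and roots: "\<And>\<zeta>. \<zeta> \<in> Z \<Longrightarrow> poly (complex_poly p) \<zeta> = 0"
  shows "(\<Prod>\<zeta>\<in>Z. poly (complex_poly q) \<zeta>) \<in> \<int>"
proof (cases "Polynomial.degree p = 0")
  case True
  with card fin show ?thesis by simp
next
  case False
  define d where "d = Polynomial.degree p"
  obtain z where z: "bij_betw z {..<d} Z"
    using ex_bij_betw_nat_finite[OF fin] card by (auto simp: d_def atLeast0LessThan)
  have "\<exists>r. \<forall>j. (\<exists>s. Polynomial.monom 1 j * q = p * s + r j) \<and> Polynomial.degree (r j) < d"
    unfolding d_def
  proof (intro choice allI)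
    fix j
    obtain s r where "Polynomial.monom 1 j * q = p * s + r" "Polynomial.degree r < Polynomial.degree p"
      using monic_int_poly_mod[OF monic, of "Polynomial.monom 1 j * q"] False by auto
    then show "\<exists>r. (\<exists>s. Polynomial.monom 1 j * q = p * s + r) \<and> Polynomial.degree r < Polynomial.degree p"
      by blast
  qed
  then obtain r where r: "\<And>j. \<exists>s. Polynomial.monom 1 j * q = p * s + r j"
    "\<And>j. Polynomial.degree (r j) < d"
    by blast
  define M where "M = mat d d (\<lambda>(k, j). Polynomial.coeff (r j) k)"
  define V where "V = mat d d (\<lambda>(i, j). z i ^ j)"
  define D where "D = mat d d (\<lambda>(i, j). if i = j then poly (complex_poly q) (z i) else 0)"
  let ?M = "map_mat complex_of_int M"
  have carr: "M \<in> carrier_mat d d" "?M \<in> carrier_mat d d" "V \<in> carrier_mat d d" 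
      "D \<in> carrier_mat d d"
    by (auto simp: M_def V_def D_def)
  \<comment> \<open>Column j holds the values of x^j q at the roots; they equal the values of its
    remainder \<open>r j\<close>, whose coefficients form column j of \<open>M\<close>.\<close>
  have DV: "D * V = V * ?M"
  proof (rule eq_matI)
    fix i j
    assume "i < dim_row (V * ?M)" "j < dim_col (V * ?M)"
    then have ij: "i < d" "j < d"
      by (auto simp: V_def M_def)
    have "z i \<in> Z"
      using z ij by (auto simp: bij_betw_def)
    obtain s where s: "Polynomial.monom 1 j * q = p * s + r j"
      using r(1) by blast
    have "(D * V) $$ (i, j) = (\<Sum>k<d. (if i = k then poly (complex_poly q) (z i) else 0) * z k ^ j)"
      using ij by (simp add: D_def V_def scalar_prod_def atLeast0LessThan)
    also have "\<dots> = poly (complex_poly q) (z i) * z i ^ j"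
      using ij by (simp add: if_distrib[of "\<lambda>x. x * _"] sum.delta' cong: if_cong)
    also have "\<dots> = poly (complex_poly (Polynomial.monom 1 j * q)) (z i)"
      by (simp add: of_int_poly_hom.hom_mult poly_monom map_poly_monom)
    also have "\<dots> = poly (complex_poly (r j)) (z i)"
      unfolding s using roots[OF \<open>z i \<in> Z\<close>]
      by (simp add: of_int_poly_hom.hom_mult of_int_poly_hom.hom_add)
    also have "\<dots> = (\<Sum>k<d. of_int (Polynomial.coeff (r j) k) * z i ^ k)"
    proof -
      have "Polynomial.degree (complex_poly (r j)) < d"
        using r(2)[of j] by (subst degree_map_poly) auto
      then show ?thesis
        unfolding poly_altdef
        by (intro sum.mono_neutral_cong_left) (auto simp: coeff_map_poly coeff_eq_0
          dest: le_degree[of "complex_poly (r j)", unfolded coeff_map_poly])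
    qed
    also have "\<dots> = (V * ?M) $$ (i, j)"
      using ij by (simp add: M_def V_def scalar_prod_def atLeast0LessThan mult.commute)
    finally show "(D * V) $$ (i, j) = (V * ?M) $$ (i, j)" .
  qed (auto simp: D_def V_def M_def)
  have "det D * det V = det V * det ?M"
    unfolding det_mult[OF carr(4,3), symmetric] det_mult[OF carr(3,2), symmetric] DV ..
  moreover have "det V \<noteq> 0"
    unfolding V_def using z by (intro vandermonde_det_nonzero) (auto simp: bij_betw_def)
  ultimately have "det D = det ?M"
    by simp
  also have "\<dots> = of_int (det M)"
    by (simp)
  finally have "det D \<in> \<int>"
    by simp
  moreover have "det D = (\<Prod>i<d. poly (complex_poly q) (z i))"
    by (subst det_upper_triangular[OF _ carr(4)])
       (auto simp: D_def upper_triangular_def prod_list_diag_prod atLeast0LessThan)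
  moreover have "(\<Prod>i<d. poly (complex_poly q) (z i)) = (\<Prod>\<zeta>\<in>Z. poly (complex_poly q) \<zeta>)"
    using z by (rule prod.reindex_bij_betw)
  ultimately show ?thesis by simp
qed

text \<open>Minimality is known at \<open>a\<close> only, simplicity is needed at every root. The
  gcd with the derivative has too small a degree to vanish at \<open>a\<close>; hence the cofactor
  vanishes there and has full degree, the gcd is constant, and a Bezout identity evaluated at
  \<zeta> gives the contradiction.\<close>

lemma minimal_poly_no_common_root:
  fixes p :: "int poly"
  assumes "is_minimal_poly (map_poly of_int p) a" "poly (complex_poly p) \<zeta> = 0"
  shows "poly (pderiv (complex_poly p)) \<zeta> \<noteq> 0"
proof
  assume deriv: "poly (pderiv (complex_poly p)) \<zeta> = 0"
  define q :: "rat poly" where "q = map_poly of_int p"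
  have q: "Polynomial.lead_coeff q = 1" "poly (map_poly of_rat q) a = 0"
    "\<And>r. r \<noteq> 0 \<Longrightarrow> poly (map_poly of_rat r) a = 0 \<Longrightarrow> Polynomial.degree q \<le> Polynomial.degree r"
    using assms(1) by (auto simp: is_minimal_poly_def q_def)
  have to_complex: "map_poly of_rat q = complex_poly p"
    by (simp add: q_def map_poly_map_poly o_def)
  interpret of_rat_poly_hom: map_poly_comm_ring_hom "of_rat :: rat \<Rightarrow> complex"
    by unfold_locales (auto simp: of_rat_add of_rat_mult)
  have "q \<noteq> 0"
    using q(1) by auto
  have "Polynomial.degree q \<noteq> 0"
  proof
    assume "Polynomial.degree q = 0"
    then have "q = [:1:]"
      using q(1) by (metis degree_0_id)
    with q(2) show False by simp
  qed
  then have "pderiv q \<noteq> 0"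
    by (simp add: pderiv_eq_0_iff)
  define g where "g = gcd q (pderiv q)"
  have "g \<noteq> 0"
    using \<open>q \<noteq> 0\<close> by (simp add: g_def)
  obtain h where h: "q = g * h"
    unfolding g_def by (meson dvdE gcd_dvd1)
  have "h \<noteq> 0"
    using h \<open>q \<noteq> 0\<close> by auto
  have deg: "Polynomial.degree q = Polynomial.degree g + Polynomial.degree h"
    using h \<open>g \<noteq> 0\<close> \<open>h \<noteq> 0\<close> by (simp add: degree_mult_eq)
  have "Polynomial.degree g \<le> Polynomial.degree (pderiv q)"
    unfolding g_def using \<open>pderiv q \<noteq> 0\<close> by (intro dvd_imp_degree_le) auto
  then have "Polynomial.degree g < Polynomial.degree q"
    using \<open>Polynomial.degree q \<noteq> 0\<close> by (simp add: degree_pderiv)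
  then have "poly (map_poly of_rat g) a \<noteq> 0"
    using q(3)[OF \<open>g \<noteq> 0\<close>] by force
  then have "poly (map_poly of_rat h) a = 0"
    using q(2) unfolding h by (simp add: of_rat_poly_hom.hom_mult)
  then have "Polynomial.degree g = 0"
    using q(3)[OF \<open>h \<noteq> 0\<close>] deg by simp
  then obtain c where c: "g = [:c:]"
    by (rule degree_eq_zeroE)
  obtain u v where "u * q + v * pderiv q = g"
    unfolding g_def using bezout_coefficients_fst_snd[of q "pderiv q"] by blast
  then have "poly (map_poly of_rat (u * q + v * pderiv q)) \<zeta> = poly (map_poly of_rat g) \<zeta>"
    by simp
  moreover have "map_poly of_rat (pderiv q) = pderiv (complex_poly p)"
    unfolding to_complex[symmetric] by (intro poly_eqI) (simp add: coeff_pderiv coeff_map_poly of_rat_mult of_rat_add)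
  moreover have "map_poly of_rat [:c:] = [:of_rat c :: complex:]"
    by (intro poly_eqI) (simp add: coeff_map_poly coeff_pCons split: nat.split)
  ultimately have "of_rat c = (0 :: complex)"
    using assms(2) deriv to_complex
    by (simp add: of_rat_poly_hom.hom_mult of_rat_poly_hom.hom_add c)
  with c \<open>g \<noteq> 0\<close> show False by simp
qed

text \<open>Simplicity of the roots lets the set of conjugates replace the multiset of roots, so
  normalised sums over the set are averages over all roots.\<close>

lemma galois_conjugates_facts:
  fixes p :: "int poly"
  assumes "is_minimal_poly (map_poly of_int p) a"
  shows "Polynomial.lead_coeff p = 1" "a \<in> galois_conjugates p" "finite (galois_conjugates p)"
    "card (galois_conjugates p) = Polynomial.degree p"
    "complex_poly p = (\<Prod>\<zeta>\<in>galois_conjugates p. [:- \<zeta>, 1:])"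
proof -
  have lead: "Polynomial.lead_coeff (map_poly of_int p :: rat poly) = 1"
    and root: "poly (map_poly of_rat (map_poly of_int p :: rat poly)) a = 0"
    using assms by (auto simp: is_minimal_poly_def)
  show lc: "Polynomial.lead_coeff p = 1"
    using lead by (simp add: degree_map_poly coeff_map_poly)
  have "(map_poly of_rat (map_poly of_int p :: rat poly) :: complex poly) = complex_poly p"
    by (simp add: map_poly_map_poly o_def)
  with root show "a \<in> galois_conjugates p"
    by (simp add: galois_conjugates_def)
  have lc': "Polynomial.lead_coeff (complex_poly p) = 1"
    using lc by (simp add: degree_map_poly coeff_map_poly)
  then have nz: "complex_poly p \<noteq> 0"
    by auto
  then show fin: "finite (galois_conjugates p)"
    unfolding galois_conjugates_def by (rule poly_roots_finite)
  have "rsquarefree (complex_poly p)"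
    using minimal_poly_no_common_root[OF assms] by (auto simp: rsquarefree_roots)
  then show eq: "complex_poly p = (\<Prod>\<zeta>\<in>galois_conjugates p. [:- \<zeta>, 1:])"
    using complex_poly_decompose_rsquarefree[of "complex_poly p"] lc'
    by (simp add: galois_conjugates_def)
  have "Polynomial.degree p = Polynomial.degree (complex_poly p)"
    by (simp add: degree_map_poly)
  also have "\<dots> = card (galois_conjugates p)"
    unfolding eq by (subst degree_prod_eq_sum_degree) auto
  finally show "card (galois_conjugates p) = Polynomial.degree p" ..
qed

text \<open>The product of all ordered differences of roots is the product of p'(\<zeta>), hence an
  integer. It is nonzero because the differences are taken between distinct elements, so its modulus
  is at least 1.\<close>

lemma log_discriminant_nonneg:
  fixes p :: "int poly"
  assumes "is_minimal_poly (map_poly of_int p) a"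
  defines "Z \<equiv> galois_conjugates p"
  shows "0 \<le> (\<Sum>\<zeta>\<in>Z. \<Sum>\<xi>\<in>Z - {\<zeta>}. ln (cmod (\<zeta> - \<xi>)))"
proof -
  note facts = galois_conjugates_facts[OF assms(1), folded Z_def]
  have deriv: "poly (complex_poly (pderiv p)) \<zeta> = (\<Prod>\<xi>\<in>Z - {\<zeta>}. \<zeta> - \<xi>)" if "\<zeta> \<in> Z" for \<zeta>
  proof -
    have "complex_poly (pderiv p) = pderiv (complex_poly p)"
      by (intro poly_eqI) (simp add: coeff_pderiv coeff_map_poly)
    also have "complex_poly p = [:- \<zeta>, 1:] * (\<Prod>\<xi>\<in>Z - {\<zeta>}. [:- \<xi>, 1:])"
      using prod.remove[OF facts(3) that, of "\<lambda>\<xi>. [:- \<xi>, 1:]"] facts(5) by (rule trans[rotated])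
    also have "poly (pderiv \<dots>) \<zeta> = poly (\<Prod>\<xi>\<in>Z - {\<zeta>}. [:- \<xi>, 1:]) \<zeta>"
      unfolding pderiv_mult by (simp add: pderiv_pCons del: mult_pCons_left)
    finally show ?thesis
      by (simp add: poly_prod)
  qed
  define D where "D = (\<Prod>\<zeta>\<in>Z. \<Prod>\<xi>\<in>Z - {\<zeta>}. \<zeta> - \<xi>)"
  have "D \<in> \<int>"
  proof -
    have "D = (\<Prod>\<zeta>\<in>Z. poly (complex_poly (pderiv p)) \<zeta>)"
      unfolding D_def by (intro prod.cong refl deriv[symmetric])
    also have "\<dots> \<in> \<int>"
      by (rule prod_poly_roots_Ints[OF facts(1,3,4)]) (simp add: Z_def galois_conjugates_def)
    finally show ?thesis .
  qed
  moreover have "D \<noteq> 0"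
    using facts(3) by (auto simp: D_def)
  ultimately obtain m where m: "D = of_int m" "m \<noteq> 0"
    by (auto simp: Ints_def)
  then have "cmod D \<ge> 1"
    by simp
  then have "0 \<le> ln (cmod D)"
    by simp
  also have "cmod D = (\<Prod>\<zeta>\<in>Z. \<Prod>\<xi>\<in>Z - {\<zeta>}. cmod (\<zeta> - \<xi>))"
    by (simp add: D_def prod_norm)
  also have "ln \<dots> = (\<Sum>\<zeta>\<in>Z. \<Sum>\<xi>\<in>Z - {\<zeta>}. ln (cmod (\<zeta> - \<xi>)))"
  proof (subst ln_prod)
    show "(\<Sum>\<zeta>\<in>Z. ln (\<Prod>\<xi>\<in>Z - {\<zeta>}. cmod (\<zeta> - \<xi>))) = 
        (\<Sum>\<zeta>\<in>Z. \<Sum>\<xi>\<in>Z - {\<zeta>}. ln (cmod (\<zeta> - \<xi>)))"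
      using facts(3) by (intro sum.cong refl ln_prod) auto
  qed (use facts(3) in auto)
  finally show ?thesis .
qed

section \<open>Growth of the degrees\<close>

lemma coeff_prod_linear_bound:
  fixes Z :: "complex set"
  assumes "finite Z" "Z \<subseteq> cball 0 R" "R \<ge> 0"
  shows "cmod (Polynomial.coeff (\<Prod>\<zeta>\<in>Z. [:- \<zeta>, 1:]) k) \<le> (1 + R) ^ card Z"
  using assms(1,2)
proof (induction Z arbitrary: k rule: finite_induct)
  case empty
  then show ?case by (simp add: coeff_eq_0)
next
  case (insert z Z)
  let ?q = "\<Prod>\<zeta>\<in>Z. [:- \<zeta>, 1:]"
  have IH: "cmod (Polynomial.coeff ?q j) \<le> (1 + R) ^ card Z" for j
    using insert by auto
  have "cmod (Polynomial.coeff ([:- z, 1:] * ?q) k)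
      \<le> cmod z * cmod (Polynomial.coeff ?q k) + (1 + R) ^ card Z"
  proof (cases k)
    case 0
    then show ?thesis
      using assms(3) by (simp add: norm_mult)
  next
    case (Suc j)
    have "cmod (Polynomial.coeff ([:- z, 1:] * ?q) k) 
        \<le> cmod (z * Polynomial.coeff ?q k) + cmod (Polynomial.coeff ?q j)"
      unfolding Suc using norm_triangle_ineq4[of "Polynomial.coeff ?q j" "z * Polynomial.coeff ?q (Suc j)"]
      by (simp add: add.commute[of "cmod (z * _)"])
    then show ?thesis
      using IH[of j] by (simp add: norm_mult)
  qed
  also have "\<dots> \<le> R * (1 + R) ^ card Z + (1 + R) ^ card Z"
    using IH[of k] insert.prems assms(3) by (intro add_mono mult_mono) auto
  also have "\<dots> = (1 + R) ^ card (insert z Z)"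
    using insert.hyps by (simp add: algebra_simps)
  finally show ?case
    using insert.hyps by simp
qed

lemma finite_bounded_int_polys:
  "finite {p :: int poly. Polynomial.degree p \<le> D \<and> (\<forall>k. \<bar>Polynomial.coeff p k\<bar> \<le> B)}" (is "finite ?S")
proof (rule finite_subset)
  show "?S \<subseteq> Poly ` {xs. set xs \<subseteq> {-B..B} \<and> length xs \<le> Suc D}"
  proof
    fix p
    assume "p \<in> ?S"
    then have "set (coeffs p) \<subseteq> {-B..B}" "length (coeffs p) \<le> Suc D"
      by (auto simp: coeffs_def abs_le_iff minus_le_iff)
    then show "p \<in> Poly ` {xs. set xs \<subseteq> {-B..B} \<and> length xs \<le> Suc D}"
      by (intro image_eqI[of _ _ "coeffs p"]) auto
  qed
  show "finite (Poly ` {xs. set xs \<subseteq> {-B..B} \<and> length xs \<le> Suc D})"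
    by (intro finite_imageI finite_lists_length_le) auto
qed

text \<open>Northcott's argument: bounds on the degree and on all conjugates bound the integer
  coefficients, leaving finitely many polynomials and so finitely many values for an injective
  sequence.\<close>

lemma degree_minimal_polys_at_top:
  fixes P :: "nat \<Rightarrow> int poly" and a :: "nat \<Rightarrow> complex"
  assumes "inj a"
    and minimal: "\<And>n. is_minimal_poly (map_poly of_int (P n)) (a n)"
    and bounded: "eventually (\<lambda>n. galois_conjugates (P n) \<subseteq> cball 0 R) sequentially"
  shows "filterlim (\<lambda>n. Polynomial.degree (P n)) at_top sequentially"
  unfolding filterlim_at_top
proof
  fix D
  note facts = galois_conjugates_facts[OF minimal]
  define R' where "R' = max R 0"
  define S where "S = {p :: int poly. Polynomial.degree p \<le> D \<and> 
    (\<forall>k. \<bar>Polynomial.coeff p k\<bar> \<le> \<lceil>(1 + R') ^ D\<rceil>)}"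
  have "finite S"
    unfolding S_def by (rule finite_bounded_int_polys)
  \<comment> \<open>The zero polynomial is removed because its root set is the whole plane.\<close>
  then have "finite (\<Union>p\<in>S - {0}. galois_conjugates p)"
    unfolding galois_conjugates_def by (auto intro!: poly_roots_finite simp: map_poly_eq_0_iff)
  then have "finite (a -` (\<Union>p\<in>S - {0}. galois_conjugates p))"
    using \<open>inj a\<close> by (rule finite_vimageI)
  then have "eventually (\<lambda>n. n \<notin> a -` (\<Union>p\<in>S - {0}. galois_conjugates p)) sequentially"
    by (simp add: cofinite_eq_sequentially[symmetric] eventually_cofinite vimage_def)
  with bounded show "eventually (\<lambda>n. D \<le> Polynomial.degree (P n)) sequentially"
  proof eventually_elim
    case (elim n)
    show ?case
    proof (rule ccontr)
      assume *: "\<not> ?case"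
      have "P n \<in> S"
        unfolding S_def
      proof (intro CollectI conjI allI)
        fix k
        have "cmod (Polynomial.coeff (complex_poly (P n)) k) \<le> (1 + R') ^ card (galois_conjugates (P n))"
          unfolding facts(5)[of n] by (rule coeff_prod_linear_bound) (use facts elim in \<open>auto simp: R'_def\<close>)
        also have "\<dots> \<le> (1 + R') ^ D"
          using * facts(4)[of n] by (intro power_increasing) (auto simp: R'_def)
        finally show "\<bar>Polynomial.coeff (P n) k\<bar> \<le> \<lceil>(1 + R') ^ D\<rceil>"
          by (simp add: coeff_map_poly) linarith
      qed (use * in auto)
      moreover have "P n \<noteq> 0"
        using facts(1)[of n] by auto
      ultimately show False
        using elim facts(2)[of n] by auto
    qed
  qed
qed


section \<open>Conditional positive definiteness of the logarithmic kernel\<close>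

text \<open>Stands for integration against a signed measure on S of total variation at most C.
  Axiomatising only linearity and boundedness on continuous functions treats integrals, averages
  over roots, their differences and added point masses alike.\<close>

locale signed_functional =
  fixes L :: "(complex \<Rightarrow> real) \<Rightarrow> real" and S :: "complex set" and C :: real
  assumes compact: "compact S"
    and add: "continuous_on UNIV f \<Longrightarrow> continuous_on UNIV g \<Longrightarrow> L (\<lambda>x. f x + g x) = L f + L g"
    and scale: "continuous_on UNIV f \<Longrightarrow> L (\<lambda>x. c * f x) = c * L f"
    and bound: "continuous_on UNIV f \<Longrightarrow> (\<And>x. x \<in> S \<Longrightarrow> \<bar>f x\<bar> \<le> B) \<Longrightarrow> 0 \<le> B \<Longrightarrow> \<bar>L f\<bar> \<le> C * B"
    and C_nonneg: "0 \<le> C"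
begin

definition energy_form :: "(complex \<Rightarrow> complex \<Rightarrow> real) \<Rightarrow> real" where
  "energy_form G = L (\<lambda>x. L (\<lambda>y. G x y))"

abbreviation cont2 :: "(complex \<Rightarrow> complex \<Rightarrow> real) \<Rightarrow> bool" where
  "cont2 G \<equiv> continuous_on UNIV (\<lambda>p. G (fst p) (snd p))"

lemma cont2_section: "cont2 G \<Longrightarrow> continuous_on UNIV (\<lambda>y. G x y)"
  by (rule continuous_on_compose2[where f = "\<lambda>y. (x, y)" and g = "\<lambda>p. G (fst p) (snd p)", simplified])
     (auto intro!: continuous_intros)

lemma diff: "continuous_on UNIV f \<Longrightarrow> continuous_on UNIV g \<Longrightarrow> L (\<lambda>x. f x - g x) = L f - L g"
  using add[of f "\<lambda>x. (- 1) * g x"] scale[of g "-1"] by (simp add: continuous_on_minus)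

lemma zero: "L (\<lambda>x. 0) = 0"
  using scale[of "\<lambda>x. 0" 0] by simp

lemma const: "L (\<lambda>x. c) = c * L (\<lambda>x. 1)"
  using scale[of "\<lambda>x. 1" c] by simp

lemma continuous_L:
  assumes "cont2 G"
  shows "continuous_on UNIV (\<lambda>x. L (\<lambda>y. G x y))"
  unfolding continuous_on_iff
proof (intro ballI allI impI)
  fix x0 :: complex and e :: real
  assume "0 < e"
  define e' where "e' = e / (2 * (C + 1))"
  have "e' > 0"
    using \<open>0 < e\<close> C_nonneg by (simp add: e'_def)
  have "uniformly_continuous_on (cball x0 1 \<times> S) (\<lambda>p. G (fst p) (snd p))"
    using assms by (intro compact_uniformly_continuous compact_Times compact)
      (auto intro: continuous_on_subset)
  then obtain r where r: "r > 0" "\<And>p q. p \<in> cball x0 1 \<times> S \<Longrightarrow> q \<in> cball x0 1 \<times> S \<Longrightarrow> dist q p < r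
      \<Longrightarrow> dist (G (fst q) (snd q)) (G (fst p) (snd p)) < e'"
    using \<open>e' > 0\<close> unfolding uniformly_continuous_on_def by metis
  have "dist (L (\<lambda>y. G x y)) (L (\<lambda>y. G x0 y)) < e" if "dist x x0 < min r 1" for x
  proof -
    have "\<bar>G x y - G x0 y\<bar> \<le> e'" if "y \<in> S" for y
      using r(2)[of "(x0, y)" "(x, y)"] that \<open>dist x x0 < min r 1\<close>
      by (auto simp: dist_Pair_Pair dist_commute dist_real_def)
    then have "\<bar>L (\<lambda>y. G x y - G x0 y)\<bar> \<le> C * e'"
      using \<open>e' > 0\<close> by (intro bound continuous_intros cont2_section assms) auto
    also have "L (\<lambda>y. G x y - G x0 y) = L (\<lambda>y. G x y) - L (\<lambda>y. G x0 y)"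
      by (intro diff cont2_section assms)
    also have "C * e' < e"
      using \<open>0 < e\<close> C_nonneg by (simp add: e'_def field_simps add_nonneg_pos)
    finally show ?thesis
      by (simp add: dist_real_def)
  qed
  with r(1) show "\<exists>d>0. \<forall>x\<in>UNIV. dist x x0 < d \<longrightarrow> dist (L (\<lambda>y. G x y)) (L (\<lambda>y. G x0 y)) < e"
    by (intro exI[of _ "min r 1"]) auto
qed

lemma energy_form_add:
  "cont2 G \<Longrightarrow> cont2 H \<Longrightarrow> energy_form (\<lambda>x y. G x y + H x y) = energy_form G + energy_form H"
  unfolding energy_form_def add[OF continuous_L continuous_L, symmetric]
  by (intro arg_cong[of _ _ L] ext add cont2_section)

lemma energy_form_diff:
  "cont2 G \<Longrightarrow> cont2 H \<Longrightarrow> energy_form (\<lambda>x y. G x y - H x y) = energy_form G - energy_form H"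
  unfolding energy_form_def diff[OF continuous_L continuous_L, symmetric]
  by (intro arg_cong[of _ _ L] ext diff cont2_section)

lemma energy_form_scale: "cont2 G \<Longrightarrow> energy_form (\<lambda>x y. c * G x y) = c * energy_form G"
  unfolding energy_form_def scale[OF continuous_L, symmetric]
  by (intro arg_cong[of _ _ L] ext scale cont2_section)

lemma energy_form_sum:
  "finite I \<Longrightarrow> (\<And>i. i \<in> I \<Longrightarrow> cont2 (G i)) \<Longrightarrow>
     energy_form (\<lambda>x y. \<Sum>i\<in>I. G i x y) = (\<Sum>i\<in>I. energy_form (G i))"
proof (induction I rule: finite_induct)
  case empty
  then show ?case by (simp add: energy_form_def zero)
next
  case (insert i I)
  then have "energy_form (\<lambda>x y. G i x y + (\<Sum>i\<in>I. G i x y)) =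
      energy_form (G i) + energy_form (\<lambda>x y. \<Sum>i\<in>I. G i x y)"
    by (intro energy_form_add continuous_on_sum) auto
  with insert show ?case by simp
qed

lemma energy_form_bound:
  assumes "cont2 G" "\<And>x y. x \<in> S \<Longrightarrow> y \<in> S \<Longrightarrow> \<bar>G x y\<bar> \<le> B" "0 \<le> B"
  shows "\<bar>energy_form G\<bar> \<le> C * (C * B)"
  unfolding energy_form_def
  using assms C_nonneg by (intro bound continuous_L) (auto intro!: cont2_section)

lemma energy_form_tendsto:
  assumes G: "\<And>n. cont2 (G n)" "cont2 H"
    and unif: "uniform_limit (S \<times> S) (\<lambda>n p. G n (fst p) (snd p)) (\<lambda>p. H (fst p) (snd p)) sequentially"
  shows "(\<lambda>n. energy_form (G n)) \<longlonglongrightarrow> energy_form H"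
proof (rule tendstoI)
  fix e :: real
  assume "0 < e"
  define e' where "e' = e / (2 * (C * C + 1))"
  have "e' > 0"
    using \<open>0 < e\<close> C_nonneg by (simp add: e'_def add_nonneg_pos)
  have "eventually (\<lambda>n. \<forall>p\<in>S \<times> S. dist (G n (fst p) (snd p)) (H (fst p) (snd p)) < e') sequentially"
    using unif \<open>e' > 0\<close> by (auto simp: uniform_limit_iff)
  then show "eventually (\<lambda>n. dist (energy_form (G n)) (energy_form H) < e) sequentially"
  proof eventually_elim
    case (elim n)
    have "\<bar>G n x y - H x y\<bar> \<le> e'" if "x \<in> S" "y \<in> S" for x y
    proof -
      have "(x, y) \<in> S \<times> S" using that by simp
      with elim show ?thesis by (fastforce simp: dist_real_def)
    qed
    then have "\<bar>energy_form (\<lambda>x y. G n x y - H x y)\<bar> \<le> C * (C * e')"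
      using \<open>e' > 0\<close> G by (intro energy_form_bound continuous_intros) auto
    also have "C * (C * e') = (C * C) / (C * C + 1) * (e / 2)"
      by (simp add: e'_def mult_ac)
    also have "\<dots> \<le> 1 * (e / 2)"
      using \<open>0 < e\<close> C_nonneg by (intro mult_right_mono) (auto simp: divide_le_eq_1 add_nonneg_pos)
    also have "\<dots> < e"
      using \<open>0 < e\<close> by simp
    finally show ?case
      using G by (simp add: energy_form_diff dist_real_def)
  qed
qed

text \<open>The weight h makes the notion stable under multiplication by rank-one kernels, since
  such a factor is absorbed into h. Nonnegativity of the energy alone would not give that, and
  powers of the chordal kernel are built up in this way.\<close>

definition psd :: "(complex \<Rightarrow> complex \<Rightarrow> real) \<Rightarrow> bool" where
  "psd G \<longleftrightarrow> cont2 G \<and> (\<forall>h. continuous_on UNIV h \<longrightarrow> 0 \<le> energy_form (\<lambda>x y. h x * h y * G x y))"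

lemma continuous_on_fst': "continuous_on UNIV h \<Longrightarrow> continuous_on UNIV (\<lambda>p. h (fst p))"
  and continuous_on_snd': "continuous_on UNIV h \<Longrightarrow> continuous_on UNIV (\<lambda>p. h (snd p))"
  by (rule continuous_on_compose2[where f = fst] continuous_on_compose2[where f = snd];
      auto intro!: continuous_intros)+

lemma psd_energy_nonneg: "psd G \<Longrightarrow> 0 \<le> energy_form G"
  unfolding psd_def by (auto dest!: spec[of _ "\<lambda>_. 1"])

lemma psd_one: "psd (\<lambda>x y. 1)"
  unfolding psd_def
proof (intro conjI allI impI)
  fix h :: "complex \<Rightarrow> real"
  assume h: "continuous_on UNIV h"
  have "energy_form (\<lambda>x y. h x * h y * 1) = L h * L h"
    unfolding energy_form_def using scale[OF h] scale[OF h, of "L h"]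
    by (simp add: mult.commute)
  then show "0 \<le> energy_form (\<lambda>x y. h x * h y * 1)"
    by simp
qed (intro continuous_intros)

lemma psd_zero: "psd (\<lambda>x y. 0)"
  unfolding psd_def energy_form_def by (simp add: zero)

lemma psd_add:
  assumes G: "psd G" and H: "psd H"
  shows "psd (\<lambda>x y. G x y + H x y)"
  unfolding psd_def distrib_left
proof (intro conjI allI impI)
  have GH: "cont2 G" "cont2 H"
    using G H by (simp_all add: psd_def)
  note [continuous_intros] = GH
  show "cont2 (\<lambda>x y. G x y + H x y)"
    by (intro continuous_intros)
  fix h :: "complex \<Rightarrow> real"
  assume h: "continuous_on UNIV h"
  note [continuous_intros] = continuous_on_fst'[OF h] continuous_on_snd'[OF h]
  have "energy_form (\<lambda>x y. h x * h y * G x y + h x * h y * H x y) =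
      energy_form (\<lambda>x y. h x * h y * G x y) + energy_form (\<lambda>x y. h x * h y * H x y)"
    by (rule energy_form_add) (intro continuous_intros)+
  then show "0 \<le> energy_form (\<lambda>x y. h x * h y * G x y + h x * h y * H x y)"
    using G H h by (simp add: psd_def)
qed

lemma psd_rank_one:
  assumes G: "psd G" and \<phi>: "continuous_on UNIV \<phi>" and c: "0 \<le> c"
  shows "psd (\<lambda>x y. c * (\<phi> x * \<phi> y) * G x y)"
  unfolding psd_def
proof (intro conjI allI impI)
  note [continuous_intros] = continuous_on_fst'[OF \<phi>] continuous_on_snd'[OF \<phi>]
  have G': "cont2 G"
    using G by (simp add: psd_def)
  note [continuous_intros] = G'
  show "cont2 (\<lambda>x y. c * (\<phi> x * \<phi> y) * G x y)"
    by (intro continuous_intros)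
  fix h :: "complex \<Rightarrow> real"
  assume h: "continuous_on UNIV h"
  note [continuous_intros] = continuous_on_fst'[OF h] continuous_on_snd'[OF h]
  have "continuous_on UNIV (\<lambda>x. h x * \<phi> x)"
    using h \<phi> by (rule continuous_on_mult)
  then have "0 \<le> c * energy_form (\<lambda>x y. (h x * \<phi> x) * (h y * \<phi> y) * G x y)"
    using G c by (simp add: psd_def)
  also have "\<dots> = energy_form (\<lambda>x y. c * ((h x * \<phi> x) * (h y * \<phi> y) * G x y))"
    by (rule energy_form_scale[symmetric]) (intro continuous_intros)
  finally show "0 \<le> energy_form (\<lambda>x y. h x * h y * (c * (\<phi> x * \<phi> y) * G x y))"
    by (simp add: mult_ac)
qed

end

text \<open>At e = 0 the numerator is |1 + x cnj(y)|^2, and the kernel is the squared cosine of half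
  the spherical angle between the stereographic images; 1 minus it is a quarter of the squared
  chordal distance. Lowering the constant term by e turns |x - y|^2 into e + |x - y|^2
  there.\<close>

definition chordal_kernel :: "real \<Rightarrow> complex \<Rightarrow> complex \<Rightarrow> real" where
  "chordal_kernel e x y = ((1 - e) + 2 * (Re x * Re y + Im x * Im y) + (cmod x)\<^sup>2 * (cmod y)\<^sup>2)
     / ((1 + (cmod x)\<^sup>2) * (1 + (cmod y)\<^sup>2))"

text \<open>Tends to -2 ln |x - y|, twice the kernel in \<open>energy\<close>, as e tends to 0; this
  is the source of the factors 2 further on. It is finite on the diagonal.\<close>

definition log_kernel_reg :: "real \<Rightarrow> complex \<Rightarrow> complex \<Rightarrow> real" where
  "log_kernel_reg e x y = - ln (e + (cmod (x - y))\<^sup>2)"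

lemma one_plus_cmod_pos: "0 < 1 + (cmod x)\<^sup>2"
  by (simp add: add_pos_nonneg)

lemma one_minus_chordal_kernel:
  "(1 + (cmod x)\<^sup>2) * (1 + (cmod y)\<^sup>2) * (1 - chordal_kernel e x y) = e + (cmod (x - y))\<^sup>2"
proof -
  have "(1 + (cmod x)\<^sup>2) * (1 + (cmod y)\<^sup>2) * (1 - chordal_kernel e x y) =
     (1 + (cmod x)\<^sup>2) * (1 + (cmod y)\<^sup>2) - 
     ((1 - e) + 2 * (Re x * Re y + Im x * Im y) + (cmod x)\<^sup>2 * (cmod y)\<^sup>2)"
    using one_plus_cmod_pos[of x] one_plus_cmod_pos[of y] 
    by (simp add: chordal_kernel_def right_diff_distrib)
  also have "\<dots> = e + (cmod (x - y))\<^sup>2"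
    unfolding cmod_power2 by (simp add: power2_eq_square algebra_simps)
  finally show ?thesis .
qed

text \<open>Multiplied by the weights, 1 - t becomes e + |x - y|^2 and 1 + t a positive sum
  containing |x + y|^2. The strict bound puts every kernel value inside the disc of convergence of -
  ln (1 - t).\<close>

lemma abs_chordal_kernel_less_1:
  assumes "0 < e" "e \<le> 1"
  shows "\<bar>chordal_kernel e x y\<bar> < 1"
proof -
  let ?A = "(1 + (cmod x)\<^sup>2) * (1 + (cmod y)\<^sup>2)"
  have A: "?A > 0"
    using one_plus_cmod_pos by simp
  have "0 < ?A * (1 - chordal_kernel e x y)"
    unfolding one_minus_chordal_kernel using assms by (simp add: add_pos_nonneg)
  moreover have "?A * (1 + chordal_kernel e x y) = 
      ?A + ((1 - e) + 2 * (Re x * Re y + Im x * Im y) + (cmod x)\<^sup>2 * (cmod y)\<^sup>2)"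
    using A by (simp add: chordal_kernel_def distrib_left)
  then have "?A * (1 + chordal_kernel e x y) = 
      (1 - e) + 1 + (cmod (x + y))\<^sup>2 + 2 * ((cmod x)\<^sup>2 * (cmod y)\<^sup>2)"
    unfolding cmod_power2 by (simp add: power2_eq_square algebra_simps)
  then have "0 < ?A * (1 + chordal_kernel e x y)"
    using assms by (simp add: add_pos_nonneg add_nonneg_nonneg)
  ultimately show ?thesis
    using A by (auto simp: zero_less_mult_iff)
qed

lemma continuous_chordal_kernel:
  "continuous_on UNIV (\<lambda>p. chordal_kernel e (fst p) (snd p))"
  unfolding chordal_kernel_def
  by (intro continuous_intros) (use one_plus_cmod_pos in \<open>auto simp: less_imp_neq[THEN not_sym]\<close>)

lemma continuous_log_kernel_reg:
  "0 < e \<Longrightarrow> continuous_on UNIV (\<lambda>p. log_kernel_reg e (fst p) (snd p))"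
  unfolding log_kernel_reg_def
  by (intro continuous_intros) (auto simp: add_pos_nonneg less_imp_neq[THEN not_sym])

lemma log_kernel_reg_eq:
  assumes "0 < e" "e \<le> 1"
  shows "log_kernel_reg e x y = 
    - ln (1 + (cmod x)\<^sup>2) - ln (1 + (cmod y)\<^sup>2) - ln (1 - chordal_kernel e x y)"
proof -
  have pos: "0 < 1 - chordal_kernel e x y"
    using abs_chordal_kernel_less_1[OF assms, of x y] by linarith
  have "ln (e + (cmod (x - y))\<^sup>2) =
      ln ((1 + (cmod x)\<^sup>2) * (1 + (cmod y)\<^sup>2) * (1 - chordal_kernel e x y))"
    by (simp only: one_minus_chordal_kernel)
  also have "\<dots> = ln (1 + (cmod x)\<^sup>2) + ln (1 + (cmod y)\<^sup>2) + ln (1 - chordal_kernel e x y)"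
    using pos one_plus_cmod_pos[of x] one_plus_cmod_pos[of y] by (simp add: ln_mult_pos)
  finally show ?thesis
    by (simp add: log_kernel_reg_def)
qed

lemma minus_ln_one_minus_sums:
  fixes k :: real
  assumes "\<bar>k\<bar> < 1"
  shows "(\<Sum>m. k ^ Suc m / real (Suc m)) = - ln (1 - k)"
proof -
  have "ln (1 - k) = (\<Sum>n. (-1) ^ n * (1 / real (n + 1)) * ((1 - k) - 1) ^ Suc n)"
    using assms by (intro ln_series) auto
  also have "\<dots> = (\<Sum>n. - (k ^ Suc n / real (Suc n)))"
  proof (rule suminf_cong)
    fix n
    have "(-1) ^ n * ((1 - k) - 1) ^ Suc n = - (k ^ Suc n)"
      by (simp add: power_minus[of k] flip: power_add)
    then show "(-1) ^ n * (1 / real (n + 1)) * ((1 - k) - 1) ^ Suc n = - (k ^ Suc n / real (Suc n))"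
      by (simp add: field_simps)
  qed
  also have "\<dots> = - (\<Sum>n. k ^ Suc n / real (Suc n))"
  proof (rule suminf_minus)
    have "summable (\<lambda>n. \<bar>k\<bar> ^ Suc n)"
      using assms by (subst summable_Suc_iff) (auto intro: summable_geometric)
    then show "summable (\<lambda>n. k ^ Suc n / real (Suc n))"
    proof (rule summable_comparison_test'[of _ 0])
      fix n
      have "\<bar>k\<bar> ^ Suc n / real (Suc n) \<le> \<bar>k\<bar> ^ Suc n / 1"
        by (intro divide_left_mono) auto
      then show "norm (k ^ Suc n / real (Suc n)) \<le> \<bar>k\<bar> ^ Suc n"
        by (simp only: real_norm_def abs_divide power_abs)
    qed
  qed
  finally show ?thesis by simp
qed

context signed_functional
begin

text \<open>The chordal kernel is a sum of four rank-one kernels, made from 1, Re, Im and the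
  squared modulus over the weight, with coefficients 1 - e, 2, 2 and 1; \<open>e \<le> 1\<close>
  keeps the first nonnegative.\<close>

lemma psd_chordal_mult:
  assumes "psd G" "0 \<le> e" "e \<le> 1"
  shows "psd (\<lambda>x y. chordal_kernel e x y * G x y)"
proof -
  let ?\<psi> = "\<lambda>x. 1 / (1 + (cmod x)\<^sup>2)"
  have \<psi>: "continuous_on UNIV ?\<psi>"
    by (intro continuous_intros) (use one_plus_cmod_pos in \<open>auto simp: less_imp_neq[THEN not_sym]\<close>)
  have "psd (\<lambda>x y. (1 - e) * (?\<psi> x * ?\<psi> y) * G x y
      + (2 * ((Re x * ?\<psi> x) * (Re y * ?\<psi> y)) * G x y
      + (2 * ((Im x * ?\<psi> x) * (Im y * ?\<psi> y)) * G x y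
      + 1 * (((cmod x)\<^sup>2 * ?\<psi> x) * ((cmod y)\<^sup>2 * ?\<psi> y)) * G x y)))"
    using assms by (intro psd_add psd_rank_one continuous_on_mult \<psi> continuous_intros) auto
  also have "(\<lambda>x y. (1 - e) * (?\<psi> x * ?\<psi> y) * G x y
      + (2 * ((Re x * ?\<psi> x) * (Re y * ?\<psi> y)) * G x y
      + (2 * ((Im x * ?\<psi> x) * (Im y * ?\<psi> y)) * G x y
      + 1 * (((cmod x)\<^sup>2 * ?\<psi> x) * ((cmod y)\<^sup>2 * ?\<psi> y)) * G x y)))
      = (\<lambda>x y. chordal_kernel e x y * G x y)"
    by (intro ext) (simp add: chordal_kernel_def add_divide_distrib distrib_left distrib_right)
  finally show ?thesis .
qed

lemma psd_chordal_power: "0 \<le> e \<Longrightarrow> e \<le> 1 \<Longrightarrow> psd (\<lambda>x y. chordal_kernel e x y ^ m)"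
  by (induction m) (auto intro: psd_one psd_chordal_mult)

text \<open>Two chordal kernels differ by a nonnegative rank-one kernel, and a^(m+1) - b^(m+1) = a
  (a^m - b^m) + (a - b) b^m carries semidefiniteness to the powers.\<close>

lemma psd_chordal_power_diff:
  assumes "0 \<le> e" "e \<le> e'" "e' \<le> 1"
  shows "psd (\<lambda>x y. chordal_kernel e x y ^ m - chordal_kernel e' x y ^ m)"
proof (induction m)
  case 0
  then show ?case by (simp add: psd_zero)
next
  case (Suc m)
  let ?\<psi> = "\<lambda>x. 1 / (1 + (cmod x)\<^sup>2)"
  have \<psi>: "continuous_on UNIV ?\<psi>"
    by (intro continuous_intros) (use one_plus_cmod_pos in \<open>auto simp: less_imp_neq[THEN not_sym]\<close>)
  have diff: "chordal_kernel e x y - chordal_kernel e' x y = (e' - e) * (?\<psi> x * ?\<psi> y)" for x y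
    by (simp add: chordal_kernel_def flip: diff_divide_distrib)
  have "psd (\<lambda>x y. chordal_kernel e x y * (chordal_kernel e x y ^ m - chordal_kernel e' x y ^ m)
      + (e' - e) * (?\<psi> x * ?\<psi> y) * chordal_kernel e' x y ^ m)"
    using assms by (intro psd_add psd_chordal_mult Suc psd_rank_one psd_chordal_power \<psi>) auto
  then show ?case
    unfolding diff[symmetric] by (simp add: algebra_simps)
qed

text \<open>Up to functions of one variable, which do not contribute when the total mass vanishes, the
  regularised logarithmic kernel is the power series of \<open>- ln (1 - t)\<close> at the positive
  semidefinite chordal kernel.\<close>

lemma energy_form_log_kernel_reg_sums:
  assumes mass: "L (\<lambda>_. 1) = 0" and e: "0 < e" "e \<le> 1"
  shows "(\<lambda>n. \<Sum>m<n. energy_form (\<lambda>x y. chordal_kernel e x y ^ Suc m) / real (Suc m))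
           \<longlonglongrightarrow> energy_form (log_kernel_reg e)"
proof -
  define G where "G n x y = (\<Sum>m<n. chordal_kernel e x y ^ Suc m / real (Suc m))" for n x y
  define H where "H x y = - ln (1 - chordal_kernel e x y)" for x y
  have less: "\<bar>chordal_kernel e x y\<bar> < 1" for x y
    by (rule abs_chordal_kernel_less_1[OF e])
  note [continuous_intros] = continuous_chordal_kernel
  have contH: "cont2 H"
    unfolding H_def
  proof (intro continuous_intros ballI)
    fix p :: "complex \<times> complex"
    show "1 - chordal_kernel e (fst p) (snd p) \<noteq> 0"
      using less[of "fst p" "snd p"] by auto
  qed
  have contK: "cont2 (\<lambda>x y. chordal_kernel e x y ^ Suc m)" for m
    by (intro continuous_intros)
  have contK': "cont2 (\<lambda>x y. chordal_kernel e x y ^ Suc m / real (Suc m))" for m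
    unfolding divide_inverse by (intro continuous_intros)
  have contG: "cont2 (G n)" for n
    unfolding G_def by (intro continuous_on_sum contK')
  \<comment> \<open>Compactness turns the pointwise strict bound into a uniform one, which yields a
    geometric majorant on S x S; the energy depends on values there only.\<close>
  obtain q where q: "q < 1" "0 \<le> q" "\<And>x y. x \<in> S \<Longrightarrow> y \<in> S \<Longrightarrow> \<bar>chordal_kernel e x y\<bar> \<le> q"
  proof (cases "S = {}")
    case True
    then show ?thesis by (intro that[of 0]) auto
  next
    case False
    have "continuous_on (S \<times> S) (\<lambda>p. \<bar>chordal_kernel e (fst p) (snd p)\<bar>)"
      by (rule continuous_on_subset[of UNIV]) (intro continuous_intros, simp)
    then obtain p where "p \<in> S \<times> S" 
      "\<And>p'. p' \<in> S \<times> S \<Longrightarrow> \<bar>chordal_kernel e (fst p') (snd p')\<bar> \<le> \<bar>chordal_kernel e (fst p) (snd p)\<bar>"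
      using continuous_attains_sup[of "S \<times> S"] False compact_Times[OF compact compact] by blast
    then show ?thesis
      using less by (intro that[of "\<bar>chordal_kernel e (fst p) (snd p)\<bar>"]) auto
  qed
  have "(\<lambda>n. energy_form (G n)) \<longlonglongrightarrow> energy_form H"
  proof (rule energy_form_tendsto[OF contG contH])
    have "uniform_limit (S \<times> S) (\<lambda>n p. \<Sum>m<n. chordal_kernel e (fst p) (snd p) ^ Suc m / real (Suc m))
        (\<lambda>p. \<Sum>m. chordal_kernel e (fst p) (snd p) ^ Suc m / real (Suc m)) sequentially"
    proof (rule Weierstrass_m_test[where M = "\<lambda>m. q ^ Suc m"])
      show "summable (\<lambda>m. q ^ Suc m)"
        using q by (subst summable_Suc_iff) (auto intro: summable_geometric)
      fix m and p :: "complex \<times> complex"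
      assume p: "p \<in> S \<times> S"
      let ?k = "chordal_kernel e (fst p) (snd p)"
      have "\<bar>?k\<bar> ^ Suc m / real (Suc m) \<le> \<bar>?k\<bar> ^ Suc m / 1"
        by (intro divide_left_mono) auto
      also have "\<dots> \<le> q ^ Suc m"
        unfolding div_by_1 using q(3)[of "fst p" "snd p"] p by (intro power_mono) auto
      finally show "norm (?k ^ Suc m / real (Suc m)) \<le> q ^ Suc m"
        by (simp only: real_norm_def abs_divide power_abs)
    qed
    then show "uniform_limit (S \<times> S) (\<lambda>n p. G n (fst p) (snd p)) (\<lambda>p. H (fst p) (snd p)) sequentially"
      unfolding G_def H_def minus_ln_one_minus_sums[OF less] .
  qed
  moreover have "energy_form (G n) = 
      (\<Sum>m<n. energy_form (\<lambda>x y. chordal_kernel e x y ^ Suc m) / real (Suc m))" for n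
  proof -
    have "energy_form (\<lambda>x y. (1 / real (Suc m)) * chordal_kernel e x y ^ Suc m) =
        (1 / real (Suc m)) * energy_form (\<lambda>x y. chordal_kernel e x y ^ Suc m)" for m
      by (rule energy_form_scale[OF contK])
    then have "energy_form (\<lambda>x y. chordal_kernel e x y ^ Suc m / real (Suc m)) =
        energy_form (\<lambda>x y. chordal_kernel e x y ^ Suc m) / real (Suc m)" for m
      by simp
    then show ?thesis
      unfolding G_def by (subst energy_form_sum[OF _ contK']) simp_all
  qed
  moreover have "energy_form H = energy_form (log_kernel_reg e)"
  proof -
    define a where "a x = - ln (1 + (cmod x)\<^sup>2)" for x
    have a: "continuous_on UNIV a"
      unfolding a_def 
      by (intro continuous_intros) (use one_plus_cmod_pos in \<open>auto simp: less_imp_neq[THEN not_sym]\<close>)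
    \<comment> \<open>A function of one variable contributes nothing: integrating it in the other
      variable gives the total mass, which is 0.\<close>
    have one: "energy_form (\<lambda>x y. a x) = 0" 
      unfolding energy_form_def const[of "a _"] by (simp add: mass zero)
    have two: "energy_form (\<lambda>x y. a y) = 0" 
      unfolding energy_form_def const[of "L a"] by (simp add: mass)
    have "energy_form (\<lambda>x y. a x + (a y + H x y)) = energy_form H"
      using contH by (subst energy_form_add energy_form_add[of "\<lambda>x y. a y" H];
        simp add: one two continuous_on_fst'[OF a] continuous_on_snd'[OF a] continuous_on_add)+
    also have "(\<lambda>x y. a x + (a y + H x y)) = log_kernel_reg e"
      by (intro ext) (simp add: log_kernel_reg_eq[OF e] H_def a_def)
    finally show ?thesis ..
  qed
  ultimately show ?thesis by simp
qed

lemma energy_form_log_kernel_reg_nonneg: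
  assumes "L (\<lambda>_. 1) = 0" "0 < e" "e \<le> 1"
  shows "0 \<le> energy_form (log_kernel_reg e)"
  using energy_form_log_kernel_reg_sums[OF assms]
  by (rule LIMSEQ_le_const)
     (use assms in \<open>auto intro!: sum_nonneg divide_nonneg_nonneg psd_energy_nonneg psd_chordal_power simp del: power_Suc\<close>)

text \<open>Pointwise monotonicity of the kernel gives nothing for a signed functional. The
  comparison holds term by term in the power series, by semidefiniteness of differences of
  powers.\<close>

lemma energy_form_log_kernel_reg_antimono:
  assumes mass: "L (\<lambda>_. 1) = 0" and e: "0 < e" "e \<le> e'" "e' \<le> 1"
  shows "energy_form (log_kernel_reg e') \<le> energy_form (log_kernel_reg e)"
proof (rule LIMSEQ_le)
  show "(\<lambda>n. \<Sum>m<n. energy_form (\<lambda>x y. chordal_kernel e x y ^ Suc m) / real (Suc m))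
          \<longlonglongrightarrow> energy_form (log_kernel_reg e)"
    by (rule energy_form_log_kernel_reg_sums) (use assms in auto)
  show "(\<lambda>n. \<Sum>m<n. energy_form (\<lambda>x y. chordal_kernel e' x y ^ Suc m) / real (Suc m))
          \<longlonglongrightarrow> energy_form (log_kernel_reg e')"
    by (rule energy_form_log_kernel_reg_sums) (use assms in auto)
  have "energy_form (\<lambda>x y. chordal_kernel e' x y ^ Suc m) \<le> energy_form (\<lambda>x y. chordal_kernel e x y ^ Suc m)" for m
  proof -
    have "0 \<le> energy_form (\<lambda>x y. chordal_kernel e x y ^ Suc m - chordal_kernel e' x y ^ Suc m)"
      using e by (intro psd_energy_nonneg psd_chordal_power_diff) auto
    also have "\<dots> = energy_form (\<lambda>x y. chordal_kernel e x y ^ Suc m) 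
        - energy_form (\<lambda>x y. chordal_kernel e' x y ^ Suc m)"
      by (intro energy_form_diff continuous_on_power continuous_chordal_kernel)
    finally show ?thesis by simp
  qed
  then show "\<exists>N. \<forall>n\<ge>N. (\<Sum>m<n. energy_form (\<lambda>x y. chordal_kernel e' x y ^ Suc m) / real (Suc m))
      \<le> (\<Sum>m<n. energy_form (\<lambda>x y. chordal_kernel e x y ^ Suc m) / real (Suc m))"
    by (intro exI[of _ 0] allI impI sum_mono divide_right_mono) auto
qed

text \<open>L perturbed by t times the difference of point masses at z and y still has mass zero, so
  its energy is a nonnegative quadratic polynomial in t. Its t^2 coefficient, the energy of the two
  point masses, is the last factor. Only differences of potentials are controlled in this
  way.\<close>

lemma log_kernel_reg_cauchy_schwarz:
  assumes mass: "L (\<lambda>_. 1) = 0" and e: "0 < e" "e \<le> 1" and "z \<noteq> y"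
  shows "(L (log_kernel_reg e z) - L (log_kernel_reg e y))\<^sup>2
           \<le> energy_form (log_kernel_reg e) * (2 * ln ((e + (cmod (z - y))\<^sup>2) / e))"
proof -
  let ?K = "log_kernel_reg e"
  define b where "b = L (?K z) - L (?K y)"
  define c where "c = 2 * ln ((e + (cmod (z - y))\<^sup>2) / e)"
  have contK: "cont2 ?K"
    using e by (intro continuous_log_kernel_reg)
  have cont: "continuous_on UNIV (\<lambda>y. ?K x y)" for x
    by (rule cont2_section[OF contK])
  have sym: "?K x y = ?K y x" for x y
    by (simp add: log_kernel_reg_def norm_minus_commute)
  have quad: "0 \<le> energy_form ?K + 2 * t * b + t\<^sup>2 * c" for t
  proof -
    define L' where "L' f = L f + t * (f z - f y)" for f
    interpret L': signed_functional L' "insert z (insert y S)" "C + 2 * \<bar>t\<bar>"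
    proof
      show "compact (insert z (insert y S))"
        using compact by simp
      show "L' (\<lambda>x. f x + g x) = L' f + L' g" if "continuous_on UNIV f" "continuous_on UNIV g" for f g
        using that by (simp add: L'_def add algebra_simps)
      show "L' (\<lambda>x. c * f x) = c * L' f" if "continuous_on UNIV f" for f c
        using that by (simp add: L'_def scale algebra_simps)
      show "0 \<le> C + 2 * \<bar>t\<bar>"
        using C_nonneg by simp
      fix f :: "complex \<Rightarrow> real" and B
      assume f: "continuous_on UNIV f" "\<And>x. x \<in> insert z (insert y S) \<Longrightarrow> \<bar>f x\<bar> \<le> B" "0 \<le> B"
      have "\<bar>L f\<bar> \<le> C * B"
        using f by (intro bound) auto
      moreover have "\<bar>f z - f y\<bar> \<le> 2 * B"
        using f(2)[of z] f(2)[of y] by auto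
      then have "\<bar>t * (f z - f y)\<bar> \<le> \<bar>t\<bar> * (2 * B)"
        unfolding abs_mult by (intro mult_left_mono) auto
      ultimately show "\<bar>L' f\<bar> \<le> (C + 2 * \<bar>t\<bar>) * B"
        unfolding L'_def by (simp add: algebra_simps)
    qed
    have "0 \<le> L'.energy_form ?K"
      using e mass by (intro L'.energy_form_log_kernel_reg_nonneg) (auto simp: L'_def)
    also have "L'.energy_form ?K = L (\<lambda>x. L (?K x) + t * (?K z x - ?K y x))
        + t * (b + t * (?K z z - ?K z y - (?K y z - ?K y y)))"
    proof -
      have eq: "L' (?K x) = L (?K x) + t * (?K z x - ?K y x)" for x
        unfolding L'_def using sym[of x z] sym[of x y] by simp
      have arith: "u + t * ((p + t * (a1 - a2)) - (q + t * (a3 - a4)))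
          = u + t * ((p - q) + t * (a1 - a3 - (a2 - a4)))" for u p q a1 a2 a3 a4 :: real
        by (simp add: algebra_simps)
      have "L'.energy_form ?K = L' (\<lambda>x. L (?K x) + t * (?K z x - ?K y x))"
        unfolding L'.energy_form_def eq ..
      then show ?thesis
        unfolding L'_def[of "\<lambda>x. L (?K x) + t * (?K z x - ?K y x)"] arith b_def .
    qed
    also have "L (\<lambda>x. L (?K x) + t * (?K z x - ?K y x)) = energy_form ?K + t * b"
    proof -
      have D: "continuous_on UNIV (\<lambda>x. ?K z x - ?K y x)"
        by (intro continuous_on_diff cont)
      have "L (\<lambda>x. L (?K x) + t * (?K z x - ?K y x)) = L (\<lambda>x. L (?K x)) + L (\<lambda>x. t * (?K z x - ?K y x))"
        by (intro add continuous_L[OF contK] continuous_on_mult_left D)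
      also have "L (\<lambda>x. t * (?K z x - ?K y x)) = t * L (\<lambda>x. ?K z x - ?K y x)"
        by (rule scale[OF D])
      also have "L (\<lambda>x. ?K z x - ?K y x) = b"
        unfolding b_def by (rule diff[OF cont cont])
      finally show ?thesis
        by (simp add: energy_form_def)
    qed
    also have "?K z z - ?K z y - (?K y z - ?K y y) = c"
    proof -
      have "0 < e + (cmod (z - y))\<^sup>2"
        using e by (simp add: add_pos_nonneg)
      then show ?thesis
        using e by (simp add: log_kernel_reg_def c_def ln_div norm_minus_commute)
    qed
    finally show ?thesis
      by (simp add: algebra_simps power2_eq_square)
  qed
  have "(cmod (z - y))\<^sup>2 > 0"
    using \<open>z \<noteq> y\<close> by simp
  then have "c > 0"
    using e by (auto simp: c_def intro!: ln_gt_zero simp: less_divide_eq)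
  \<comment> \<open>The quadratic polynomial is minimal at t = - b / c; c > 0 because z and y
    differ.\<close>
  have "0 \<le> energy_form ?K - b\<^sup>2 / c"
    using quad[of "- b / c"] \<open>c > 0\<close> by (simp add: power2_eq_square field_simps)
  then show ?thesis
    using \<open>c > 0\<close> by (simp add: field_simps b_def c_def)
qed

end

section \<open>Functionals given by measures and by finite sets\<close>

lemma signed_functional_diff:
  assumes "signed_functional M S A" "signed_functional N S B"
  shows "signed_functional (\<lambda>f. M f - N f) S (A + B)"
proof -
  interpret M: signed_functional M S A by fact
  interpret N: signed_functional N S B by fact
  show ?thesis
  proof
    fix f :: "complex \<Rightarrow> real" and b
    assume f: "continuous_on UNIV f" "\<And>x. x \<in> S \<Longrightarrow> \<bar>f x\<bar> \<le> b" "0 \<le> b"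
    show "\<bar>M f - N f\<bar> \<le> (A + B) * b"
      using M.bound[OF f] N.bound[OF f] by (simp add: algebra_simps)
  next
    fix f g :: "complex \<Rightarrow> real" and c
    assume f: "continuous_on UNIV f"
    show "M (\<lambda>x. c * f x) - N (\<lambda>x. c * f x) = c * (M f - N f)"
      using M.scale[OF f] N.scale[OF f] by (simp add: right_diff_distrib)
    assume g: "continuous_on UNIV g"
    show "M (\<lambda>x. f x + g x) - N (\<lambda>x. f x + g x) = M f - N f + (M g - N g)"
      using M.add[OF f g] N.add[OF f g] by simp
  qed (use M.compact M.C_nonneg N.C_nonneg in simp_all)
qed

lemma signed_functional_integral:
  assumes "prob_space \<nu>" "sets \<nu> = sets borel" "emeasure \<nu> S = 1" "compact S"
  shows "signed_functional (\<lambda>f. \<integral>x. f x \<partial>\<nu>) S 1"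
proof -
  interpret prob_space \<nu> by fact
  have meas: "f \<in> borel_measurable \<nu>" if "continuous_on UNIV f" for f :: "complex \<Rightarrow> real"
    using borel_measurable_continuous_onI[OF that] measurable_cong_sets[OF assms(2) refl] by blast
  have AE: "AE x in \<nu>. x \<in> S"
    using assms(3) by (intro AE_prob_1) (simp add: emeasure_eq_measure)
  have int: "integrable \<nu> f" if "continuous_on UNIV f" for f :: "complex \<Rightarrow> real"
  proof -
    have "bounded (f ` S)"
      using that assms(4) by (intro compact_imp_bounded compact_continuous_image)
        (auto intro: continuous_on_subset)
    then obtain b where "\<And>x. x \<in> S \<Longrightarrow> norm (f x) \<le> b"
      by (auto simp: bounded_iff)
    with AE have "AE x in \<nu>. norm (f x) \<le> b"
      by auto
    with meas[OF that] show ?thesis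
      by (intro integrable_const_bound)
  qed
  show ?thesis
  proof
    fix f :: "complex \<Rightarrow> real" and b
    assume f: "continuous_on UNIV f" "\<And>x. x \<in> S \<Longrightarrow> \<bar>f x\<bar> \<le> b" "0 \<le> b"
    have "AE x in \<nu>. norm (f x) \<le> b"
      using AE f(2) by auto
    then have "norm (\<integral>x. f x \<partial>\<nu>) \<le> (\<integral>x. b \<partial>\<nu>)"
      by (intro integral_norm_bound[THEN order_trans] integral_mono_AE integrable_norm int[OF f(1)]) auto
    then show "\<bar>\<integral>x. f x \<partial>\<nu>\<bar> \<le> 1 * b"
      by (simp add: prob_space)
  next
    fix f g :: "complex \<Rightarrow> real" and c
    assume f: "continuous_on UNIV f"
    show "(\<integral>x. c * f x \<partial>\<nu>) = c * (\<integral>x. f x \<partial>\<nu>)"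
      by simp
    assume g: "continuous_on UNIV g"
    show "(\<integral>x. f x + g x \<partial>\<nu>) = (\<integral>x. f x \<partial>\<nu>) + (\<integral>x. g x \<partial>\<nu>)"
      by (rule Bochner_Integration.integral_add[OF int[OF f] int[OF g]])
  qed (use assms(4) in simp_all)
qed

lemma signed_functional_average:
  assumes "finite Z" "Z \<noteq> {}" "Z \<subseteq> S" "compact S"
  shows "signed_functional (\<lambda>f. (\<Sum>\<zeta>\<in>Z. f \<zeta>) / real (card Z)) S 1"
proof
  fix f :: "complex \<Rightarrow> real" and b
  assume f: "\<And>x. x \<in> S \<Longrightarrow> \<bar>f x\<bar> \<le> b"
  have "\<bar>\<Sum>\<zeta>\<in>Z. f \<zeta>\<bar> \<le> (\<Sum>\<zeta>\<in>Z. b)"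
    using f assms by (intro order_trans[OF sum_abs] sum_mono) auto
  then show "\<bar>(\<Sum>\<zeta>\<in>Z. f \<zeta>) / real (card Z)\<bar> \<le> 1 * b"
    using assms by (simp add: divide_le_eq card_gt_0_iff mult.commute)
next
  fix f g :: "complex \<Rightarrow> real" and c
  show "(\<Sum>\<zeta>\<in>Z. f \<zeta> + g \<zeta>) / real (card Z) = (\<Sum>\<zeta>\<in>Z. f \<zeta>) / real (card Z) + (\<Sum>\<zeta>\<in>Z. g \<zeta>) / real (card Z)"
    by (simp add: sum.distrib add_divide_distrib)
  show "(\<Sum>\<zeta>\<in>Z. c * f \<zeta>) / real (card Z) = c * ((\<Sum>\<zeta>\<in>Z. f \<zeta>) / real (card Z))"
    by (simp add: sum_distrib_left[symmetric])
qed (use assms in auto)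


section \<open>Equidistribution of the roots\<close>

lemma log_kernel_reg_commute: "log_kernel_reg e x y = log_kernel_reg e y x"
  by (simp add: log_kernel_reg_def norm_minus_commute)

lemma log_kernel_reg_antimono:
  "0 < e \<Longrightarrow> e \<le> e' \<Longrightarrow> log_kernel_reg e' x y \<le> log_kernel_reg e x y"
  by (simp add: log_kernel_reg_def add_pos_nonneg)

lemma log_kernel_reg_le:
  assumes "0 < e" "x \<noteq> y"
  shows "log_kernel_reg e x y \<le> - 2 * ln (cmod (x - y))"
proof -
  have "2 * ln (cmod (x - y)) = ln ((cmod (x - y))\<^sup>2)"
    using assms by (simp add: ln_realpow)
  also have "\<dots> \<le> ln (e + (cmod (x - y))\<^sup>2)"
    using assms by (subst ln_le_cancel_iff) (auto simp: add_pos_nonneg)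
  finally show ?thesis
    by (simp add: log_kernel_reg_def)
qed

lemma log_kernel_reg_approx:
  assumes "0 < e" "0 < r" "r \<le> cmod (x - y)"
  shows "\<bar>log_kernel_reg e x y + 2 * ln (cmod (x - y))\<bar> \<le> e / r\<^sup>2"
proof -
  let ?s = "cmod (x - y)"
  have s: "0 < ?s"
    using assms by linarith
  have "ln (e + ?s\<^sup>2) - ln (?s\<^sup>2) \<le> (e + ?s\<^sup>2 - ?s\<^sup>2) / ?s\<^sup>2"
    using assms s by (intro ln_diff_le) (auto simp: add_pos_nonneg)
  also have "\<dots> \<le> e / r\<^sup>2"
    using assms s by (simp add: divide_left_mono power_mono)
  finally have "- log_kernel_reg e x y - 2 * ln ?s \<le> e / r\<^sup>2"
    using s by (simp add: log_kernel_reg_def ln_realpow)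
  moreover have "log_kernel_reg e x y \<le> - 2 * ln ?s"
    using assms s by (intro log_kernel_reg_le) auto
  ultimately show ?thesis
    by simp
qed

lemma abs_ln_diff_le:
  fixes a b m :: real
  assumes "0 < m" "m \<le> a" "m \<le> b"
  shows "\<bar>ln a - ln b\<bar> \<le> \<bar>a - b\<bar> / m"
proof -
  have *: "ln a - ln b \<le> \<bar>a - b\<bar> / m" if "m \<le> a" "m \<le> b" for a b
  proof -
    have "ln a - ln b \<le> (a - b) / b"
      using that assms by (intro ln_diff_le) auto
    also have "\<dots> \<le> \<bar>a - b\<bar> / b"
      using that assms by (intro divide_right_mono) auto
    also have "\<dots> \<le> \<bar>a - b\<bar> / m"
      using that assms by (intro divide_left_mono) auto
    finally show ?thesis .
  qed
  show ?thesis
    using *[OF assms(2,3)] *[OF assms(3,2)] by (simp add: abs_minus_commute abs_le_iff)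
qed

lemma infdist_less_1_in_cball:
  fixes E :: "complex set"
  assumes E: "compact E" and ne: "E \<noteq> {}"
  obtains R where "1 \<le> R" "E \<subseteq> cball 0 R" "\<And>\<zeta>. infdist \<zeta> E < 1 \<Longrightarrow> \<zeta> \<in> cball 0 R"
proof -
  obtain B where B: "\<And>x. x \<in> E \<Longrightarrow> cmod x \<le> B"
    using compact_imp_bounded[OF E] by (auto simp: bounded_iff)
  define R where "R = max B 0 + 1"
  have "\<zeta> \<in> cball 0 R" if near: "infdist \<zeta> E < 1" for \<zeta>
  proof -
    obtain x where x: "x \<in> E" "infdist \<zeta> E = dist \<zeta> x"
      using infdist_attains_inf[OF compact_imp_closed[OF E] ne, of \<zeta>] by blast
    then have "cmod \<zeta> \<le> cmod x + 1"
      using near norm_triangle_sub[of \<zeta> x] by (simp add: dist_norm)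
    then show ?thesis
      using B[OF x(1)] by (auto simp: R_def)
  qed
  moreover have "E \<subseteq> cball 0 R"
    using B by (force simp: R_def)
  ultimately show ?thesis
    by (intro that[of R]) (auto simp: R_def)
qed

locale compact_prob =
  fixes E :: "complex set" and \<mu> :: "complex measure"
  assumes compact_E: "compact E"
    and prob: "prob_space \<mu>" and sets_\<mu>: "sets \<mu> = sets borel" and E_full: "emeasure \<mu> E = 1"
begin

sublocale prob_space \<mu>
  by (rule prob)

text \<open>The sign is that of the energy: as e decreases to 0 the value increases towards -2 times
  the logarithmic potential. Unlike the latter it is continuous for every measure.\<close>

definition pot :: "real \<Rightarrow> complex \<Rightarrow> real" where
  "pot e z = (\<integral>w. log_kernel_reg e z w \<partial>\<mu>)"

lemma AE_E: "AE x in \<mu>. x \<in> E"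
  using E_full by (intro AE_prob_1) (simp add: emeasure_eq_measure)

lemma E_nonempty: "E \<noteq> {}"
  using E_full by auto

lemma measurable_\<mu>: "f \<in> borel_measurable borel \<Longrightarrow> f \<in> borel_measurable \<mu>"
  using measurable_cong_sets[OF sets_\<mu> refl] by blast

lemma integrable_bounded_on_E:
  assumes "f \<in> borel_measurable borel" "\<And>x. x \<in> E \<Longrightarrow> \<bar>f x\<bar> \<le> (B :: real)"
  shows "integrable \<mu> f"
  using AE_E assms by (intro integrable_const_bound[of _ B] measurable_\<mu>) auto

lemma integrable_continuous:
  assumes "continuous_on UNIV (f :: complex \<Rightarrow> real)"
  shows "integrable \<mu> f"
proof -
  have "bounded (f ` E)"
    using assms compact_E by (intro compact_imp_bounded compact_continuous_image)
      (auto intro: continuous_on_subset)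
  then obtain B where "\<And>x. x \<in> E \<Longrightarrow> \<bar>f x\<bar> \<le> B"
    by (auto simp: bounded_iff)
  then show ?thesis
    using assms by (intro integrable_bounded_on_E borel_measurable_continuous_onI)
qed

lemma continuous_log_kernel_reg2: "0 < e \<Longrightarrow> continuous_on UNIV (log_kernel_reg e z)"
  using continuous_on_compose2[OF continuous_log_kernel_reg, of e UNIV "\<lambda>w. (z, w)"]
    continuous_on_Pair[OF continuous_on_const continuous_on_id, of UNIV z]
  by simp

lemma integrable_log_kernel_reg: "0 < e \<Longrightarrow> integrable \<mu> (log_kernel_reg e z)"
  by (intro integrable_continuous continuous_log_kernel_reg2)

lemma pot_antimono: "0 < e \<Longrightarrow> e \<le> e' \<Longrightarrow> pot e' z \<le> pot e z"
  unfolding pot_def by (intro integral_mono integrable_log_kernel_reg log_kernel_reg_antimono) auto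

lemma functional: "compact S \<Longrightarrow> E \<subseteq> S \<Longrightarrow> signed_functional (\<lambda>f. \<integral>x. f x \<partial>\<mu>) S 1"
proof (rule signed_functional_integral[OF prob sets_\<mu>])
  assume S: "compact S" "E \<subseteq> S"
  then have "emeasure \<mu> E \<le> emeasure \<mu> S"
    using borel_compact[of S] sets_\<mu> by (intro emeasure_mono) auto
  then show "emeasure \<mu> S = 1"
    using E_full emeasure_le_1[of S] by (auto intro: antisym)
qed

lemma continuous_pot: "0 < e \<Longrightarrow> continuous_on UNIV (pot e)"
  unfolding pot_def
  by (rule signed_functional.continuous_L[OF functional[OF compact_E order_refl]])
     (rule continuous_log_kernel_reg)

end

text \<open>Separates analytic from arithmetic input. \<open>self_energy\<close> reflects that the
  equilibrium measure has energy 0 when the capacity is 1, \<open>pot_lower\<close> that the Green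
  function vanishes on E, and \<open>disc\<close> is the integrality of discriminants.\<close>

locale root_distribution = compact_prob +
  fixes Z :: "nat \<Rightarrow> complex set"
  assumes self_energy: "\<And>e. 0 < e \<Longrightarrow> e \<le> 1 \<Longrightarrow> (\<integral>x. pot e x \<partial>\<mu>) \<le> 0"
    and pot_lower: "\<And>z \<eta>. z \<in> E \<Longrightarrow> 0 < \<eta> \<Longrightarrow> \<exists>e>0. e \<le> 1 \<and> - \<eta> < pot e z"
    and finite_Z: "\<And>n. finite (Z n)"
    and card_Z: "filterlim (\<lambda>n. card (Z n)) at_top sequentially"
    and near_E: "\<And>r. 0 < r \<Longrightarrow> eventually (\<lambda>n. \<forall>\<zeta>\<in>Z n. infdist \<zeta> E < r) sequentially"
    and disc: "\<And>n. 0 \<le> (\<Sum>\<zeta>\<in>Z n. \<Sum>\<xi>\<in>Z n - {\<zeta>}. ln (cmod (\<zeta> - \<xi>)))"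
begin

definition avg :: "nat \<Rightarrow> (complex \<Rightarrow> real) \<Rightarrow> real" where
  "avg n f = (\<Sum>\<zeta>\<in>Z n. f \<zeta>) / real (card (Z n))"

definition discrepancy :: "nat \<Rightarrow> (complex \<Rightarrow> real) \<Rightarrow> real" where
  "discrepancy n f = avg n f - (\<integral>x. f x \<partial>\<mu>)"

lemma avg_mono: "(\<And>x. x \<in> Z n \<Longrightarrow> f x \<le> g x) \<Longrightarrow> avg n f \<le> avg n g"
  unfolding avg_def by (intro divide_right_mono sum_mono) auto

lemma avg_diff: "avg n (\<lambda>x. f x - g x) = avg n f - avg n g"
  by (simp add: avg_def sum_subtractf diff_divide_distrib)

lemma eventually_nonempty: "eventually (\<lambda>n. Z n \<noteq> {}) sequentially"
  using filterlim_at_top[THEN iffD1, OF card_Z, THEN spec, of 1] by eventually_elim auto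

text \<open>Dini's argument, for the increasing continuous potentials \<open>pot e\<close>.\<close>

lemma pot_lower_uniform:
  assumes "0 < \<eta>"
  obtains e r where "0 < e" "e \<le> 1" "0 < r" "\<And>z. infdist z E < r \<Longrightarrow> - \<eta> < pot e z"
proof -
  obtain e where e: "\<And>z. z \<in> E \<Longrightarrow> 0 < e z \<and> e z \<le> 1 \<and> - \<eta> < pot (e z) z"
    using pot_lower[OF _ assms] by metis
  define U where "U z = {w. - \<eta> < pot (e z) w}" for z
  have "open (U z)" if "z \<in> E" for z
    unfolding U_def using e[OF that] by (intro open_Collect_less continuous_pot) auto
  moreover have "E \<subseteq> (\<Union>z\<in>E. U z)"
    using e by (auto simp: U_def)
  ultimately obtain F where F: "F \<subseteq> E" "finite F" "E \<subseteq> (\<Union>z\<in>F. U z)"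
    using compactE_image[OF compact_E, of E U] by metis
  have "F \<noteq> {}"
    using F E_nonempty by auto
  define e' where "e' = Min (e ` F)"
  have e': "0 < e'" "e' \<le> 1" "\<And>z. z \<in> F \<Longrightarrow> e' \<le> e z"
    using F \<open>F \<noteq> {}\<close> e by (auto simp: e'_def Min_le_iff subset_iff) 
  have "open (\<Union>z\<in>F. U z)"
    using \<open>\<And>z. z \<in> E \<Longrightarrow> open (U z)\<close> F by auto
  \<comment> \<open>The finite cover contains a neighbourhood of E; this matters because the roots
    approach E without having to lie on it.\<close>
  then obtain r where r: "0 < r" "(\<Union>x\<in>E. ball x r) \<subseteq> (\<Union>z\<in>F. U z)"
    using compact_subset_open_imp_ball_epsilon_subset[OF compact_E _ F(3)] by blast
  show ?thesis
  proof (rule that[OF e'(1,2) r(1)])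
    fix z
    assume "infdist z E < r"
    then obtain x where "x \<in> E" "dist z x < r"
      using infdist_attains_inf[OF compact_imp_closed[OF compact_E] E_nonempty, of z] by metis
    then have "z \<in> (\<Union>x\<in>E. ball x r)"
      by (auto simp: dist_commute)
    then have "z \<in> (\<Union>z\<in>F. U z)"
      using r(2) by (rule rev_subsetD)
    then obtain w where "w \<in> F" "z \<in> U w"
      by (rule UN_E)
    then have "- \<eta> < pot (e w) z"
      by (simp add: U_def)
    also have "\<dots> \<le> pot e' z"
      using e' \<open>w \<in> F\<close> by (intro pot_antimono) auto
    finally show "- \<eta> < pot e' z" .
  qed
qed

lemma discrepancy_functional:
  assumes "compact S" "E \<subseteq> S" "Z n \<subseteq> S" "Z n \<noteq> {}"
  shows "signed_functional (discrepancy n) S 2"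
  using signed_functional_diff[OF signed_functional_average[OF finite_Z assms(4,3,1)] functional[OF assms(1,2)]]
  unfolding discrepancy_def[abs_def] avg_def[abs_def] by simp

lemma discrepancy_mass: "Z n \<noteq> {} \<Longrightarrow> discrepancy n (\<lambda>_. 1) = 0"
  using finite_Z[of n] by (simp add: discrepancy_def avg_def prob_space)

definition disc_energy :: "nat \<Rightarrow> real \<Rightarrow> real" where
  "disc_energy n e = discrepancy n (\<lambda>x. discrepancy n (log_kernel_reg e x))"

text \<open>The d diagonal terms contribute \<open>- ln e\<close> each, which is
  \<open>- ln e / d\<close> after division by d^2. The off-diagonal terms are dominated by -2 ln of
  the differences, whose sum is nonpositive by the discriminant.\<close>

lemma avg_avg_kernel_le:
  assumes "0 < e" "e \<le> 1" "Z n \<noteq> {}"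
  shows "avg n (\<lambda>x. avg n (log_kernel_reg e x)) \<le> - ln e / real (card (Z n))"
proof -
  let ?d = "real (card (Z n))"
  have d: "?d > 0"
    using assms finite_Z[of n] by (simp add: card_gt_0_iff)
  have "(\<Sum>\<zeta>\<in>Z n. \<Sum>\<xi>\<in>Z n. log_kernel_reg e \<zeta> \<xi>) 
      \<le> (\<Sum>\<zeta>\<in>Z n. - ln e + (\<Sum>\<xi>\<in>Z n - {\<zeta>}. - 2 * ln (cmod (\<zeta> - \<xi>))))"
  proof (rule sum_mono)
    fix \<zeta>
    assume "\<zeta> \<in> Z n"
    then have "(\<Sum>\<xi>\<in>Z n. log_kernel_reg e \<zeta> \<xi>) 
        = log_kernel_reg e \<zeta> \<zeta> + (\<Sum>\<xi>\<in>Z n - {\<zeta>}. log_kernel_reg e \<zeta> \<xi>)"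
      by (intro sum.remove finite_Z)
    also have "\<dots> \<le> - ln e + (\<Sum>\<xi>\<in>Z n - {\<zeta>}. - 2 * ln (cmod (\<zeta> - \<xi>)))"
      using assms by (intro add_mono sum_mono log_kernel_reg_le) (auto simp: log_kernel_reg_def)
    finally show "(\<Sum>\<xi>\<in>Z n. log_kernel_reg e \<zeta> \<xi>) \<le> \<dots>" .
  qed
  also have "\<dots> = ?d * (- ln e) - 2 * (\<Sum>\<zeta>\<in>Z n. \<Sum>\<xi>\<in>Z n - {\<zeta>}. ln (cmod (\<zeta> - \<xi>)))"
    by (simp add: sum.distrib sum_distrib_left[symmetric] sum_negf sum_subtractf)
  also have "\<dots> \<le> ?d * (- ln e)"
    using disc[of n] by simp
  finally have "(\<Sum>\<zeta>\<in>Z n. \<Sum>\<xi>\<in>Z n. log_kernel_reg e \<zeta> \<xi>) / ?d / ?d \<le> ?d * (- ln e) / ?d / ?d"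
    by (intro divide_right_mono) auto
  then show ?thesis
    using d by (simp add: avg_def sum_divide_distrib[symmetric])
qed

text \<open>Bilinear expansion of the energy of the root average minus \<mu>: the self-energy of
  \<mu> is nonpositive, and both cross terms equal the average of the potential of \<mu> over the
  roots.\<close>

lemma disc_energy_le:
  assumes e: "0 < e" "e \<le> 1" and ne: "Z n \<noteq> {}"
  shows "disc_energy n e \<le> - ln e / real (card (Z n)) - 2 * avg n (pot e)"
proof -
  let ?K = "log_kernel_reg e"
  have flip: "(\<lambda>x. ?K x y) = ?K y" for y
    by (rule ext) (rule log_kernel_reg_commute)
  have K: "integrable \<mu> (\<lambda>x. ?K x y)" for y
    unfolding flip by (rule integrable_log_kernel_reg[OF e(1)])
  have pot: "(\<integral>x. ?K x y \<partial>\<mu>) = pot e y" for y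
    unfolding pot_def flip ..
  have "integrable \<mu> (\<lambda>x. \<Sum>\<zeta>\<in>Z n. ?K x \<zeta>)"
    by (rule Bochner_Integration.integrable_sum) (rule K)
  then have q: "integrable \<mu> (\<lambda>x. avg n (?K x))"
    unfolding avg_def by simp
  have p: "integrable \<mu> (pot e)"
    by (intro integrable_continuous continuous_pot e)
  have "(\<integral>x. avg n (?K x) \<partial>\<mu>) = (\<Sum>\<zeta>\<in>Z n. \<integral>x. ?K x \<zeta> \<partial>\<mu>) / real (card (Z n))"
    unfolding avg_def integral_divide_zero by (subst Bochner_Integration.integral_sum[OF K]) (rule refl)
  then have Nq: "(\<integral>x. avg n (?K x) \<partial>\<mu>) = avg n (pot e)"
    by (simp add: pot avg_def)
  have "disc_energy n e = avg n (\<lambda>x. avg n (?K x) - pot e x) - (\<integral>x. avg n (?K x) - pot e x \<partial>\<mu>)"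
    by (simp add: disc_energy_def discrepancy_def pot_def)
  also have "avg n (\<lambda>x. avg n (?K x) - pot e x) = avg n (\<lambda>x. avg n (?K x)) - avg n (pot e)"
    by (rule avg_diff)
  also have "(\<integral>x. avg n (?K x) - pot e x \<partial>\<mu>) = avg n (pot e) - (\<integral>x. pot e x \<partial>\<mu>)"
    using q p by (simp add: Nq)
  finally show ?thesis
    using self_energy[OF e] avg_avg_kernel_le[OF e ne] by linarith
qed

lemma eventually_in_cball:
  obtains R where "1 \<le> R" "E \<subseteq> cball 0 R" "eventually (\<lambda>n. Z n \<subseteq> cball 0 R) sequentially"
proof -
  obtain R where R: "1 \<le> R" "E \<subseteq> cball 0 R" "\<And>\<zeta>. infdist \<zeta> E < 1 \<Longrightarrow> \<zeta> \<in> cball 0 R"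
    using infdist_less_1_in_cball[OF compact_E E_nonempty] by metis
  have "eventually (\<lambda>n. Z n \<subseteq> cball 0 R) sequentially"
    using near_E[of 1, simplified]
  proof eventually_elim
    case (elim n)
    show ?case
    proof
      fix \<zeta>
      assume "\<zeta> \<in> Z n"
      with elim have "infdist \<zeta> E < 1" by blast
      then show "\<zeta> \<in> cball 0 R" by (rule R(3))
    qed
  qed
  with R(1,2) show ?thesis by (rule that)
qed

text \<open>The potential bound near E asks for a small parameter, the diagonal term for one
  independent of n. Fixing e'' first and then taking n large serves both; monotonicity carries the
  bound from e'' back to e. The total is 1/4 + 2/4 of \<eta>.\<close>

lemma eventually_disc_energy_less:
  assumes e: "0 < e" "e \<le> 1" and \<eta>: "0 < \<eta>"
  shows "eventually (\<lambda>n. disc_energy n e < \<eta>) sequentially"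
proof -
  obtain e' r where e': "0 < e'" "e' \<le> 1" "0 < r" "\<And>z. infdist z E < r \<Longrightarrow> - (\<eta> / 4) < pot e' z"
    using pot_lower_uniform[of "\<eta> / 4"] \<eta> by auto
  define e'' where "e'' = min e e'"
  have e'': "0 < e''" "e'' \<le> e" "e'' \<le> e'" "e'' \<le> 1"
    using e e' by (auto simp: e''_def)
  obtain R where R: "E \<subseteq> cball 0 R" "eventually (\<lambda>n. Z n \<subseteq> cball 0 R) sequentially"
    using eventually_in_cball by metis
  have "((\<lambda>n. - ln e'' / real (card (Z n))) \<longlongrightarrow> 0) sequentially"
    by (intro real_tendsto_divide_at_top[OF tendsto_const] 
        filterlim_compose[OF filterlim_real_sequentially card_Z])
  then have "eventually (\<lambda>n. - ln e'' / real (card (Z n)) < \<eta> / 4) sequentially"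
    using \<eta> by (intro order_tendstoD) auto
  with R(2) near_E[OF e'(3)] eventually_nonempty show ?thesis
  proof eventually_elim
    case (elim n)
    interpret L: signed_functional "discrepancy n" "cball 0 R" 2
      using elim R(1) by (intro discrepancy_functional) auto
    have "disc_energy n e \<le> disc_energy n e''"
      using L.energy_form_log_kernel_reg_antimono[OF discrepancy_mass[OF \<open>Z n \<noteq> {}\<close>] e''(1,2) e(2)]
      by (simp add: disc_energy_def L.energy_form_def)
    also have "\<dots> \<le> - ln e'' / real (card (Z n)) - 2 * avg n (pot e'')"
      using elim e'' by (intro disc_energy_le) auto
    also have "avg n (pot e'') \<ge> avg n (\<lambda>_. - (\<eta> / 4))"
    proof (rule avg_mono)
      fix x
      assume "x \<in> Z n"
      then have "- (\<eta> / 4) < pot e' x"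
        using elim e' by auto
      also have "\<dots> \<le> pot e'' x"
        using e'' by (intro pot_antimono) auto
      finally show "- (\<eta> / 4) \<le> pot e'' x" by simp
    qed
    then have "- ln e'' / real (card (Z n)) - 2 * avg n (pot e'') 
        \<le> - ln e'' / real (card (Z n)) - 2 * avg n (\<lambda>_. - (\<eta> / 4))"
      by simp
    also have "avg n (\<lambda>_. - (\<eta> / 4)) = - (\<eta> / 4)"
      using elim finite_Z[of n] by (simp add: avg_def)
    also have "- ln e'' / real (card (Z n)) - 2 * - (\<eta> / 4) < \<eta>"
      using elim \<eta> by linarith
    finally show ?case by simp
  qed
qed

text \<open>Cauchy-Schwarz compares two points, so a reference point is needed. Far away the kernel
  is nearly constant on the ball containing E and the roots, and constants have discrepancy
  0.\<close>

lemma far_point_discrepancy: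
  assumes e: "0 < e" "e \<le> 1" and \<eta>: "0 < \<eta>"
  obtains y where "y \<noteq> z" "eventually (\<lambda>n. \<bar>discrepancy n (log_kernel_reg e y)\<bar> \<le> \<eta>) sequentially"
proof -
  obtain R where R: "1 \<le> R" "E \<subseteq> cball 0 R" "eventually (\<lambda>n. Z n \<subseteq> cball 0 R) sequentially"
    using eventually_in_cball by metis
  \<comment> \<open>Bounds the oscillation: with s the distance from y to x, |s^2 - Y^2| = |s - Y|
    (s + Y) is at most R (2Y + R), and both logarithms have arguments of at least (Y - R)^2.\<close>
  have "((\<lambda>Y. R * (2 * Y + R) / (Y - R)\<^sup>2) \<longlongrightarrow> 0) at_top"
    using R(1) by real_asymp
  then have "eventually (\<lambda>Y. R * (2 * Y + R) / (Y - R)\<^sup>2 < \<eta> / 2) at_top"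
    using \<eta> by (intro order_tendstoD) auto
  moreover have "eventually (\<lambda>Y. Y > R \<and> Y > cmod z) at_top"
    by (intro eventually_conj eventually_gt_at_top)
  ultimately have "eventually (\<lambda>Y. R * (2 * Y + R) / (Y - R)\<^sup>2 < \<eta> / 2 \<and> Y > R \<and> Y > cmod z) at_top"
    by eventually_elim auto
  then obtain Y where Y: "R * (2 * Y + R) / (Y - R)\<^sup>2 < \<eta> / 2" "Y > R" "Y > cmod z"
    by (auto simp: eventually_at_top_linorder)
  define y where "y = complex_of_real Y"
  have norm_y: "cmod y = Y"
    using Y R by (simp add: y_def)
  have osc: "\<bar>log_kernel_reg e y x - log_kernel_reg e y 0\<bar> \<le> \<eta> / 2" if "x \<in> cball 0 R" for x
  proof -
    let ?s = "cmod (y - x)"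
    have x: "cmod x \<le> R"
      using that by simp
    have s: "Y - R \<le> ?s" "?s \<le> Y + R" "\<bar>?s - Y\<bar> \<le> R"
      using norm_triangle_ineq2[of y x] norm_triangle_ineq4[of y x] x norm_y by auto
    have "\<bar>ln (e + ?s\<^sup>2) - ln (e + Y\<^sup>2)\<bar> \<le> \<bar>(e + ?s\<^sup>2) - (e + Y\<^sup>2)\<bar> / (Y - R)\<^sup>2"
    proof (rule abs_ln_diff_le)
      have "(Y - R)\<^sup>2 \<le> ?s\<^sup>2" "(Y - R)\<^sup>2 \<le> Y\<^sup>2"
        using s Y R(1) by (auto intro!: power_mono)
      then show "(Y - R)\<^sup>2 \<le> e + ?s\<^sup>2" "(Y - R)\<^sup>2 \<le> e + Y\<^sup>2"
        using e by linarith+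
    qed (use Y in auto)
    also have "(e + ?s\<^sup>2) - (e + Y\<^sup>2) = (?s - Y) * (?s + Y)"
      by (simp add: power2_eq_square algebra_simps)
    also have "\<bar>(?s - Y) * (?s + Y)\<bar> \<le> R * (2 * Y + R)"
      unfolding abs_mult using s Y R(1) by (intro mult_mono) auto
    finally have "\<bar>ln (e + ?s\<^sup>2) - ln (e + Y\<^sup>2)\<bar> \<le> R * (2 * Y + R) / (Y - R)\<^sup>2"
      using Y by (simp add: divide_right_mono)
    then show ?thesis
      unfolding log_kernel_reg_def using Y(1) by (simp only: norm_y diff_zero)
  qed
  have "eventually (\<lambda>n. \<bar>discrepancy n (log_kernel_reg e y)\<bar> \<le> \<eta>) sequentially"
    using R(3) eventually_nonempty
  proof eventually_elim
    case (elim n)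
    interpret L: signed_functional "discrepancy n" "cball 0 R" 2
      using elim R(2) by (intro discrepancy_functional) auto
    let ?c = "log_kernel_reg e y 0"
    have cont: "continuous_on UNIV (log_kernel_reg e y)"
      by (rule continuous_log_kernel_reg2[OF e(1)])
    have "\<bar>discrepancy n (\<lambda>x. log_kernel_reg e y x - ?c)\<bar> \<le> 2 * (\<eta> / 2)"
      using \<eta> osc by (intro L.bound continuous_on_diff cont continuous_on_const) auto
    also have "discrepancy n (\<lambda>x. log_kernel_reg e y x - ?c) = discrepancy n (log_kernel_reg e y) - discrepancy n (\<lambda>_. ?c)"
      by (intro L.diff cont continuous_on_const)
    also have "discrepancy n (\<lambda>_. ?c) = 0"
      using L.const[of ?c] discrepancy_mass[OF \<open>Z n \<noteq> {}\<close>] by simp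
    finally show ?case by simp
  qed
  moreover have "y \<noteq> z"
    using Y(3) norm_y by auto
  ultimately show ?thesis
    using that by blast
qed

text \<open>Half of \<eta> is spent at the far reference point, the other half on the difference of
  potentials, which is small once the energy is below (\<eta>/2)^2 / c.\<close>

lemma discrepancy_tendsto_0:
  assumes e: "0 < e" "e \<le> 1"
  shows "(\<lambda>n. discrepancy n (log_kernel_reg e z)) \<longlonglongrightarrow> 0"
proof (rule tendstoI)
  fix \<eta> :: real
  assume \<eta>: "0 < \<eta>"
  obtain y where y: "y \<noteq> z" "eventually (\<lambda>n. \<bar>discrepancy n (log_kernel_reg e y)\<bar> \<le> \<eta> / 2) sequentially"
    using far_point_discrepancy[OF e, of "\<eta> / 2" z] \<eta> by auto
  define c where "c = 2 * ln ((e + (cmod (z - y))\<^sup>2) / e)"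
  have "c > 0"
    using e y(1) by (auto simp: c_def less_divide_eq intro!: ln_gt_zero)
  obtain R where R: "E \<subseteq> cball 0 R" "eventually (\<lambda>n. Z n \<subseteq> cball 0 R) sequentially"
    using eventually_in_cball by metis
  have "eventually (\<lambda>n. disc_energy n e < (\<eta> / 2)\<^sup>2 / c) sequentially"
    using \<eta> \<open>c > 0\<close> by (intro eventually_disc_energy_less e) auto
  with y(2) R(2) eventually_nonempty
  show "eventually (\<lambda>n. dist (discrepancy n (log_kernel_reg e z)) 0 < \<eta>) sequentially"
  proof eventually_elim
    case (elim n)
    interpret L: signed_functional "discrepancy n" "cball 0 R" 2
      using elim R(1) by (intro discrepancy_functional) auto
    have "(discrepancy n (log_kernel_reg e z) - discrepancy n (log_kernel_reg e y))\<^sup>2 \<le> disc_energy n e * c"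
      unfolding disc_energy_def c_def L.energy_form_def[symmetric]
      by (rule L.log_kernel_reg_cauchy_schwarz[OF discrepancy_mass[OF \<open>Z n \<noteq> {}\<close>] e y(1)[symmetric]])
    also have "\<dots> < (\<eta> / 2)\<^sup>2"
      using elim \<open>c > 0\<close> by (simp add: pos_less_divide_eq)
    finally have "\<bar>discrepancy n (log_kernel_reg e z) - discrepancy n (log_kernel_reg e y)\<bar>\<^sup>2 < (\<eta> / 2)\<^sup>2"
      by (simp only: power2_abs)
    then have "\<bar>discrepancy n (log_kernel_reg e z) - discrepancy n (log_kernel_reg e y)\<bar> < \<eta> / 2"
      by (rule power_less_imp_less_base) (use \<eta> in simp)
    then show ?case
      unfolding dist_real_def using elim by linarith
  qed
qed

end


section \<open>The logarithmic potential and limits of averages\<close>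

text \<open>The factorisation of x^N - 1 at x = - a / b, rescaled by (- b)^N.\<close>

lemma prod_roots_unity_linear:
  fixes a b :: complex
  assumes N: "N > 0" and "b \<noteq> 0"
  shows "(\<Prod>\<omega> | \<omega> ^ N = 1. a + b * \<omega>) = a ^ N - (- b) ^ N"
proof -
  define P :: "complex poly" where "P = Polynomial.monom 1 N - 1"
  have poly_P: "poly P x = x ^ N - 1" for x
    by (simp add: P_def poly_monom)
  have roots: "{x. poly P x = 0} = {\<omega>. \<omega> ^ N = 1}"
    by (simp add: poly_P)
  have deg: "Polynomial.degree P = N"
    unfolding P_def diff_conv_add_uminus
    using N by (subst degree_add_eq_left) (auto simp: degree_monom_eq)
  have lead: "Polynomial.lead_coeff P = 1"
    unfolding deg using N by (simp add: P_def)
  have "rsquarefree P"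
    unfolding rsquarefree_roots
  proof (intro allI notI, elim conjE)
    fix x
    assume "poly P x = 0" "poly (pderiv P) x = 0"
    then have "x ^ N = 1" "of_nat N * x ^ (N - 1) = 0"
      by (simp_all add: poly_P) (simp add: P_def pderiv_diff pderiv_monom poly_monom)
    then show False
      using N by (auto simp: power_0_left)
  qed
  then have "P = (\<Prod>\<omega> | \<omega> ^ N = 1. [:- \<omega>, 1:])"
    using complex_poly_decompose_rsquarefree[of P] by (simp add: lead roots)
  then have "poly P x = poly (\<Prod>\<omega> | \<omega> ^ N = 1. [:- \<omega>, 1:]) x" for x
    by simp
  then have prod: "(\<Prod>\<omega> | \<omega> ^ N = 1. x - \<omega>) = x ^ N - 1" for x :: complex
    by (simp add: poly_prod poly_P)
  have "(\<Prod>\<omega> | \<omega> ^ N = 1. a + b * \<omega>) = (\<Prod>\<omega> | \<omega> ^ N = 1. (- b) * (- a / b - \<omega>))"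
    using \<open>b \<noteq> 0\<close> by (intro prod.cong) (auto simp: field_simps)
  also have "\<dots> = (- b) ^ N * ((- a / b) ^ N - 1)"
    unfolding prod.distrib using card_complex_roots_unity[of N] N by (simp add: prod)
  also have "\<dots> = a ^ N - (- b) ^ N"
    using \<open>b \<noteq> 0\<close> by (simp add: right_diff_distrib flip: power_mult_distrib)
  finally show ?thesis .
qed

context compact_prob
begin

definition log_pot :: "complex \<Rightarrow> real" where
  "log_pot z = (\<integral>w. ln (cmod (z - w)) \<partial>\<mu>)"

lemma integrable_ln_cmod:
  assumes "z \<notin> E"
  shows "integrable \<mu> (\<lambda>w. ln (cmod (z - w)))"
proof -
  have "continuous_on E (\<lambda>w. ln (cmod (z - w)))"
    using assms by (intro continuous_intros) auto
  then have "bounded ((\<lambda>w. ln (cmod (z - w))) ` E)"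
    by (intro compact_imp_bounded compact_continuous_image compact_E)
  then obtain B where "\<And>w. w \<in> E \<Longrightarrow> \<bar>ln (cmod (z - w))\<bar> \<le> B"
    by (auto simp: bounded_iff)
  then show ?thesis
    by (rule integrable_bounded_on_E[rotated]) measurable
qed

text \<open>A discrete mean value property: averaging over the \<open>N\<close>-th roots of unity replaces the
  logarithmic potential by one of \<open>a ^ N - c ^ N\<close>, which differs from \<open>N * ln \<bar>a\<bar>\<close> by an
  exponentially small amount.\<close>

lemma log_pot_roots_unity_mean:
  assumes N: "N > 0" and b: "b \<noteq> 0" "cmod b < \<rho>" and \<rho>: "\<And>w. w \<in> E \<Longrightarrow> \<rho> \<le> cmod (p - w)"
  shows "(\<Sum>\<omega> | \<omega> ^ N = 1. log_pot (p + b * \<omega>)) \<le> real N * log_pot p + (cmod b / \<rho>) ^ N"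
proof -
  let ?\<Omega> = "{\<omega> :: complex. \<omega> ^ N = 1}"
  have "0 < \<rho>"
    using b by (smt (verit) norm_ge_zero)
  have norm1: "cmod \<omega> = 1" if "\<omega> \<in> ?\<Omega>" for \<omega>
    using that N power_eq_1_iff[of \<omega> N] by auto
  have off: "p + b * \<omega> \<notin> E" if "\<omega> \<in> ?\<Omega>" for \<omega>
  proof
    assume "p + b * \<omega> \<in> E"
    from \<rho>[OF this] have "\<rho> \<le> cmod b"
      using norm1[OF that] by (simp add: norm_mult)
    with b show False by simp
  qed
  have "p \<notin> E"
    using \<rho>[of p] \<open>0 < \<rho>\<close> by auto
  have fin: "finite ?\<Omega>"
    using card_complex_roots_unity[of N] N by (intro card_ge_0_finite) auto
  have "(\<Sum>\<omega>\<in>?\<Omega>. log_pot (p + b * \<omega>)) = (\<integral>w. (\<Sum>\<omega>\<in>?\<Omega>. ln (cmod (p + b * \<omega> - w))) \<partial>\<mu>)"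
    unfolding log_pot_def by (rule Bochner_Integration.integral_sum[symmetric]) (rule integrable_ln_cmod[OF off])
  also have "\<dots> \<le> (\<integral>w. real N * ln (cmod (p - w)) + (cmod b / \<rho>) ^ N \<partial>\<mu>)"
  proof (rule integral_mono_AE)
    show "integrable \<mu> (\<lambda>w. \<Sum>\<omega>\<in>?\<Omega>. ln (cmod (p + b * \<omega> - w)))"
      by (rule Bochner_Integration.integrable_sum) (rule integrable_ln_cmod[OF off])
    show "integrable \<mu> (\<lambda>w. real N * ln (cmod (p - w)) + (cmod b / \<rho>) ^ N)"
      using integrable_ln_cmod[OF \<open>p \<notin> E\<close>] by simp
    show "AE w in \<mu>. (\<Sum>\<omega>\<in>?\<Omega>. ln (cmod (p + b * \<omega> - w))) \<le> real N * ln (cmod (p - w)) + (cmod b / \<rho>) ^ N"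
      using AE_E
    proof eventually_elim
      case (elim w)
      let ?a = "p - w"
      have a: "\<rho> \<le> cmod ?a"
        using \<rho>[OF elim] .
      have nz: "?a + b * \<omega> \<noteq> 0" if "\<omega> \<in> ?\<Omega>" for \<omega>
        using off[OF that] elim by (auto simp: algebra_simps)
      have "(\<Sum>\<omega>\<in>?\<Omega>. ln (cmod (p + b * \<omega> - w))) = (\<Sum>\<omega>\<in>?\<Omega>. ln (cmod (?a + b * \<omega>)))"
        by (intro sum.cong refl) (simp add: algebra_simps)
      also have "\<dots> = ln (\<Prod>\<omega>\<in>?\<Omega>. cmod (?a + b * \<omega>))"
        using nz fin by (intro ln_prod[symmetric]) auto
      also have "(\<Prod>\<omega>\<in>?\<Omega>. cmod (?a + b * \<omega>)) = cmod (?a ^ N - (- b) ^ N)"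
        unfolding prod_norm prod_roots_unity_linear[OF N b(1)] ..
      also have "ln (cmod (?a ^ N - (- b) ^ N)) \<le> ln (cmod ?a ^ N * (1 + (cmod b / \<rho>) ^ N))"
      proof (subst ln_le_cancel_iff)
        have "?a ^ N - (- b) ^ N = (\<Prod>\<omega>\<in>?\<Omega>. ?a + b * \<omega>)"
          by (rule prod_roots_unity_linear[OF N b(1), symmetric])
        also have "\<dots> \<noteq> 0"
          using nz fin by (auto simp: prod_zero_iff)
        finally show "0 < cmod (?a ^ N - (- b) ^ N)" by simp
        show "0 < cmod ?a ^ N * (1 + (cmod b / \<rho>) ^ N)"
          using a \<open>0 < \<rho>\<close> by (intro mult_pos_pos add_pos_nonneg zero_less_power) auto
        have "cmod (?a ^ N - (- b) ^ N) \<le> cmod ?a ^ N + cmod b ^ N"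
          by (rule order_trans[OF norm_triangle_ineq4]) (simp add: norm_power)
        also have "cmod b ^ N = \<rho> ^ N * (cmod b / \<rho>) ^ N"
          using \<open>0 < \<rho>\<close> by (simp add: power_divide)
        also have "\<dots> \<le> cmod ?a ^ N * (cmod b / \<rho>) ^ N"
          using a \<open>0 < \<rho>\<close> by (intro mult_right_mono power_mono) auto
        finally show "cmod (?a ^ N - (- b) ^ N) \<le> cmod ?a ^ N * (1 + (cmod b / \<rho>) ^ N)"
          by (simp add: distrib_left)
      qed
      also have "\<dots> = real N * ln (cmod ?a) + ln (1 + (cmod b / \<rho>) ^ N)"
      proof -
        have "0 < cmod ?a"
          using a \<open>0 < \<rho>\<close> by linarith
        moreover have "0 < 1 + (cmod b / \<rho>) ^ N"
          using \<open>0 < \<rho>\<close> by (intro add_pos_nonneg) auto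
        ultimately show ?thesis
          by (simp add: ln_mult_pos ln_realpow)
      qed
      also have "ln (1 + (cmod b / \<rho>) ^ N) \<le> (cmod b / \<rho>) ^ N"
        using \<open>0 < \<rho>\<close> by (intro ln_add_one_self_le_self) auto
      finally show ?case by simp
    qed
  qed
  also have "\<dots> = real N * log_pot p + (cmod b / \<rho>) ^ N"
    unfolding log_pot_def using integrable_ln_cmod[OF \<open>p \<notin> E\<close>] by (simp add: prob_space)
  finally show ?thesis .
qed

text \<open>Minimum principle. A negative minimum would be attained off E; the discrete mean value
  property makes the set of minimum points open, it is closed by continuity, hence it is the whole
  plane, against the value 0 on E. Far out all logarithms are nonnegative, so a minimum
  exists.\<close>

lemma log_pot_nonneg:
  assumes cont: "continuous_on UNIV log_pot" and zero: "\<And>z. z \<in> E \<Longrightarrow> log_pot z = 0"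
  shows "0 \<le> log_pot z"
proof (rule ccontr)
  assume neg: "\<not> 0 \<le> log_pot z"
  obtain R where R: "\<And>x. x \<in> E \<Longrightarrow> cmod x \<le> R"
    using compact_imp_bounded[OF compact_E] by (auto simp: bounded_iff)
  have large: "0 \<le> log_pot x" if "R + 1 \<le> cmod x" for x
    unfolding log_pot_def
  proof (rule integral_nonneg_AE)
    show "AE w in \<mu>. 0 \<le> ln (cmod (x - w))"
      using AE_E
    proof eventually_elim
      case (elim w)
      then show ?case
        using R[OF elim] that norm_triangle_ineq2[of x w] by (intro ln_ge_zero) linarith
    qed
  qed
  define B where "B = cball (0 :: complex) (\<bar>R\<bar> + 1 + cmod z)"
  obtain p where p: "p \<in> B" "\<And>x. x \<in> B \<Longrightarrow> log_pot p \<le> log_pot x"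
  proof -
    have "compact B" "z \<in> B"
      by (auto simp: B_def)
    then have "compact B" "B \<noteq> {}"
      by auto
    with continuous_attains_inf[OF this continuous_on_subset[OF cont subset_UNIV]] that
    show ?thesis by blast
  qed
  define m where "m = log_pot p"
  have "z \<in> B"
    by (simp add: B_def)
  then have "m < 0"
    using p(2)[of z] neg by (simp add: m_def)
  have min: "m \<le> log_pot x" for x
  proof (cases "x \<in> B")
    case True
    with p(2) show ?thesis by (simp add: m_def)
  next
    case False
    then have "0 \<le> log_pot x"
    proof (intro large)
      show "R + 1 \<le> cmod x"
        using False abs_ge_self[of R] norm_ge_zero[of z] unfolding B_def mem_cball_0 by linarith
    qed
    with \<open>m < 0\<close> show ?thesis by simp
  qed
  define M where "M = {x. log_pot x = m}"
  have "closed M"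
    unfolding M_def by (intro closed_Collect_eq cont continuous_on_const)
  moreover have "open M"
    unfolding open_contains_ball
  proof
    fix p
    assume "p \<in> M"
    then have pm: "log_pot p = m"
      by (simp add: M_def)
    with \<open>m < 0\<close> have "p \<notin> E"
      using zero by force
    define \<rho> where "\<rho> = infdist p E"
    have "0 < \<rho>"
      unfolding \<rho>_def using \<open>p \<notin> E\<close> E_nonempty compact_imp_closed[OF compact_E]
      by (simp add: infdist_pos_not_in_closed)
    have \<rho>: "\<rho> \<le> cmod (p - w)" if "w \<in> E" for w
      using infdist_le[OF that, of p] by (simp add: \<rho>_def dist_norm)
    have "q \<in> M" if "q \<in> ball p \<rho>" for q
    proof (cases "q = p")
      case True
      with \<open>p \<in> M\<close> show ?thesis by simp
    next
      case False
      define b where "b = q - p"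
      have b: "b \<noteq> 0" "cmod b < \<rho>"
        using False that by (auto simp: b_def dist_norm norm_minus_commute)
      have bound: "log_pot q - m \<le> (cmod b / \<rho>) ^ N" if "N > 0" for N
      proof -
        let ?\<Omega> = "{\<omega> :: complex. \<omega> ^ N = 1}"
        have card: "card ?\<Omega> = N"
          using card_complex_roots_unity[of N] that by simp
        have fin: "finite ?\<Omega>"
          using card that by (intro card_ge_0_finite) auto
        \<comment> \<open>The root of unity 1 gives the point q itself; the remaining terms are
          nonnegative because m is the minimum. Letting N grow then removes the exponentially small
          error.\<close>
        have "log_pot (p + b * 1) - m \<le> (\<Sum>\<omega>\<in>?\<Omega>. log_pot (p + b * \<omega>) - m)"
          using min fin by (intro member_le_sum) auto
        also have "\<dots> = (\<Sum>\<omega>\<in>?\<Omega>. log_pot (p + b * \<omega>)) - real N * m"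
          using card by (simp add: sum_subtractf)
        also have "\<dots> \<le> (cmod b / \<rho>) ^ N"
          using log_pot_roots_unity_mean[OF that b \<rho>] by (simp add: pm)
        finally show ?thesis
          by (simp add: b_def)
      qed
      have "(\<lambda>N. (cmod b / \<rho>) ^ N) \<longlonglongrightarrow> 0"
        using b \<open>0 < \<rho>\<close> by (intro LIMSEQ_realpow_zero) auto
      then have "log_pot q - m \<le> 0"
        using bound by (intro LIMSEQ_le_const[where X = "\<lambda>N. (cmod b / \<rho>) ^ N"]) (auto intro!: exI[of _ 1])
      with min[of q] show ?thesis
        by (simp add: M_def)
    qed
    with \<open>0 < \<rho>\<close> show "\<exists>e>0. ball p e \<subseteq> M"
      by blast
  qed
  ultimately have "M = {} \<or> M = UNIV"
    using clopen by blast
  moreover have "p \<in> M"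
    by (simp add: M_def m_def)
  ultimately have "M = UNIV"
    by auto
  moreover obtain w where "w \<in> E"
    using E_nonempty by auto
  ultimately show False
    using zero[OF \<open>w \<in> E\<close>] \<open>m < 0\<close> UNIV_I[of w] by (simp add: M_def set_eq_iff)
qed

end

context root_distribution
begin

text \<open>Off E the points of E and, eventually, the roots keep a distance \<rho> from z, so
  replacing the regularised kernel by the logarithm costs at most e / \<rho>^2 on either
  side.\<close>

lemma log_average_tendsto:
  assumes "z \<notin> E"
  shows "(\<lambda>n. avg n (\<lambda>\<zeta>. ln (cmod (z - \<zeta>)))) \<longlonglongrightarrow> log_pot z"
proof (rule tendstoI)
  fix \<eta> :: real
  assume \<eta>: "0 < \<eta>"
  define \<rho> where "\<rho> = infdist z E / 2"
  have "0 < \<rho>"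
    unfolding \<rho>_def using assms E_nonempty compact_imp_closed[OF compact_E]
    by (simp add: infdist_pos_not_in_closed)
  \<comment> \<open>Makes the cost of the regularisation at most \<eta>/4. Three such errors bound
    twice the quantity in question.\<close>
  define e where "e = min 1 (\<eta> * \<rho>\<^sup>2 / 4)"
  have e: "0 < e" "e \<le> 1" "e / \<rho>\<^sup>2 \<le> \<eta> / 4"
    using \<eta> \<open>0 < \<rho>\<close> by (auto simp: e_def min_def divide_le_eq field_simps)
  let ?K = "log_kernel_reg e z"
  have E_far: "\<rho> \<le> cmod (z - w)" if "w \<in> E" for w
    using infdist_le[OF that, of z] \<open>0 < \<rho>\<close> by (simp add: \<rho>_def dist_norm)
  have int: "integrable \<mu> (\<lambda>w. ln (cmod (z - w)))"
    by (rule integrable_ln_cmod[OF assms])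
  have pot: "\<bar>pot e z + 2 * log_pot z\<bar> \<le> \<eta> / 4"
  proof -
    have "pot e z + 2 * log_pot z = (\<integral>w. ?K w + 2 * ln (cmod (z - w)) \<partial>\<mu>)"
      unfolding pot_def log_pot_def using int integrable_log_kernel_reg[OF e(1), of z] by simp
    also have "\<bar>\<dots>\<bar> \<le> \<eta> / 4"
    proof (rule abs_leI)
      have AE: "AE w in \<mu>. \<bar>?K w + 2 * ln (cmod (z - w))\<bar> \<le> \<eta> / 4"
        using AE_E
      proof eventually_elim
        case (elim w)
        then show ?case
          using log_kernel_reg_approx[OF e(1) \<open>0 < \<rho>\<close> E_far[OF elim]] e(3) by linarith
      qed
      have i: "integrable \<mu> (\<lambda>w. ?K w + 2 * ln (cmod (z - w)))"
        using int integrable_log_kernel_reg[OF e(1), of z] by simp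
      show "(\<integral>w. ?K w + 2 * ln (cmod (z - w)) \<partial>\<mu>) \<le> \<eta> / 4"
        using AE by (intro integral_le_const i) (elim eventually_mono, linarith)
      have "- (\<eta> / 4) \<le> (\<integral>w. ?K w + 2 * ln (cmod (z - w)) \<partial>\<mu>)"
        using AE by (intro integral_ge_const i) (elim eventually_mono, linarith)
      then show "- (\<integral>w. ?K w + 2 * ln (cmod (z - w)) \<partial>\<mu>) \<le> \<eta> / 4" by simp
    qed
    finally show ?thesis .
  qed
  have "eventually (\<lambda>n. \<bar>discrepancy n ?K\<bar> < \<eta> / 4) sequentially"
    using tendstoD[OF discrepancy_tendsto_0[OF e(1,2), of z], of "\<eta> / 4"] \<eta> by (simp add: dist_real_def)
  with near_E[OF \<open>0 < \<rho>\<close>] eventually_nonempty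
  show "eventually (\<lambda>n. dist (avg n (\<lambda>\<zeta>. ln (cmod (z - \<zeta>)))) (log_pot z) < \<eta>) sequentially"
  proof eventually_elim
    case (elim n)
    have d: "real (card (Z n)) > 0"
      using elim finite_Z[of n] by (simp add: card_gt_0_iff)
    have *: "\<bar>?K \<zeta> + 2 * ln (cmod (z - \<zeta>))\<bar> \<le> \<eta> / 4" if "\<zeta> \<in> Z n" for \<zeta>
    proof -
      have "infdist z E \<le> infdist \<zeta> E + dist z \<zeta>"
        by (rule infdist_triangle)
      moreover have "infdist \<zeta> E < \<rho>"
        using elim that by blast
      ultimately have "\<rho> \<le> cmod (z - \<zeta>)"
        by (simp add: \<rho>_def dist_norm)
      then show ?thesis
        using log_kernel_reg_approx[OF e(1) \<open>0 < \<rho>\<close>, of z \<zeta>] e(3) by linarith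
    qed
    have "avg n ?K + 2 * avg n (\<lambda>\<zeta>. ln (cmod (z - \<zeta>))) = 
        (\<Sum>\<zeta>\<in>Z n. ?K \<zeta> + 2 * ln (cmod (z - \<zeta>))) / real (card (Z n))"
      by (simp add: avg_def sum.distrib add_divide_distrib sum_distrib_left)
    also have "\<bar>\<dots>\<bar> \<le> (\<Sum>\<zeta>\<in>Z n. \<eta> / 4) / real (card (Z n))"
      unfolding abs_divide abs_of_nat using *
      by (intro divide_right_mono order_trans[OF sum_abs] sum_mono) auto
    also have "\<dots> = \<eta> / 4"
      using d by simp
    finally have "\<bar>avg n ?K + 2 * avg n (\<lambda>\<zeta>. ln (cmod (z - \<zeta>)))\<bar> \<le> \<eta> / 4" .
    moreover have "\<bar>avg n ?K - pot e z\<bar> < \<eta> / 4"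
      using elim by (simp add: discrepancy_def pot_def)
    ultimately show ?case
      using pot \<eta> unfolding dist_real_def by linarith
  qed
qed

lemma log_plus_prod_tendsto_off:
  assumes "z \<notin> E"
  shows "(\<lambda>n. log_plus (cmod (\<Prod>\<zeta>\<in>Z n. z - \<zeta>)) / real (card (Z n))) \<longlonglongrightarrow> max (log_pot z) 0"
proof -
  define \<rho> where "\<rho> = infdist z E"
  have "0 < \<rho>"
    unfolding \<rho>_def using assms E_nonempty compact_imp_closed[OF compact_E]
    by (simp add: infdist_pos_not_in_closed)
  have "eventually (\<lambda>n. max (avg n (\<lambda>\<zeta>. ln (cmod (z - \<zeta>)))) 0 
      = log_plus (cmod (\<Prod>\<zeta>\<in>Z n. z - \<zeta>)) / real (card (Z n))) sequentially"
    using near_E[OF \<open>0 < \<rho>\<close>]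
  proof eventually_elim
    case (elim n)
    then have "z \<notin> Z n"
      by (auto simp: \<rho>_def)
    then have "ln (cmod (\<Prod>\<zeta>\<in>Z n. z - \<zeta>)) = (\<Sum>\<zeta>\<in>Z n. ln (cmod (z - \<zeta>)))"
      unfolding prod_norm[symmetric] using finite_Z by (intro ln_prod) auto
    then show ?case
      by (simp add: log_plus_def avg_def max_divide_distrib_right)
  qed
  moreover have "(\<lambda>n. max (avg n (\<lambda>\<zeta>. ln (cmod (z - \<zeta>)))) 0) \<longlonglongrightarrow> max (log_pot z) 0"
    by (intro tendsto_max log_average_tendsto assms tendsto_const)
  ultimately show ?thesis
    by (rule Lim_transform_eventually[rotated])
qed

text \<open>Nonnegativity of \<open>log_plus\<close> settles the lower bound, and above, ln |z -
  \<zeta>| is at most half of minus the regularised kernel at any distance. So z may lie arbitrarily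
  close to roots.\<close>

lemma log_plus_prod_tendsto_on:
  assumes "z \<in> E"
  shows "(\<lambda>n. log_plus (cmod (\<Prod>\<zeta>\<in>Z n. z - \<zeta>)) / real (card (Z n))) \<longlonglongrightarrow> 0"
proof (rule tendstoI)
  fix \<eta> :: real
  assume \<eta>: "0 < \<eta>"
  obtain e where e: "0 < e" "e \<le> 1" "- \<eta> < pot e z"
    using pot_lower[OF assms \<eta>] by auto
  let ?K = "log_kernel_reg e z"
  have "eventually (\<lambda>n. \<bar>discrepancy n ?K\<bar> < \<eta>) sequentially"
    using tendstoD[OF discrepancy_tendsto_0[OF e(1,2), of z], of \<eta>] \<eta> by (simp add: dist_real_def)
  then show "eventually (\<lambda>n. dist (log_plus (cmod (\<Prod>\<zeta>\<in>Z n. z - \<zeta>)) / real (card (Z n))) 0 < \<eta>) sequentially"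
    using eventually_nonempty
  proof eventually_elim
    case (elim n)
    let ?d = "real (card (Z n))"
    have d: "?d > 0"
      using elim finite_Z[of n] by (simp add: card_gt_0_iff)
    have "log_plus (cmod (\<Prod>\<zeta>\<in>Z n. z - \<zeta>)) < ?d * \<eta>"
    proof (cases "z \<in> Z n")
      \<comment> \<open>If z is a root the product is 0, and \<open>log_plus\<close> vanishes there
        through the convention ln 0 = 0.\<close>
      case True
      then have "(\<Prod>\<zeta>\<in>Z n. z - \<zeta>) = 0"
        using finite_Z by (auto simp: prod_zero_iff)
      then show ?thesis
        using d \<eta> by (simp add: log_plus_def)
    next
      case False
      then have "ln (cmod (\<Prod>\<zeta>\<in>Z n. z - \<zeta>)) = (\<Sum>\<zeta>\<in>Z n. ln (cmod (z - \<zeta>)))"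
        unfolding prod_norm[symmetric] using finite_Z by (intro ln_prod) auto
      also have "\<dots> \<le> (\<Sum>\<zeta>\<in>Z n. - ?K \<zeta> / 2)"
      proof (rule sum_mono)
        fix \<zeta>
        assume "\<zeta> \<in> Z n"
        with False have "z \<noteq> \<zeta>" by auto
        from log_kernel_reg_le[OF e(1) this] show "ln (cmod (z - \<zeta>)) \<le> - ?K \<zeta> / 2"
          by simp
      qed
      also have "\<dots> = - (\<Sum>\<zeta>\<in>Z n. ?K \<zeta>) / 2"
        by (simp add: sum_negf sum_divide_distrib)
      also have "\<dots> = ?d * (- avg n ?K / 2)"
        using d by (simp add: avg_def)
      also have "\<dots> < ?d * \<eta>"
      proof (rule mult_strict_left_mono[OF _ d])
        have "avg n ?K - pot e z = discrepancy n ?K"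
          by (simp add: discrepancy_def pot_def)
        then show "- avg n ?K / 2 < \<eta>"
          using elim(1) e(3) by linarith
      qed
      finally show ?thesis
        using d \<eta> by (simp add: log_plus_def)
    qed
    then show ?case
      using d log_plus_nonneg[of "cmod (\<Prod>\<zeta>\<in>Z n. z - \<zeta>)"]
      by (simp add: dist_real_def pos_divide_less_eq mult.commute)
  qed
qed

end


section \<open>Energy and regularised potentials\<close>

context compact_prob
begin

text \<open>Monotone convergence of integrals needs a sequence of parameters instead of a real
  one.\<close>

definition reg_seq :: "nat \<Rightarrow> real" where
  "reg_seq n = 1 / real (Suc n)"

lemma reg_seq: "0 < reg_seq n" "reg_seq n \<le> 1" "m \<le> n \<Longrightarrow> reg_seq n \<le> reg_seq m"
  by (auto simp: reg_seq_def intro!: divide_left_mono)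

lemma reg_seq_LIMSEQ: "reg_seq \<longlonglongrightarrow> 0"
  unfolding reg_seq_def by (rule LIMSEQ_Suc[OF lim_1_over_n])

text \<open>One shift for all parameters e in (0, 1], so the shifted kernels stay monotone in
  e.\<close>

definition kernel_bound :: real where
  "kernel_bound = ln (1 + (diameter E)\<^sup>2)"

lemma cmod_diff_le_diameter: "z \<in> E \<Longrightarrow> w \<in> E \<Longrightarrow> cmod (z - w) \<le> diameter E"
  using diameter_bounded_bound[OF compact_imp_bounded[OF compact_E], of z w] by (simp add: dist_norm)

lemma kernel_bound_le:
  assumes "z \<in> E" "w \<in> E" "0 < e" "e \<le> 1"
  shows "0 \<le> log_kernel_reg e z w + kernel_bound"
proof -
  have "(cmod (z - w))\<^sup>2 \<le> (diameter E)\<^sup>2"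
    using cmod_diff_le_diameter[OF assms(1,2)] by (intro power_mono) auto
  then show ?thesis
    using assms by (simp add: log_kernel_reg_def kernel_bound_def add_pos_nonneg)
qed

lemma kernel_bound_nonneg: "0 \<le> kernel_bound"
  by (simp add: kernel_bound_def)

text \<open>The logarithmic kernel shifted by a constant that makes it nonnegative on \<open>E\<close>, with the
  value \<open>\<infinity>\<close> on the diagonal.\<close>

definition shifted_kernel :: "complex \<Rightarrow> complex \<Rightarrow> ennreal" where
  "shifted_kernel z w = (SUP n. ennreal (log_kernel_reg (reg_seq n) z w + kernel_bound))"

lemma incseq_reg_kernel: "incseq (\<lambda>n. ennreal (log_kernel_reg (reg_seq n) z w + kernel_bound))"
  by (intro incseq_SucI ennreal_leI add_right_mono log_kernel_reg_antimono reg_seq) simp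

lemma shifted_kernel_off_diagonal:
  assumes "z \<noteq> w"
  shows "shifted_kernel z w = ennreal (- 2 * ln (cmod (z - w)) + kernel_bound)"
proof -
  have "(\<lambda>n. log_kernel_reg (reg_seq n) z w + kernel_bound)
      \<longlonglongrightarrow> - ln (0 + (cmod (z - w))\<^sup>2) + kernel_bound"
    unfolding log_kernel_reg_def using assms by (intro tendsto_intros reg_seq_LIMSEQ) auto
  then have "(\<lambda>n. ennreal (log_kernel_reg (reg_seq n) z w + kernel_bound))
      \<longlonglongrightarrow> ennreal (- ln (0 + (cmod (z - w))\<^sup>2) + kernel_bound)"
    by (rule tendsto_ennrealI)
  moreover have "(\<lambda>n. ennreal (log_kernel_reg (reg_seq n) z w + kernel_bound)) \<longlonglongrightarrow> shifted_kernel z w"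
    unfolding shifted_kernel_def by (rule LIMSEQ_SUP[OF incseq_reg_kernel])
  ultimately have "shifted_kernel z w = ennreal (- ln (0 + (cmod (z - w))\<^sup>2) + kernel_bound)"
    by (rule LIMSEQ_unique[rotated])
  then show ?thesis
    using assms by (simp add: ln_realpow)
qed

lemma shifted_kernel_diagonal: "shifted_kernel z z = \<infinity>"
proof -
  have "ennreal (real n) \<le> shifted_kernel z z" for n
  proof -
    obtain m where m: "exp (real n) \<le> real m"
      using real_arch_simple by blast
    have "real n \<le> ln (real (Suc m))"
      using m by (subst ln_ge_iff) auto
    also have "\<dots> \<le> log_kernel_reg (reg_seq m) z z + kernel_bound"
      using kernel_bound_nonneg by (simp add: log_kernel_reg_def reg_seq_def ln_div)
    finally show ?thesis
      unfolding shifted_kernel_def by (intro SUP_upper2[of m] ennreal_leI) auto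
  qed
  then show ?thesis
    by (metis ennreal_of_nat_eq_real_of_nat infinity_ennreal_def neq_top_trans ennreal_Ex_less_of_nat
        leD top.not_eq_extremum)
qed

lemma borel_measurable_log_kernel_reg [measurable]:
  "0 < e \<Longrightarrow> (\<lambda>p. log_kernel_reg e (fst p) (snd p)) \<in> borel_measurable (borel \<Otimes>\<^sub>M borel)"
  unfolding log_kernel_reg_def by measurable

lemma nn_integral_shifted_kernel:
  assumes "z \<in> E"
  shows "(\<integral>\<^sup>+ w. shifted_kernel z w \<partial>\<mu>) = (SUP n. ennreal (pot (reg_seq n) z + kernel_bound))"
proof -
  have "(\<integral>\<^sup>+ w. shifted_kernel z w \<partial>\<mu>) = 
      (SUP n. \<integral>\<^sup>+ w. ennreal (log_kernel_reg (reg_seq n) z w + kernel_bound) \<partial>\<mu>)"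
    unfolding shifted_kernel_def
  proof (rule nn_integral_monotone_convergence_SUP)
    show "incseq (\<lambda>n w. ennreal (log_kernel_reg (reg_seq n) z w + kernel_bound))"
      using incseq_reg_kernel by (auto simp: incseq_def le_fun_def)
    show "(\<lambda>w. ennreal (log_kernel_reg (reg_seq n) z w + kernel_bound)) \<in> borel_measurable \<mu>" for n
      by (intro measurable_\<mu> measurable_compose[OF _ measurable_ennreal] borel_measurable_add borel_measurable_const
          borel_measurable_continuous_onI[OF continuous_log_kernel_reg2[OF reg_seq(1)]])
  qed
  also have "\<dots> = (SUP n. ennreal (pot (reg_seq n) z + kernel_bound))"
  proof (rule SUP_cong[OF refl])
    fix n
    have "(\<integral>\<^sup>+ w. ennreal (log_kernel_reg (reg_seq n) z w + kernel_bound) \<partial>\<mu>) =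
        ennreal (\<integral>w. log_kernel_reg (reg_seq n) z w + kernel_bound \<partial>\<mu>)"
    proof (rule nn_integral_eq_integral)
      show "integrable \<mu> (\<lambda>w. log_kernel_reg (reg_seq n) z w + kernel_bound)"
        using integrable_log_kernel_reg[OF reg_seq(1)] by simp
      show "AE w in \<mu>. 0 \<le> log_kernel_reg (reg_seq n) z w + kernel_bound"
        using AE_E by eventually_elim (intro kernel_bound_le assms reg_seq)
    qed
    also have "(\<integral>w. log_kernel_reg (reg_seq n) z w + kernel_bound \<partial>\<mu>) = pot (reg_seq n) z + kernel_bound"
      unfolding pot_def using integrable_log_kernel_reg[OF reg_seq(1)] by (simp add: prob_space)
    finally show "(\<integral>\<^sup>+ w. ennreal (log_kernel_reg (reg_seq n) z w + kernel_bound) \<partial>\<mu>) =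
        ennreal (pot (reg_seq n) z + kernel_bound)" .
  qed
  finally show ?thesis .
qed

lemma pot_bound_nonneg:
  assumes "z \<in> E" "0 < e" "e \<le> 1"
  shows "0 \<le> pot e z + kernel_bound"
proof -
  have "0 \<le> (\<integral>w. log_kernel_reg e z w + kernel_bound \<partial>\<mu>)"
    using AE_E by (intro integral_nonneg_AE) (auto elim!: eventually_mono intro!: kernel_bound_le assms)
  then show ?thesis
    unfolding pot_def using integrable_log_kernel_reg[OF assms(2), of z] by (simp add: prob_space)
qed

lemma nn_integral2_shifted_kernel:
  "(\<integral>\<^sup>+ z. \<integral>\<^sup>+ w. shifted_kernel z w \<partial>\<mu> \<partial>\<mu>) = 
    (SUP n. ennreal ((\<integral>z. pot (reg_seq n) z \<partial>\<mu>) + kernel_bound))"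
proof -
  have int: "integrable \<mu> (\<lambda>z. pot (reg_seq n) z)" for n
    by (intro integrable_continuous continuous_pot reg_seq)
  have "(\<integral>\<^sup>+ z. \<integral>\<^sup>+ w. shifted_kernel z w \<partial>\<mu> \<partial>\<mu>) 
      = (\<integral>\<^sup>+ z. (SUP n. ennreal (pot (reg_seq n) z + kernel_bound)) \<partial>\<mu>)"
    using AE_E by (intro nn_integral_cong_AE) (auto elim!: eventually_mono simp: nn_integral_shifted_kernel)
  also have "\<dots> = (SUP n. \<integral>\<^sup>+ z. ennreal (pot (reg_seq n) z + kernel_bound) \<partial>\<mu>)"
  proof (rule nn_integral_monotone_convergence_SUP)
    show "incseq (\<lambda>n z. ennreal (pot (reg_seq n) z + kernel_bound))"
      by (intro incseq_SucI le_funI ennreal_leI add_right_mono pot_antimono reg_seq) simp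
    show "(\<lambda>z. ennreal (pot (reg_seq n) z + kernel_bound)) \<in> borel_measurable \<mu>" for n
      by (intro measurable_\<mu> measurable_compose[OF _ measurable_ennreal] borel_measurable_add borel_measurable_const
          borel_measurable_continuous_onI[OF continuous_pot[OF reg_seq(1)]])
  qed
  also have "\<dots> = (SUP n. ennreal ((\<integral>z. pot (reg_seq n) z \<partial>\<mu>) + kernel_bound))"
  proof (rule SUP_cong[OF refl])
    fix n
    have "(\<integral>\<^sup>+ z. ennreal (pot (reg_seq n) z + kernel_bound) \<partial>\<mu>) =
        ennreal (\<integral>z. pot (reg_seq n) z + kernel_bound \<partial>\<mu>)"
      using AE_E int by (intro nn_integral_eq_integral)
        (auto elim!: eventually_mono intro!: pot_bound_nonneg reg_seq)
    then show "(\<integral>\<^sup>+ z. ennreal (pot (reg_seq n) z + kernel_bound) \<partial>\<mu>) =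
        ennreal ((\<integral>z. pot (reg_seq n) z \<partial>\<mu>) + kernel_bound)"
      using int by (simp add: prob_space)
  qed
  finally show ?thesis .
qed

text \<open>If the potential were bounded away from \<open>0\<close> from above at a point of \<open>E\<close>, the logarithm would be
  integrable there and the integral would be nonzero.  The converse case, where the Bochner
  integral has the junk value \<open>0\<close>, is harmless because then the potentials are unbounded.\<close>

lemma pot_lower_bound_of_log_pot_zero:
  assumes z: "z \<in> E" and zero: "(\<integral>w. ln (cmod (z - w)) \<partial>\<mu>) = 0" and \<eta>: "0 < \<eta>"
  shows "\<exists>e>0. e \<le> 1 \<and> - \<eta> < pot e z"
proof (rule ccontr)
  assume "\<not> ?thesis"
  then have le: "pot (reg_seq n) z \<le> - \<eta>" for n
    using reg_seq[of n] by force
  let ?f = "\<lambda>w. - 2 * ln (cmod (z - w)) + kernel_bound"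
  have bound: "(\<integral>\<^sup>+ w. shifted_kernel z w \<partial>\<mu>) \<le> ennreal (kernel_bound - \<eta>)"
  proof -
    have "pot (reg_seq n) z + kernel_bound \<le> kernel_bound - \<eta>" for n
      using le[of n] by simp
    then show ?thesis
      unfolding nn_integral_shifted_kernel[OF z] by (intro SUP_least ennreal_leI)
  qed
  have "shifted_kernel z \<in> borel_measurable \<mu>"
    unfolding shifted_kernel_def[abs_def]
    by (intro measurable_\<mu> borel_measurable_SUP measurable_compose[OF _ measurable_ennreal] borel_measurable_add
        borel_measurable_const borel_measurable_continuous_onI[OF continuous_log_kernel_reg2[OF reg_seq(1)]]) auto
  then have "AE w in \<mu>. shifted_kernel z w \<noteq> \<infinity>"
    using bound by (intro nn_integral_PInf_AE) (auto simp: top_unique)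
  \<comment> \<open>The kernel is infinite on the diagonal, so a finite integral excludes an atom at
    z, and the shifted logarithm agrees with the kernel almost everywhere.\<close>
  then have ne: "AE w in \<mu>. z \<noteq> w"
    by eventually_elim (use shifted_kernel_diagonal in auto)
  have eq: "AE w in \<mu>. ennreal (?f w) = shifted_kernel z w"
    using ne by eventually_elim (simp add: shifted_kernel_off_diagonal)
  have nonneg: "AE w in \<mu>. 0 \<le> ?f w"
    using ne AE_E
  proof eventually_elim
    case (elim w)
    have "ln ((cmod (z - w))\<^sup>2) \<le> kernel_bound"
      unfolding kernel_bound_def
    proof (subst ln_le_cancel_iff)
      have "(cmod (z - w))\<^sup>2 \<le> (diameter E)\<^sup>2"
        using cmod_diff_le_diameter[OF z] elim by (intro power_mono) auto
      then show "(cmod (z - w))\<^sup>2 \<le> 1 + (diameter E)\<^sup>2" by simp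
    qed (use elim in \<open>auto simp: add_pos_nonneg\<close>)
    then show ?case
      using elim by (simp add: ln_realpow)
  qed
  have nn: "(\<integral>\<^sup>+ w. ennreal (?f w) \<partial>\<mu>) \<le> ennreal (kernel_bound - \<eta>)"
    using bound by (subst nn_integral_cong_AE[OF eq])
  have meas: "?f \<in> borel_measurable \<mu>"
    by (intro measurable_\<mu>) measurable
  have int: "integrable \<mu> ?f"
    using nn nonneg meas by (intro integrableI_nonneg) (auto intro: le_less_trans)
  have "ennreal (\<integral>w. ?f w \<partial>\<mu>) \<le> ennreal (kernel_bound - \<eta>)"
    using nn nn_integral_eq_integral[OF int nonneg] by simp
  \<comment> \<open>Integrability is now available, so the assumed value 0 is a true integral and
    only the shift remains; this contradicts the bound lowered by \<eta>.\<close>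
  moreover have "(\<integral>w. ?f w \<partial>\<mu>) = kernel_bound"
  proof -
    have "integrable \<mu> (\<lambda>w. (?f w - kernel_bound) / (- 2))"
      by (intro integrable_divide_zero Bochner_Integration.integrable_diff int) auto
    then have "integrable \<mu> (\<lambda>w. ln (cmod (z - w)))"
      by simp
    then show ?thesis
      using zero by (simp add: prob_space)
  qed
  ultimately have "ennreal kernel_bound \<le> ennreal (kernel_bound - \<eta>)"
    by simp
  moreover have "0 \<le> kernel_bound - \<eta>"
    using le[of 0] pot_bound_nonneg[OF z reg_seq(1,2), of 0] by linarith
  ultimately show False
    using \<eta> by simp
qed

text \<open>Written additively to avoid subtraction in \<open>ennreal\<close>. Off the diagonal it
  splits the logarithm into positive and negative parts; on the diagonal both sides are
  infinite.\<close>

lemma kernel_parts: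
  assumes "z \<in> E" "w \<in> E"
  shows "shifted_kernel z w + 2 * e2ennreal (- log_kernel z w) = 2 * e2ennreal (log_kernel z w) + ennreal kernel_bound"
proof (cases "z = w")
  case True
  then show ?thesis
    by (simp add: shifted_kernel_diagonal log_kernel_def ennreal_mult_top)
next
  case False
  let ?l = "ln (cmod (z - w))"
  have l: "ln (1 / cmod (z - w)) = - ?l"
    using False by (simp add: ln_div)
  have "(cmod (z - w))\<^sup>2 \<le> (diameter E)\<^sup>2"
    using cmod_diff_le_diameter[OF assms] by (intro power_mono) auto
  then have "ln ((cmod (z - w))\<^sup>2) \<le> kernel_bound"
    unfolding kernel_bound_def using False by (subst ln_le_cancel_iff) (auto simp: add_pos_nonneg)
  then have nonneg: "0 \<le> - 2 * ?l + kernel_bound"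
    using False by (simp add: ln_realpow)
  have two: "2 * ennreal x = ennreal (2 * x)" if "0 \<le> x" for x
    using that by (simp add: ennreal_mult)
  show ?thesis
  proof (cases "0 \<le> ?l")
    case True
    then show ?thesis
      using nonneg unfolding shifted_kernel_off_diagonal[OF False] log_kernel_def l
      using False by (simp add: e2ennreal_ereal e2ennreal_neg ennreal_neg two flip: ennreal_plus)
  next
    case neg: False
    then show ?thesis
      using nonneg kernel_bound_nonneg unfolding shifted_kernel_off_diagonal[OF False] log_kernel_def l
      using False by (simp add: e2ennreal_ereal e2ennreal_neg ennreal_neg two flip: ennreal_plus)
  qed
qed

lemma borel_measurable_log_kernel [measurable]:
  "(\<lambda>p. log_kernel (fst p) (snd p)) \<in> borel_measurable (borel \<Otimes>\<^sub>M borel)"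
proof -
  have "{p :: complex \<times> complex. fst p = snd p} \<in> sets (borel \<Otimes>\<^sub>M borel)"
    unfolding borel_prod by (intro borel_closed closed_Collect_eq continuous_intros)
  then have [measurable]: "Measurable.pred (borel \<Otimes>\<^sub>M borel) (\<lambda>p :: complex \<times> complex. fst p = snd p)"
    by (simp add: pred_def space_pair_measure)
  show ?thesis
    unfolding log_kernel_def by measurable
qed

lemma measurable_pair_\<mu>:
  "f \<in> borel_measurable (borel \<Otimes>\<^sub>M borel) \<Longrightarrow> f \<in> borel_measurable (\<mu> \<Otimes>\<^sub>M \<mu>)"
  using measurable_cong_sets[OF sets_pair_measure_cong[OF sets_\<mu> sets_\<mu>] refl] by blast

lemma borel_measurable_shifted_kernel:
  "(\<lambda>p. shifted_kernel (fst p) (snd p)) \<in> borel_measurable (borel \<Otimes>\<^sub>M borel)"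
  unfolding shifted_kernel_def
  by (intro borel_measurable_SUP measurable_compose[OF _ measurable_ennreal] borel_measurable_add
        borel_measurable_const borel_measurable_log_kernel_reg reg_seq) auto

text \<open>\<open>kernel_parts\<close> integrated twice. Finiteness of \<open>B\<close>, from ln t
  <= t <= diameter, rules out \<infinity> - \<infinity> in \<open>energy\<close> and permits
  cancellation.\<close>

lemma nn_integral2_parts:
  defines "A \<equiv> (\<integral>\<^sup>+ z. \<integral>\<^sup>+ w. e2ennreal (log_kernel z w) \<partial>\<mu> \<partial>\<mu>)"
    and "B \<equiv> (\<integral>\<^sup>+ z. \<integral>\<^sup>+ w. e2ennreal (- log_kernel z w) \<partial>\<mu> \<partial>\<mu>)"
  shows "(SUP n. ennreal ((\<integral>z. pot (reg_seq n) z \<partial>\<mu>) + kernel_bound)) + 2 * B = 2 * A + ennreal kernel_bound"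
    and "B < \<infinity>"
proof -
  let ?p = "\<lambda>z w. e2ennreal (log_kernel z w)" and ?q = "\<lambda>z w. e2ennreal (- log_kernel z w)"
  have p: "(\<lambda>x. ?p (fst x) (snd x)) \<in> borel_measurable (\<mu> \<Otimes>\<^sub>M \<mu>)"
    by (intro measurable_pair_\<mu> measurable_compose[OF borel_measurable_log_kernel measurable_e2ennreal])
  have q: "(\<lambda>x. ?q (fst x) (snd x)) \<in> borel_measurable (\<mu> \<Otimes>\<^sub>M \<mu>)"
    by (intro measurable_pair_\<mu> measurable_compose[OF borel_measurable_uminus_ereal[OF borel_measurable_log_kernel] measurable_e2ennreal])
  note k = measurable_pair_\<mu>[OF borel_measurable_shifted_kernel]
  have sec: "(\<lambda>w. f z w) \<in> borel_measurable \<mu>" 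
    if "(\<lambda>x. f (fst x) (snd x)) \<in> borel_measurable (\<mu> \<Otimes>\<^sub>M \<mu>)" for f :: "complex \<Rightarrow> complex \<Rightarrow> ennreal" and z
    using measurable_compose[OF measurable_Pair1'[of z \<mu> \<mu>] that] sets_eq_imp_space_eq[OF sets_\<mu>] by simp
  have out: "(\<lambda>z. \<integral>\<^sup>+ w. f z w \<partial>\<mu>) \<in> borel_measurable \<mu>" 
    if "(\<lambda>x. f (fst x) (snd x)) \<in> borel_measurable (\<mu> \<Otimes>\<^sub>M \<mu>)" for f :: "complex \<Rightarrow> complex \<Rightarrow> ennreal"
    using that by (intro borel_measurable_nn_integral) (simp add: case_prod_beta')
  have "(\<integral>\<^sup>+ z. \<integral>\<^sup>+ w. shifted_kernel z w + 2 * ?q z w \<partial>\<mu> \<partial>\<mu>) 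
      = (\<integral>\<^sup>+ z. \<integral>\<^sup>+ w. 2 * ?p z w + ennreal kernel_bound \<partial>\<mu> \<partial>\<mu>)"
    using AE_E
    by (intro nn_integral_cong_AE; elim eventually_mono; intro nn_integral_cong_AE; 
        intro eventually_mono[OF AE_E] kernel_parts)
  moreover have "(\<integral>\<^sup>+ z. \<integral>\<^sup>+ w. shifted_kernel z w + 2 * ?q z w \<partial>\<mu> \<partial>\<mu>) 
      = (\<integral>\<^sup>+ z. \<integral>\<^sup>+ w. shifted_kernel z w \<partial>\<mu> \<partial>\<mu>) + 2 * B"
    unfolding B_def using sec[OF k] sec[OF q] out[OF k] out[OF q]
    by (simp add: nn_integral_add nn_integral_cmult)
  moreover have "(\<integral>\<^sup>+ z. \<integral>\<^sup>+ w. 2 * ?p z w + ennreal kernel_bound \<partial>\<mu> \<partial>\<mu>) = 2 * A + ennreal kernel_bound"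
    unfolding A_def using sec[OF p] out[OF p]
    by (simp add: nn_integral_add nn_integral_cmult emeasure_space_1)
  ultimately show "(SUP n. ennreal ((\<integral>z. pot (reg_seq n) z \<partial>\<mu>) + kernel_bound)) + 2 * B = 2 * A + ennreal kernel_bound"
    unfolding nn_integral2_shifted_kernel by simp
  have "B \<le> (\<integral>\<^sup>+ z. \<integral>\<^sup>+ w. ennreal (diameter E) \<partial>\<mu> \<partial>\<mu>)"
    unfolding B_def
  proof (intro nn_integral_mono_AE eventually_mono[OF AE_E])
    fix z w
    assume zw: "z \<in> E" "w \<in> E"
    show "?q z w \<le> ennreal (diameter E)"
    proof (cases "z = w")
      case True
      then show ?thesis
        by (simp add: log_kernel_def e2ennreal_neg)
    next
      case False
      then have "ln (cmod (z - w)) \<le> cmod (z - w)"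
        using ln_le_minus_one[of "cmod (z - w)"] by simp
      also have "\<dots> \<le> diameter E"
        by (rule cmod_diff_le_diameter[OF zw])
      finally show ?thesis
        using False by (simp add: log_kernel_def ln_div e2ennreal_ereal ennreal_leI)
    qed
  qed
  also have "\<dots> < \<infinity>"
    by (simp add: emeasure_space_1)
  finally show "B < \<infinity>" .
qed

text \<open>Each regularised self-energy lies below the supremum along \<open>reg_seq\<close>, which
  is twice the energy once the shift and the finite negative part are cancelled.\<close>

lemma self_energy_le_energy:
  assumes "0 < e" "e \<le> 1"
  shows "ereal (\<integral>z. pot e z \<partial>\<mu>) \<le> 2 * energy \<mu>"
proof -
  define A where "A = (\<integral>\<^sup>+ z. \<integral>\<^sup>+ w. e2ennreal (log_kernel z w) \<partial>\<mu> \<partial>\<mu>)"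
  define B where "B = (\<integral>\<^sup>+ z. \<integral>\<^sup>+ w. e2ennreal (- log_kernel z w) \<partial>\<mu> \<partial>\<mu>)"
  have energy: "energy \<mu> = enn2ereal A - enn2ereal B"
    by (simp add: energy_def A_def B_def)
  note parts = nn_integral2_parts[folded A_def B_def]
  obtain n where n: "reg_seq n \<le> e"
    using order_tendstoD(2)[OF reg_seq_LIMSEQ assms(1)] by (auto simp: eventually_sequentially intro: less_imp_le)
  have "(\<integral>z. pot e z \<partial>\<mu>) \<le> (\<integral>z. pot (reg_seq n) z \<partial>\<mu>)"
    using n assms by (intro integral_mono integrable_continuous continuous_pot pot_antimono reg_seq) auto
  then have "ennreal ((\<integral>z. pot e z \<partial>\<mu>) + kernel_bound) \<le> (SUP n. ennreal ((\<integral>z. pot (reg_seq n) z \<partial>\<mu>) + kernel_bound))"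
    by (intro SUP_upper2[of n] ennreal_leI) auto
  then have le: "ennreal ((\<integral>z. pot e z \<partial>\<mu>) + kernel_bound) + 2 * B \<le> 2 * A + ennreal kernel_bound"
    unfolding parts(1)[symmetric] by (rule add_right_mono)
  obtain b where b: "B = ennreal b" "0 \<le> b"
    using parts(2) by (cases B) auto
  show ?thesis
  proof (cases A)
    case (real a)
    have two: "2 * ennreal x = ennreal (2 * x)" if "0 \<le> x" for x
      using that by (simp add: ennreal_mult)
    have "0 \<le> (\<integral>z. pot e z + kernel_bound \<partial>\<mu>)"
      using AE_E assms by (intro integral_nonneg_AE) (auto elim!: eventually_mono intro!: pot_bound_nonneg)
    then have nonneg: "0 \<le> (\<integral>z. pot e z \<partial>\<mu>) + kernel_bound"
      using integrable_continuous[OF continuous_pot[OF assms(1)]] by (simp add: prob_space)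
    have "ennreal ((\<integral>z. pot e z \<partial>\<mu>) + kernel_bound + 2 * b) \<le> ennreal (2 * a + kernel_bound)"
      using le nonneg b real kernel_bound_nonneg by (simp add: two ennreal_plus)
    then have "(\<integral>z. pot e z \<partial>\<mu>) \<le> 2 * (a - b)"
      using b real kernel_bound_nonneg by (subst (asm) ennreal_le_iff) auto
    then show ?thesis
      using b real by (simp add: energy enn2ereal_ennreal)
  next
    case top
    then show ?thesis
      using b by (simp add: energy enn2ereal_ennreal)
  qed
qed

text \<open>A bound uniform in e survives the supremum along \<open>reg_seq\<close>. With the
  preceding lemma this lets the minimiser be found using continuous kernels only.\<close>

lemma energy_le_of_self_energy_le:
  assumes "\<And>e. 0 < e \<Longrightarrow> e \<le> 1 \<Longrightarrow> (\<integral>z. pot e z \<partial>\<mu>) \<le> 2 * c"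
  shows "energy \<mu> \<le> ereal c"
proof -
  define A where "A = (\<integral>\<^sup>+ z. \<integral>\<^sup>+ w. e2ennreal (log_kernel z w) \<partial>\<mu> \<partial>\<mu>)"
  define B where "B = (\<integral>\<^sup>+ z. \<integral>\<^sup>+ w. e2ennreal (- log_kernel z w) \<partial>\<mu> \<partial>\<mu>)"
  have energy: "energy \<mu> = enn2ereal A - enn2ereal B"
    by (simp add: energy_def A_def B_def)
  note parts = nn_integral2_parts[folded A_def B_def]
  obtain b where b: "B = ennreal b" "0 \<le> b"
    using parts(2) by (cases B) auto
  have "0 \<le> (\<integral>z. pot 1 z + kernel_bound \<partial>\<mu>)"
    using AE_E by (intro integral_nonneg_AE) (auto elim!: eventually_mono intro!: pot_bound_nonneg)
  then have "0 \<le> (\<integral>z. pot 1 z \<partial>\<mu>) + kernel_bound"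
    using integrable_continuous[OF continuous_pot[of 1]] by (simp add: prob_space)
  then have nonneg: "0 \<le> 2 * c + kernel_bound"
    using assms[of 1] by simp
  have "(SUP n. ennreal ((\<integral>z. pot (reg_seq n) z \<partial>\<mu>) + kernel_bound)) \<le> ennreal (2 * c + kernel_bound)"
    using assms[OF reg_seq(1,2)] by (intro SUP_least ennreal_leI) auto
  then have le: "2 * A + ennreal kernel_bound \<le> ennreal (2 * c + kernel_bound) + 2 * B"
    unfolding parts(1)[symmetric] by (rule add_right_mono)
  have two: "2 * ennreal x = ennreal (2 * x)" if "0 \<le> x" for x
    using that by (simp add: ennreal_mult)
  show ?thesis
  proof (cases A)
    case (real a)
    have "ennreal (2 * a + kernel_bound) \<le> ennreal (2 * c + kernel_bound + 2 * b)"
      using le nonneg b real kernel_bound_nonneg by (simp add: two ennreal_plus)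
    then have "a - b \<le> c"
      using b nonneg by (subst (asm) ennreal_le_iff) auto
    then show ?thesis
      using b real by (simp add: energy enn2ereal_ennreal)
  next
    case top
    then have "\<top> \<le> ennreal (2 * c + kernel_bound) + 2 * B"
      using le by (simp add: ennreal_mult_top)
    then show ?thesis
      using b by (simp add: two top_unique flip: ennreal_plus)
  qed
qed

end


section \<open>Existence of the equilibrium measure\<close>

definition binary_digit :: "nat \<Rightarrow> real \<Rightarrow> real" where
  "binary_digit k t = real_of_int \<lfloor>2 ^ Suc k * t\<rfloor> - 2 * real_of_int \<lfloor>2 ^ k * t\<rfloor>"

lemma binary_digit_cases: "binary_digit k t = 0 \<or> binary_digit k t = 1"
proof -
  have "\<lfloor>2 ^ Suc k * t\<rfloor> = 2 * \<lfloor>2 ^ k * t\<rfloor> \<or> \<lfloor>2 ^ Suc k * t\<rfloor> = 2 * \<lfloor>2 ^ k * t\<rfloor> + 1"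
    by (simp add: mult.assoc) linarith
  then show ?thesis
    unfolding binary_digit_def by (elim disjE) simp_all
qed

lemma binary_digits_determine:
  assumes "\<lfloor>t\<rfloor> = 0" "\<lfloor>u\<rfloor> = 0" "\<And>k. k < N \<Longrightarrow> binary_digit k t = binary_digit k u"
  shows "\<lfloor>2 ^ N * t\<rfloor> = \<lfloor>2 ^ N * u\<rfloor>"
  using assms(3)
proof (induction N)
  case 0
  then show ?case using assms(1,2) by simp
next
  case (Suc N)
  then have "\<lfloor>2 ^ N * t\<rfloor> = \<lfloor>2 ^ N * u\<rfloor>" "binary_digit N t = binary_digit N u"
    by auto
  then have "real_of_int \<lfloor>2 ^ Suc N * t\<rfloor> = real_of_int \<lfloor>2 ^ Suc N * u\<rfloor>"
    unfolding binary_digit_def by simp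
  then show ?case
    using of_int_eq_iff by blast
qed

text \<open>In base 8 the digits 0 to 3 leave gaps: in units of 8^-(j+2), the first difference, at
  position j, is worth at least 8, while all later ones together are worth at most 24/7.\<close>

lemma digit_series_separation:
  fixes a b :: "nat \<Rightarrow> real"
  assumes a: "\<And>k. a k \<in> {0, 1, 2, 3}" and b: "\<And>k. b k \<in> {0, 1, 2, 3}"
    and eq: "\<And>k. k < j \<Longrightarrow> a k = b k" and ne: "a j \<noteq> b j"
  shows "(1 / 8) ^ Suc (Suc j) \<le> \<bar>(\<Sum>k. a k * (1 / 8) ^ Suc k) - (\<Sum>k. b k * (1 / 8) ^ Suc k)\<bar>"
proof -
  have geo: "summable (\<lambda>k. 3 * (1 / 8 :: real) ^ Suc k)"
    by (intro summable_mult summable_Suc_iff[THEN iffD2] summable_geometric) simp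
  have dom: "norm (x * (1 / 8) ^ Suc k) \<le> 3 * (1 / 8) ^ Suc k" if "x \<in> {0, 1, 2, 3}" for x :: real and k
  proof -
    have "\<bar>x\<bar> \<le> 3"
      using that by auto
    then show ?thesis
      unfolding real_norm_def abs_mult by (intro mult_mono) auto
  qed
  have sa: "summable (\<lambda>k. a k * (1 / 8) ^ Suc k)" 
    by (rule summable_comparison_test'[OF geo, of 0]) (use dom[OF a] in blast)
  have sb: "summable (\<lambda>k. b k * (1 / 8) ^ Suc k)" 
    by (rule summable_comparison_test'[OF geo, of 0]) (use dom[OF b] in blast)
  define c where "c k = (a k - b k) * (1 / 8) ^ Suc k" for k
  have c_le: "\<bar>c k\<bar> \<le> 3 * (1 / 8) ^ Suc k" for k
  proof -
    have "\<bar>a k - b k\<bar> \<le> 3"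
      using a[of k] b[of k] by auto
    then show ?thesis
      unfolding c_def abs_mult by (intro mult_mono) auto
  qed
  have sc: "summable c"
    unfolding c_def left_diff_distrib by (intro summable_diff sa sb)
  have "(\<Sum>k. a k * (1 / 8) ^ Suc k) - (\<Sum>k. b k * (1 / 8) ^ Suc k) = (\<Sum>k. c k)"
    unfolding c_def left_diff_distrib by (rule suminf_diff[OF sa sb])
  also have "\<dots> = (\<Sum>k. c (k + Suc j)) + (\<Sum>k<Suc j. c k)"
    by (rule suminf_split_initial_segment[OF sc])
  also have "(\<Sum>k<Suc j. c k) = c j"
    using eq by (simp add: c_def)
  finally have split: "(\<Sum>k. a k * (1 / 8) ^ Suc k) - (\<Sum>k. b k * (1 / 8) ^ Suc k) = (\<Sum>k. c (k + Suc j)) + c j" .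
  have "\<bar>\<Sum>k. c (k + Suc j)\<bar> \<le> (\<Sum>k. 3 * (1 / 8) ^ Suc (Suc j) * (1 / 8) ^ k)"
  proof -
    have "norm (\<Sum>k. c (k + Suc j)) \<le> (\<Sum>k. 3 * (1 / 8) ^ Suc (Suc j) * (1 / 8) ^ k)"
    proof (rule norm_suminf_le)
      show "summable (\<lambda>k. 3 * (1 / 8 :: real) ^ Suc (Suc j) * (1 / 8) ^ k)"
        by (intro summable_mult summable_geometric) simp
      show "norm (c (k + Suc j)) \<le> 3 * (1 / 8) ^ Suc (Suc j) * (1 / 8) ^ k" for k
        using c_le[of "k + Suc j"] by (simp add: power_add mult_ac)
    qed
    then show ?thesis by simp
  qed
  also have "\<dots> = 3 * (1 / 8) ^ Suc (Suc j) * (8 / 7)"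
    by (subst suminf_mult) (auto simp: suminf_geometric intro!: summable_geometric)
  finally have tail: "\<bar>\<Sum>k. c (k + Suc j)\<bar> \<le> 24 / 7 * (1 / 8) ^ Suc (Suc j)"
    by simp
  have "1 \<le> \<bar>a j - b j\<bar>"
    using a[of j] b[of j] ne by auto
  then have "1 * (1 / 8) ^ Suc j \<le> \<bar>a j - b j\<bar> * (1 / 8) ^ Suc j"
    by (intro mult_right_mono) auto
  then have "8 * (1 / 8) ^ Suc (Suc j) \<le> \<bar>c j\<bar>"
    unfolding c_def abs_mult by simp
  with tail show ?thesis
    unfolding split by linarith
qed

text \<open>A digit packs one bit of each coordinate. Dividing by 3R puts the coordinates of the
  closed disc into [0, 2/3], so their integer part is 0 at the right edge as well.\<close>

definition plane_code :: "real \<Rightarrow> complex \<Rightarrow> real" where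
  "plane_code R z = (\<Sum>k. (binary_digit k ((Re z + R) / (3 * R)) + 2 * binary_digit k ((Im z + R) / (3 * R)))
     * (1 / 8) ^ Suc k)"

text \<open>Interleaving binary digits in base 8 embeds a square into the line with a uniformly continuous
  inverse.  This reduces weak compactness in the plane to Helly's theorem on the line.\<close>

lemma plane_code_inverse:
  assumes R: "1 \<le> R" and x: "x \<in> cball 0 R" and y: "y \<in> cball 0 R"
    and close: "\<bar>plane_code R x - plane_code R y\<bar> < (1 / 8) ^ Suc N"
  shows "cmod (x - y) \<le> 6 * R / 2 ^ N"
proof -
  define a where "a z k = binary_digit k ((Re z + R) / (3 * R)) + 2 * binary_digit k ((Im z + R) / (3 * R))" for z k
  have a: "a z k \<in> {0, 1, 2, 3}" for z k
    using binary_digit_cases[of k "(Re z + R) / (3 * R)"] binary_digit_cases[of k "(Im z + R) / (3 * R)"]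
    by (auto simp: a_def)
  have eq: "a x k = a y k" if "k < N" for k
  proof (rule ccontr)
    assume "a x k \<noteq> a y k"
    define j where "j = (LEAST k. a x k \<noteq> a y k)"
    have "a x j \<noteq> a y j"
      unfolding j_def using \<open>a x k \<noteq> a y k\<close> by (rule LeastI)
    moreover have "a x i = a y i" if "i < j" for i
      using not_less_Least[of i "\<lambda>k. a x k \<noteq> a y k"] that by (auto simp: j_def)
    ultimately have "(1 / 8) ^ Suc (Suc j) \<le> \<bar>plane_code R x - plane_code R y\<bar>"
      unfolding plane_code_def a_def[symmetric] using a by (intro digit_series_separation)
    moreover have "j \<le> k"
      unfolding j_def using \<open>a x k \<noteq> a y k\<close> by (rule Least_le)
    \<comment> \<open>From j <= k < N follows j + 2 <= N + 1, so the separation is at least the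
      assumed closeness.\<close>
    then have "(1 / 8 :: real) ^ Suc N \<le> (1 / 8) ^ Suc (Suc j)"
      using \<open>k < N\<close> by (intro power_decreasing) auto
    ultimately show False
      using close by linarith
  qed
  have coord: "\<bar>s - t\<bar> \<le> 3 * R / 2 ^ N" if "\<bar>s\<bar> \<le> R" "\<bar>t\<bar> \<le> R" 
    "\<And>k. k < N \<Longrightarrow> binary_digit k ((s + R) / (3 * R)) = binary_digit k ((t + R) / (3 * R))" for s t
  proof -
    have fl: "\<lfloor>(s + R) / (3 * R)\<rfloor> = 0" if "\<bar>s\<bar> \<le> R" for s
    proof (rule floor_unique)
      show "real_of_int 0 \<le> (s + R) / (3 * R)" "(s + R) / (3 * R) < real_of_int 0 + 1"
        using R that by (auto simp: divide_less_eq)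
    qed
    have "\<lfloor>2 ^ N * ((s + R) / (3 * R))\<rfloor> = \<lfloor>2 ^ N * ((t + R) / (3 * R))\<rfloor>"
      using that by (intro binary_digits_determine fl)
    then have "\<bar>2 ^ N * ((s + R) / (3 * R)) - 2 ^ N * ((t + R) / (3 * R))\<bar> \<le> 1"
      by linarith
    also have "2 ^ N * ((s + R) / (3 * R)) - 2 ^ N * ((t + R) / (3 * R)) = (s - t) * (2 ^ N / (3 * R))"
      using R by (simp add: field_simps)
    also have "\<bar>\<dots>\<bar> = \<bar>s - t\<bar> * (2 ^ N / (3 * R))"
      using R by (simp add: abs_mult)
    finally show ?thesis
      using R by (simp add: field_simps)
  qed
  have digits: "binary_digit k ((Re x + R) / (3 * R)) = binary_digit k ((Re y + R) / (3 * R))"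
    "binary_digit k ((Im x + R) / (3 * R)) = binary_digit k ((Im y + R) / (3 * R))" if "k < N" for k
    using eq[OF that] binary_digit_cases[of k "(Re x + R) / (3 * R)"] binary_digit_cases[of k "(Im x + R) / (3 * R)"]
      binary_digit_cases[of k "(Re y + R) / (3 * R)"] binary_digit_cases[of k "(Im y + R) / (3 * R)"]
    by (auto simp: a_def)
  have "\<bar>Re x - Re y\<bar> \<le> 3 * R / 2 ^ N" "\<bar>Im x - Im y\<bar> \<le> 3 * R / 2 ^ N"
    using x y digits abs_Re_le_cmod[of x] abs_Re_le_cmod[of y] abs_Im_le_cmod[of x] abs_Im_le_cmod[of y]
    by (auto intro!: coord)
  then show ?thesis
    using cmod_le[of "x - y"] by simp
qed

lemma borel_measurable_plane_code [measurable]: "plane_code R \<in> borel_measurable borel"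
  unfolding plane_code_def binary_digit_def by measurable

lemma plane_code_bounds: "0 \<le> plane_code R z" "plane_code R z \<le> 1"
proof -
  define a where "a k = binary_digit k ((Re z + R) / (3 * R)) + 2 * binary_digit k ((Im z + R) / (3 * R))" for k
  have a: "0 \<le> a k" "a k \<le> 3" for k
    using binary_digit_cases[of k "(Re z + R) / (3 * R)"] binary_digit_cases[of k "(Im z + R) / (3 * R)"]
    by (auto simp: a_def)
  have geo: "summable (\<lambda>k. 3 / 8 * (1 / 8 :: real) ^ k)"
    by (intro summable_mult summable_geometric) simp
  have le: "a k * (1 / 8) ^ Suc k \<le> 3 / 8 * (1 / 8) ^ k" for k
    using a[of k] by simp
  have summ: "summable (\<lambda>k. a k * (1 / 8) ^ Suc k)"
    by (rule summable_comparison_test'[OF geo, of 0]) (use le a in \<open>auto simp: abs_mult\<close>)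
  show "0 \<le> plane_code R z"
    unfolding plane_code_def a_def[symmetric] using a by (intro suminf_nonneg summ) auto
  have "plane_code R z \<le> (\<Sum>k. 3 / 8 * (1 / 8) ^ k)"
    unfolding plane_code_def a_def[symmetric] by (intro suminf_le le summ geo)
  also have "\<dots> = 3 / 7"
    by (subst suminf_mult) (auto simp: suminf_geometric intro!: summable_geometric)
  finally show "plane_code R z \<le> 1" by simp
qed

text \<open>Digits jump, so the code need not be continuous, but its inverse is uniformly continuous
  on the image. It extends to the closure, and by Tietze to the line with the same bound R.\<close>

lemma plane_code_continuous_left_inverse:
  assumes R: "1 \<le> R"
  obtains g where "continuous_on UNIV g" "\<And>x. x \<in> cball 0 R \<Longrightarrow> g (plane_code R x) = x"
    "\<And>t. norm (g t) \<le> R"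
proof -
  let ?s = "plane_code R"
  have small: "\<exists>N. 6 * R / 2 ^ N < e" if "0 < e" for e :: real
  proof -
    have "(\<lambda>N. 6 * R * (1 / 2) ^ N) \<longlonglongrightarrow> 0"
      by (intro tendsto_mult_right_zero LIMSEQ_realpow_zero) auto
    then have "eventually (\<lambda>N. 6 * R * (1 / 2) ^ N < e) sequentially"
      using that by (rule order_tendstoD)
    then show ?thesis
      by (auto simp: eventually_sequentially power_one_over)
  qed
  have inj: "inj_on ?s (cball 0 R)"
  proof (rule inj_onI, rule ccontr)
    fix x y
    assume xy: "x \<in> cball 0 R" "y \<in> cball 0 R" "?s x = ?s y" "x \<noteq> y"
    then have "0 < cmod (x - y)" by simp
    from small[OF this] obtain N where "6 * R / 2 ^ N < cmod (x - y)" by auto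
    moreover have "cmod (x - y) \<le> 6 * R / 2 ^ N"
      using xy by (intro plane_code_inverse[OF R]) auto
    ultimately show False by simp
  qed
  define h where "h = inv_into (cball 0 R) ?s"
  have h: "h (?s x) = x" if "x \<in> cball 0 R" for x
    unfolding h_def using inj that by (rule inv_into_f_f)
  have "uniformly_continuous_on (?s ` cball 0 R) h"
    unfolding uniformly_continuous_on_def
  proof (intro allI impI)
    fix e :: real
    assume "0 < e"
    then obtain N where N: "6 * R / 2 ^ N < e"
      using small by blast
    have "dist (h t') (h t) < e" if t: "t \<in> ?s ` cball 0 R" "t' \<in> ?s ` cball 0 R" "dist t' t < (1 / 8) ^ Suc N" for t t'
    proof -
      obtain x y where xy: "t' = ?s x" "x \<in> cball 0 R" "t = ?s y" "y \<in> cball 0 R"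
        using t by blast
      have "cmod (x - y) \<le> 6 * R / 2 ^ N"
        using t(3) xy by (intro plane_code_inverse[OF R]) (auto simp: dist_real_def)
      then show ?thesis
        using N by (simp add: xy(1,3) h[OF xy(2)] h[OF xy(4)] dist_norm)
    qed
    then show "\<exists>d>0. \<forall>x\<in>?s ` cball 0 R. \<forall>x'\<in>?s ` cball 0 R. dist x' x < d \<longrightarrow> dist (h x') (h x) < e"
      by (intro exI[of _ "(1 / 8) ^ Suc N"]) (auto simp del: power_Suc)
  qed
  then obtain g0 where g0: "uniformly_continuous_on (closure (?s ` cball 0 R)) g0" 
    "\<And>t. t \<in> ?s ` cball 0 R \<Longrightarrow> h t = g0 t"
    using uniformly_continuous_on_extension_on_closure by metis
  have cont: "continuous_on (closure (?s ` cball 0 R)) g0"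
    using g0(1) by (rule uniformly_continuous_imp_continuous)
  have "norm (g0 t) \<le> R" if "t \<in> closure (?s ` cball 0 R)" for t
  proof (rule continuous_on_closure_norm_le[OF cont _ that], rule ballI)
    fix t
    assume "t \<in> ?s ` cball 0 R"
    then obtain x where "t = ?s x" "x \<in> cball 0 R" by blast
    then show "norm (g0 t) \<le> R"
      using g0(2)[of t] h[of x] by simp
  qed
  then obtain g where g: "continuous_on UNIV g" "\<And>t. t \<in> closure (?s ` cball 0 R) \<Longrightarrow> g t = g0 t"
    "\<And>t. t \<in> UNIV \<Longrightarrow> norm (g t) \<le> R"
    using Tietze[OF cont, of UNIV R] R by auto
  have "g (?s x) = x" if "x \<in> cball 0 R" for x
  proof -
    have "?s x \<in> ?s ` cball 0 R"
      using that by blast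
    then show ?thesis
      using g(2)[of "?s x"] g0(2)[of "?s x"] h[OF that] closure_subset[of "?s ` cball 0 R"] by auto
  qed
  with g that show ?thesis by blast
qed

section \<open>Weak compactness and the energy minimiser\<close>

lemma borel_prob_on_compact_prob: "compact E \<Longrightarrow> \<nu> \<in> borel_prob_on E \<Longrightarrow> compact_prob E \<nu>"
  by (simp add: borel_prob_on_def compact_prob_def)

text \<open>The coded measures live on [0, 1] and are tight, so Helly's theorem gives a limit on the
  line, which the left inverse g carries back. Measurability of the code suffices: the test
  functions on the line are f composed with g, and these are continuous.\<close>

theorem borel_prob_on_weakly_compact:
  fixes \<nu> :: "nat \<Rightarrow> complex measure"
  assumes E: "compact E" and \<nu>: "\<And>n. \<nu> n \<in> borel_prob_on E"
  obtains r \<rho> where "strict_mono r" "\<rho> \<in> borel_prob_on E"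
    "\<And>f :: complex \<Rightarrow> real. continuous_on UNIV f \<Longrightarrow> (\<lambda>n. \<integral>x. f x \<partial>\<nu> (r n)) \<longlonglongrightarrow> (\<integral>x. f x \<partial>\<rho>)"
proof -
  interpret \<nu>: compact_prob E "\<nu> n" for n
    by (rule borel_prob_on_compact_prob[OF E \<nu>])
  obtain B where B: "\<And>x. x \<in> E \<Longrightarrow> cmod x \<le> B"
    using compact_imp_bounded[OF E] by (auto simp: bounded_iff)
  define R where "R = max B 1"
  have R: "1 \<le> R" "E \<subseteq> cball 0 R"
    using B by (force simp: R_def)+
  obtain g where g: "continuous_on UNIV g" "\<And>x. x \<in> cball 0 R \<Longrightarrow> g (plane_code R x) = x" "\<And>t. norm (g t) \<le> R"
    using plane_code_continuous_left_inverse[OF R(1)] by blast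
  define m where "m n = distr (\<nu> n) borel (plane_code R)" for n
  have code_meas: "plane_code R \<in> borel_measurable (\<nu> n)" for n
    by (intro \<nu>.measurable_\<mu> borel_measurable_plane_code)
  have m_dist: "real_distribution (m n)" for n
    unfolding m_def by (intro \<nu>.real_distribution_distr code_meas)
  have "tight m"
    unfolding tight_def
  proof (intro conjI allI impI m_dist)
    fix e :: real
    assume "0 < e"
    have "measure (m n) {-1<..1} = 1" for n
    proof -
      have "measure (m n) {-1<..1} = measure (\<nu> n) (plane_code R -` {-1<..1} \<inter> space (\<nu> n))"
        unfolding m_def by (intro measure_distr code_meas) auto
      also have "plane_code R -` {-1<..1} \<inter> space (\<nu> n) = space (\<nu> n)"
      proof -
        have "-1 < plane_code R x" for x
          using plane_code_bounds(1)[of R x] by linarith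
        then show ?thesis
          using plane_code_bounds(2)[of R] by auto
      qed
      finally show ?thesis
        by (simp add: \<nu>.prob_space)
    qed
    then show "\<exists>a b. a < b \<and> (\<forall>n. 1 - e < measure (m n) {a<..b})"
      using \<open>0 < e\<close> by (intro exI[of _ "-1"] exI[of _ 1]) auto
  qed
  then obtain r M where rM: "strict_mono r" "real_distribution M" "weak_conv_m (m \<circ> id \<circ> r) M"
    using tight_imp_convergent_subsubsequence[of m id] by (auto simp: strict_mono_def)
  interpret M: real_distribution M by fact
  define \<rho> where "\<rho> = distr M borel g"
  have g_meas: "g \<in> borel_measurable M"
    using borel_measurable_continuous_onI[OF g(1)] by simp
  have conv: "(\<lambda>n. \<integral>x. f x \<partial>\<nu> (r n)) \<longlonglongrightarrow> (\<integral>x. f x \<partial>\<rho>)" 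
    if f: "continuous_on UNIV f" for f :: "complex \<Rightarrow> real"
  proof -
    have f_meas: "f \<in> borel_measurable borel"
      by (rule borel_measurable_continuous_onI[OF f])
    have fg: "continuous_on UNIV (\<lambda>t. f (g t))"
      by (rule continuous_on_compose2[OF f g(1)]) auto
    have "bounded (f ` cball 0 R)"
      by (intro compact_imp_bounded compact_continuous_image continuous_on_subset[OF f]) auto
    then obtain C where C: "\<forall>y\<in>f ` cball 0 R. norm y \<le> C"
      unfolding bounded_iff by blast
    have "(\<lambda>n. integral\<^sup>L ((m \<circ> id \<circ> r) n) (\<lambda>t. f (g t))) \<longlonglongrightarrow> integral\<^sup>L M (\<lambda>t. f (g t))"
    proof (rule weak_conv_imp_integral_bdd_continuous_conv[OF _ rM(2,3)])
      show "isCont (\<lambda>t. f (g t)) t" for t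
        using fg by (simp add: continuous_on_eq_continuous_at)
      show "norm (f (g t)) \<le> C" for t
        using g(3)[of t] C by simp
    qed (simp add: m_dist)
    moreover have "integral\<^sup>L M (\<lambda>t. f (g t)) = (\<integral>x. f x \<partial>\<rho>)"
      unfolding \<rho>_def by (intro integral_distr[symmetric] g_meas f_meas)
    moreover have "integral\<^sup>L ((m \<circ> id \<circ> r) n) (\<lambda>t. f (g t)) = (\<integral>x. f x \<partial>\<nu> (r n))" for n
    proof -
      have "integral\<^sup>L (m (r n)) (\<lambda>t. f (g t)) = (\<integral>x. f (g (plane_code R x)) \<partial>\<nu> (r n))"
        unfolding m_def by (intro integral_distr code_meas borel_measurable_continuous_onI[OF fg])
      also have "\<dots> = (\<integral>x. f x \<partial>\<nu> (r n))"
      proof (rule integral_cong_AE)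
        show "AE x in \<nu> (r n). f (g (plane_code R x)) = f x"
          using \<nu>.AE_E by eventually_elim (use R(2) g(2) in auto)
        show "f \<in> borel_measurable (\<nu> (r n))"
          by (rule \<nu>.measurable_\<mu>[OF f_meas])
        show "(\<lambda>x. f (g (plane_code R x))) \<in> borel_measurable (\<nu> (r n))"
          by (rule measurable_compose[OF code_meas borel_measurable_continuous_onI[OF fg]])
      qed
      finally show ?thesis by simp
    qed
    ultimately show ?thesis by simp
  qed
  interpret \<Lambda>: prob_space \<rho>
    unfolding \<rho>_def by (rule M.prob_space_distr[OF g_meas])
  have "\<rho> \<in> borel_prob_on E"
  proof -
    have ne: "E \<noteq> {}"
      by (rule \<nu>.E_nonempty)
    \<comment> \<open>A bounded continuous function vanishing exactly on the closed set E; its zero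
      integrals pass to the limit and force \<rho> to live on E.\<close>
    define f where "f x = min 1 (infdist x E)" for x
    have f: "continuous_on UNIV f"
      unfolding f_def by (intro continuous_intros)
    have f_meas: "f \<in> borel_measurable \<rho>"
      unfolding \<rho>_def using borel_measurable_continuous_onI[OF f] by simp
    have "(\<integral>x. f x \<partial>\<nu> n) = 0" for n
      by (intro integral_eq_zero_AE eventually_mono[OF \<nu>.AE_E]) (simp add: f_def)
    then have int0: "(\<integral>x. f x \<partial>\<rho>) = 0"
      using conv[OF f] LIMSEQ_unique[OF _ tendsto_const] by simp
    have f_int: "integrable \<rho> f"
      by (rule \<Lambda>.integrable_const_bound[of _ 1]) (use f_meas in \<open>auto simp: f_def infdist_nonneg\<close>)
    have "AE x in \<rho>. 0 \<le> f x"
      by (simp add: f_def infdist_nonneg)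
    then have "AE x in \<rho>. f x = 0"
      using int0 integral_nonneg_eq_0_iff_AE[OF f_int] by blast
    then have AE: "AE x in \<rho>. x \<in> E"
    proof eventually_elim
      case (elim x)
      then have "infdist x E = 0"
        by (auto simp: f_def min_def split: if_splits)
      then show ?case
        using in_closed_iff_infdist_zero[OF compact_imp_closed[OF E] ne] by simp
    qed
    have "E \<in> sets \<rho>"
      unfolding \<rho>_def using borel_compact[OF E] by simp
    then have "emeasure \<rho> E = 1"
      using AE \<Lambda>.prob_eq_1 by (simp add: \<Lambda>.emeasure_eq_measure)
    then show ?thesis
      unfolding borel_prob_on_def using \<Lambda>.prob_space_axioms by (simp add: \<rho>_def)
  qed
  with rM(1) conv show ?thesis
    using that by blast
qed

text \<open>The direct method: a weak limit of a minimising sequence. Lower semicontinuity of the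
  energy comes from positive definiteness of the regularised kernel.\<close>

theorem energy_minimiser_exists:
  assumes E: "compact E" and finite: "robin_constant E \<noteq> \<infinity>"
  obtains \<mu> where "\<mu> \<in> borel_prob_on E" "energy \<mu> = robin_constant E"
proof -
  have ne: "borel_prob_on E \<noteq> {}"
  proof
    assume "borel_prob_on E = {}"
    then have "robin_constant E = \<infinity>"
      by (simp only: robin_constant_def image_empty Inf_empty top_ereal_def)
    with finite show False by simp
  qed
  obtain u where u: "\<And>n. u n \<in> energy ` borel_prob_on E" "u \<longlonglongrightarrow> robin_constant E"
    using Inf_as_limit[of "energy ` borel_prob_on E"] ne unfolding robin_constant_def by blast
  have "\<forall>n. \<exists>\<nu>. \<nu> \<in> borel_prob_on E \<and> energy \<nu> = u n"
  proof
    fix n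
    show "\<exists>\<nu>. \<nu> \<in> borel_prob_on E \<and> energy \<nu> = u n"
    proof -
      obtain \<nu> where "u n = energy \<nu>" "\<nu> \<in> borel_prob_on E"
        using u(1)[of n] by (rule imageE)
      then show ?thesis
        by (intro exI[of _ \<nu>]) simp
    qed
  qed
  from choice[OF this] obtain \<nu> where "\<forall>n. \<nu> n \<in> borel_prob_on E \<and> energy (\<nu> n) = u n"
    by (rule exE)
  then have \<nu>: "\<nu> n \<in> borel_prob_on E" "energy (\<nu> n) = u n" for n
    by simp_all
  obtain r \<rho> where r: "strict_mono r" and \<rho>: "\<rho> \<in> borel_prob_on E"
    and conv: "\<And>f :: complex \<Rightarrow> real. continuous_on UNIV f \<Longrightarrow> (\<lambda>n. \<integral>x. f x \<partial>\<nu> (r n)) \<longlonglongrightarrow> (\<integral>x. f x \<partial>\<rho>)"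
    using borel_prob_on_weakly_compact[of E \<nu>, OF E \<nu>(1)] by metis
  interpret \<rho>: compact_prob E \<rho>
    by (rule borel_prob_on_compact_prob[OF E \<rho>])
  interpret \<nu>: compact_prob E "\<nu> n" for n
    by (rule borel_prob_on_compact_prob[OF E \<nu>(1)])
  have lim: "(\<lambda>n. energy (\<nu> (r n))) \<longlonglongrightarrow> robin_constant E"
    using LIMSEQ_subseq_LIMSEQ[OF u(2) r] unfolding o_def \<nu>(2) .
  have le: "ereal (\<integral>z. \<rho>.pot e z \<partial>\<rho>) \<le> 2 * robin_constant E" if e: "0 < e" "e \<le> 1" for e
  proof -
    let ?K = "log_kernel_reg e"
    define I where "I n = (\<integral>z. \<nu>.pot n e z \<partial>\<nu> n)" for n
    \<comment> \<open>Expanding the nonnegative energy of the difference of \<nu> n and \<rho> gives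
      this lower bound for \<open>I n\<close>. It is affine in \<nu> n, so it passes to the weak
      limit, whereas \<open>I n\<close> is quadratic.\<close>
    define J where "J n = (\<integral>z. \<rho>.pot e z \<partial>\<nu> n) + (\<integral>z. \<nu>.pot n e z \<partial>\<rho>) - (\<integral>z. \<rho>.pot e z \<partial>\<rho>)" for n
    have IJ: "J n \<le> I n" for n
    proof -
      interpret N: signed_functional "\<lambda>f. \<integral>x. f x \<partial>\<nu> n" E 1
        by (rule \<nu>.functional[OF E order_refl])
      interpret M: signed_functional "\<lambda>f. \<integral>x. f x \<partial>\<rho>" E 1
        by (rule \<rho>.functional[OF E order_refl])
      interpret D: signed_functional "\<lambda>f. (\<integral>x. f x \<partial>\<nu> n) - (\<integral>x. f x \<partial>\<rho>)" E 2
        using signed_functional_diff[OF \<nu>.functional[OF E order_refl] \<rho>.functional[OF E order_refl]] by simp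
      have "0 \<le> D.energy_form ?K"
        using e by (intro D.energy_form_log_kernel_reg_nonneg) (auto simp: \<nu>.prob_space \<rho>.prob_space)
      also have "D.energy_form ?K = (\<integral>x. \<nu>.pot n e x - \<rho>.pot e x \<partial>\<nu> n) - (\<integral>x. \<nu>.pot n e x - \<rho>.pot e x \<partial>\<rho>)"
        unfolding D.energy_form_def \<nu>.pot_def \<rho>.pot_def ..
      also have "(\<integral>x. \<nu>.pot n e x - \<rho>.pot e x \<partial>\<nu> n) = I n - (\<integral>x. \<rho>.pot e x \<partial>\<nu> n)"
        unfolding I_def by (intro N.diff \<nu>.continuous_pot \<rho>.continuous_pot e)
      also have "(\<integral>x. \<nu>.pot n e x - \<rho>.pot e x \<partial>\<rho>) = (\<integral>x. \<nu>.pot n e x \<partial>\<rho>) - (\<integral>x. \<rho>.pot e x \<partial>\<rho>)"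
        by (intro M.diff \<nu>.continuous_pot \<rho>.continuous_pot e)
      finally show ?thesis
        by (simp add: J_def)
    qed
    have "(\<lambda>n. \<integral>z. \<rho>.pot e z \<partial>\<nu> (r n)) \<longlonglongrightarrow> (\<integral>z. \<rho>.pot e z \<partial>\<rho>)"
      by (intro conv \<rho>.continuous_pot e)
    moreover have "(\<lambda>n. \<integral>z. \<nu>.pot (r n) e z \<partial>\<rho>) \<longlonglongrightarrow> (\<integral>z. \<rho>.pot e z \<partial>\<rho>)"
    proof -
      obtain C where C: "\<And>x y. x \<in> E \<Longrightarrow> y \<in> E \<Longrightarrow> \<bar>?K x y\<bar> \<le> C"
      proof -
        have "bounded ((\<lambda>p. ?K (fst p) (snd p)) ` (E \<times> E))"
          by (intro compact_imp_bounded compact_continuous_image compact_Times E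
              continuous_on_subset[OF continuous_log_kernel_reg[OF e(1)]]) auto
        then show ?thesis
          using that by (force simp: bounded_iff)
      qed
      show ?thesis
      proof (rule integral_dominated_convergence[where w = "\<lambda>_. C"])
        show "\<rho>.pot e \<in> borel_measurable \<rho>" "\<And>n. \<nu>.pot (r n) e \<in> borel_measurable \<rho>"
          using e by (auto intro!: \<rho>.measurable_\<mu> borel_measurable_continuous_onI \<rho>.continuous_pot \<nu>.continuous_pot)
        show "AE x in \<rho>. (\<lambda>n. \<nu>.pot (r n) e x) \<longlonglongrightarrow> \<rho>.pot e x"
          unfolding \<nu>.pot_def \<rho>.pot_def by (intro AE_I2 conv \<rho>.continuous_log_kernel_reg2 e)
        show "AE x in \<rho>. norm (\<nu>.pot (r n) e x) \<le> C" for n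
          using \<rho>.AE_E
        proof eventually_elim
          case (elim x)
          interpret N: signed_functional "\<lambda>f. \<integral>x. f x \<partial>\<nu> (r n)" E 1
            by (rule \<nu>.functional[OF E order_refl])
          have "0 \<le> C"
            using C[OF elim elim] by (rule order_trans[OF abs_ge_zero])
          then have "\<bar>\<nu>.pot (r n) e x\<bar> \<le> 1 * C"
            unfolding \<nu>.pot_def using C[OF elim] by (intro N.bound \<rho>.continuous_log_kernel_reg2 e)
          then show ?case by simp
        qed
      qed simp
    qed
    ultimately have "(\<lambda>n. J (r n)) \<longlonglongrightarrow> (\<integral>z. \<rho>.pot e z \<partial>\<rho>) + (\<integral>z. \<rho>.pot e z \<partial>\<rho>) - (\<integral>z. \<rho>.pot e z \<partial>\<rho>)"
      unfolding J_def by (intro tendsto_add tendsto_diff tendsto_const)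
    then have l1: "(\<lambda>n. ereal (J (r n))) \<longlonglongrightarrow> ereal (\<integral>z. \<rho>.pot e z \<partial>\<rho>)"
      by simp
    have l2: "(\<lambda>n. 2 * energy (\<nu> (r n))) \<longlonglongrightarrow> 2 * robin_constant E"
      using lim by (intro tendsto_cmult_ereal) auto
    have "ereal (J (r n)) \<le> 2 * energy (\<nu> (r n))" for n
    proof -
      have "ereal (J (r n)) \<le> ereal (I (r n))"
        using IJ by simp
      also have "\<dots> \<le> 2 * energy (\<nu> (r n))"
        unfolding I_def by (rule \<nu>.self_energy_le_energy[OF e])
      finally show ?thesis .
    qed
    then show ?thesis
      by (intro LIMSEQ_le[OF l1 l2]) blast
  qed
  have "robin_constant E \<noteq> -\<infinity>"
    using le[of 1] by auto
  with finite obtain c where c: "robin_constant E = ereal c"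
    by (cases "robin_constant E") auto
  have "energy \<rho> \<le> ereal c"
    using le by (intro \<rho>.energy_le_of_self_energy_le) (simp add: c)
  moreover have "robin_constant E \<le> energy \<rho>"
    unfolding robin_constant_def using \<rho> by (rule INF_lower)
  ultimately show ?thesis
    using that[OF \<rho>] c by simp
qed


section \<open>Convergence of escape rates to the Green function\<close>

text \<open>The choice inside \<open>ARG_MIN\<close> is informative only because a minimiser exists;
  the chosen measure then has the Robin constant as its energy.\<close>

lemma equilibrium_measure_facts:
  assumes E: "compact E" and cap: "log_capacity E = 1"
  shows "equilibrium_measure E \<in> borel_prob_on E" "energy (equilibrium_measure E) = 0"
proof -
  have finite: "robin_constant E \<noteq> \<infinity>"
    using cap by (auto simp: log_capacity_def)
  then have real0: "real_of_ereal (robin_constant E) = 0"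
    using cap by (simp add: log_capacity_def)
  obtain \<mu> where \<mu>: "\<mu> \<in> borel_prob_on E" "energy \<mu> = robin_constant E"
    using energy_minimiser_exists[OF E finite] by blast
  have lower: "robin_constant E \<le> energy \<nu>" if "\<nu> \<in> borel_prob_on E" for \<nu>
    unfolding robin_constant_def using that by (rule INF_lower)
  have "is_arg_min energy (\<lambda>\<nu>. \<nu> \<in> borel_prob_on E) \<mu>"
    unfolding is_arg_min_def using \<mu> lower by (metis leD)
  then have "is_arg_min energy (\<lambda>\<nu>. \<nu> \<in> borel_prob_on E) (equilibrium_measure E)"
    unfolding equilibrium_measure_def arg_min_def by (rule someI)
  then have mem: "equilibrium_measure E \<in> borel_prob_on E" 
    and "\<not> energy \<mu> < energy (equilibrium_measure E)"
    unfolding is_arg_min_def using \<mu>(1) by blast+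
  then have eq: "energy (equilibrium_measure E) = robin_constant E"
    using lower[OF mem] \<mu>(2) by simp
  interpret compact_prob E "equilibrium_measure E"
    by (rule borel_prob_on_compact_prob[OF E mem])
  \<comment> \<open>In \<open>log_capacity\<close> a Robin constant - \<infinity> would also give
    exp 0 = 1, because \<open>real_of_ereal\<close> sends it to 0. The finite self-energy at e = 1
    excludes it.\<close>
  have "robin_constant E \<noteq> - \<infinity>"
    using self_energy_le_energy[of 1] eq by auto
  with finite real0 have "robin_constant E = 0"
    by (cases "robin_constant E") auto
  with mem eq show "equilibrium_measure E \<in> borel_prob_on E" "energy (equilibrium_measure E) = 0"
    by simp_all
qed

text \<open>For capacity 1 the Green function is the logarithmic potential itself, and E lies in its
  polynomial hull, where regularity makes it 0. Off E the limit is a maximum with 0, which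
  nonnegativity of the potential removes.\<close>

lemma log_plus_poly_tendsto_green:
  fixes a :: "nat \<Rightarrow> complex" and P :: "nat \<Rightarrow> int poly"
  assumes E: "compact E" and reg: "dirichlet_regular E" and cap: "log_capacity E = 1" and "inj a"
    and minimal: "\<And>n. is_minimal_poly (map_poly of_int (P n)) (a n)"
    and dist: "(\<lambda>n. max_dist (galois_conjugates (P n)) E) \<longlonglongrightarrow> 0"
  shows "(\<lambda>n. log_plus (cmod (poly (complex_poly (P n)) z)) / real (Polynomial.degree (P n)))
           \<longlonglongrightarrow> green_function E z"
    and "filterlim (\<lambda>n. Polynomial.degree (P n)) at_top sequentially"
    and "\<exists>R\<ge>1. eventually (\<lambda>n. galois_conjugates (P n) \<subseteq> cball 0 R) sequentially"
proof -
  define \<mu> where "\<mu> = equilibrium_measure E"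
  define Z where "Z n = galois_conjugates (P n)" for n
  note facts = galois_conjugates_facts[OF minimal, folded Z_def]
  note eq = equilibrium_measure_facts[OF E cap, folded \<mu>_def]
  interpret compact_prob E \<mu>
    by (rule borel_prob_on_compact_prob[OF E eq(1)])
  have green: "green_function E = log_pot"
    unfolding green_function_def[abs_def] log_pot_def[abs_def] \<mu>_def[symmetric] by (simp add: cap)
  have zero: "log_pot x = 0" if "x \<in> E" for x
  proof -
    have "x \<in> - outside E"
      using that outside_no_overlap[of E] by blast
    then show ?thesis
      using reg unfolding dirichlet_regular_def green polynomial_hull_def by blast
  qed
  have cont: "continuous_on UNIV log_pot"
    using reg unfolding dirichlet_regular_def green by blast
  have near: "eventually (\<lambda>n. \<forall>\<zeta>\<in>Z n. infdist \<zeta> E < r) sequentially" if "0 < r" for r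
    using order_tendstoD(2)[OF dist that]
  proof eventually_elim
    case (elim n)
    show ?case
    proof
      fix \<zeta>
      assume "\<zeta> \<in> Z n"
      then have "infdist \<zeta> E \<le> max_dist (Z n) E"
        unfolding max_dist_def using facts(3)[of n] by (intro Max_ge) auto
      with elim show "infdist \<zeta> E < r"
        by (simp add: Z_def)
    qed
  qed
  obtain R where R: "1 \<le> R" "\<And>\<zeta>. infdist \<zeta> E < 1 \<Longrightarrow> \<zeta> \<in> cball 0 R"
    using infdist_less_1_in_cball[OF E E_nonempty] by metis
  have bounded: "eventually (\<lambda>n. Z n \<subseteq> cball 0 R) sequentially"
    using near[of 1, simplified]
  proof eventually_elim
    case (elim n)
    show ?case
    proof
      fix \<zeta>
      assume "\<zeta> \<in> Z n"
      with elim have "infdist \<zeta> E < 1" by blast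
      then show "\<zeta> \<in> cball 0 R" by (rule R(2))
    qed
  qed
  then show "\<exists>R\<ge>1. eventually (\<lambda>n. galois_conjugates (P n) \<subseteq> cball 0 R) sequentially"
    by (intro exI[of _ R]) (simp add: Z_def R(1))
  show deg: "filterlim (\<lambda>n. Polynomial.degree (P n)) at_top sequentially"
    using degree_minimal_polys_at_top[OF \<open>inj a\<close> minimal bounded[unfolded Z_def]] .
  interpret root_distribution E \<mu> Z
  proof
    show "(\<integral>x. pot e x \<partial>\<mu>) \<le> 0" if "0 < e" "e \<le> 1" for e
      using self_energy_le_energy[OF that] eq(2) by simp
    show "\<exists>e>0. e \<le> 1 \<and> - \<eta> < pot e z" if "z \<in> E" "0 < \<eta>" for z \<eta>
      using pot_lower_bound_of_log_pot_zero[OF that(1) zero[OF that(1), unfolded log_pot_def] that(2)] .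
    show "finite (Z n)" for n
      by (rule facts(3))
    show "filterlim (\<lambda>n. card (Z n)) at_top sequentially"
      using deg by (simp add: facts(4))
    show "0 \<le> (\<Sum>\<zeta>\<in>Z n. \<Sum>\<xi>\<in>Z n - {\<zeta>}. ln (cmod (\<zeta> - \<xi>)))" for n
      unfolding Z_def by (rule log_discriminant_nonneg[OF minimal])
  qed (rule near)
  have eval: "poly (complex_poly (P n)) z = (\<Prod>\<zeta>\<in>Z n. z - \<zeta>)" for n
    unfolding facts(5) by (simp add: poly_prod)
  show "(\<lambda>n. log_plus (cmod (poly (complex_poly (P n)) z)) / real (Polynomial.degree (P n)))
           \<longlonglongrightarrow> green_function E z"
  proof (cases "z \<in> E")
    case True
    then show ?thesis
      using log_plus_prod_tendsto_on[OF True] zero[OF True] by (simp add: eval facts(4) green)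
  next
    case False
    have "max (log_pot z) 0 = log_pot z"
      using log_pot_nonneg[OF cont zero] by simp
    then show ?thesis
      using log_plus_prod_tendsto_off[OF False] by (simp add: eval facts(4) green)
  qed
qed

definition escape_rate :: "complex poly \<Rightarrow> complex \<Rightarrow> real" where
  "escape_rate p z = lim (\<lambda>k. log_plus (cmod ((poly p ^^ k) z)) / real (Polynomial.degree p) ^ k)"

lemma escape_rate_prod_linear:
  fixes Z :: "complex set"
  assumes "finite Z" "Z \<subseteq> cball 0 R" "1 \<le> R" "2 \<le> card Z"
  defines "p \<equiv> \<Prod>\<zeta>\<in>Z. [:- \<zeta>, 1:]"
  shows "(\<lambda>k. log_plus (cmod ((poly p ^^ k) z)) / real (card Z) ^ k) \<longlonglongrightarrow> escape_rate p z"
    and "\<bar>escape_rate p z - log_plus (cmod (poly p z)) / real (card Z)\<bar> \<le> 2 * ln (2 * R) / real (card Z)"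
proof -
  have eval: "poly p w = (\<Prod>\<zeta>\<in>Z. w - \<zeta>)" for w
    by (simp add: p_def poly_prod)
  have deg: "Polynomial.degree p = card Z"
    unfolding p_def by (subst degree_prod_eq_sum_degree) auto
  obtain g where g: "(\<lambda>k. log_plus (cmod ((poly p ^^ k) z)) / real (card Z) ^ k) \<longlonglongrightarrow> g"
    "\<bar>g - log_plus (cmod (poly p z)) / real (card Z)\<bar> \<le> 2 * ln (2 * R) / real (card Z)"
  proof (rule escape_rate_limit[OF assms(4)])
    show "\<bar>log_plus (cmod (poly p w)) - real (card Z) * log_plus (cmod w)\<bar> \<le> real (card Z) * ln (2 * R)" for w
      unfolding eval using assms by (intro log_plus_prod_linear) auto
  qed
  moreover have "escape_rate p z = g"
    unfolding escape_rate_def deg using g(1) by (rule limI)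
  ultimately show "(\<lambda>k. log_plus (cmod ((poly p ^^ k) z)) / real (card Z) ^ k) \<longlonglongrightarrow> escape_rate p z"
    "\<bar>escape_rate p z - log_plus (cmod (poly p z)) / real (card Z)\<bar> \<le> 2 * ln (2 * R) / real (card Z)"
    by simp_all
qed

text \<open>One radius R contains the conjugates for all large n, so the gap between escape rate and
  normalised \<open>log_plus\<close> is at most 2 ln (2R) over the degree.\<close>

lemma escape_rate_tendsto_green:
  fixes a :: "nat \<Rightarrow> complex" and P :: "nat \<Rightarrow> int poly"
  assumes "compact E" "dirichlet_regular E" "log_capacity E = 1" "inj a"
    and minimal: "\<And>n. is_minimal_poly (map_poly of_int (P n)) (a n)"
    and "(\<lambda>n. max_dist (galois_conjugates (P n)) E) \<longlonglongrightarrow> 0"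
  shows "(\<lambda>n. escape_rate (complex_poly (P n)) z) \<longlonglongrightarrow> green_function E z"
    and "eventually (\<lambda>n. \<forall>z. (\<lambda>k. log_plus (cmod ((poly (complex_poly (P n)) ^^ k) z)) / 
           real (Polynomial.degree (P n)) ^ k) \<longlonglongrightarrow> escape_rate (complex_poly (P n)) z) sequentially"
proof -
  note lims = log_plus_poly_tendsto_green[OF assms]
  note facts = galois_conjugates_facts[OF minimal]
  obtain R where R: "1 \<le> R" "eventually (\<lambda>n. galois_conjugates (P n) \<subseteq> cball 0 R) sequentially"
    using lims(3) by auto
  have deg: "eventually (\<lambda>n. 2 \<le> Polynomial.degree (P n)) sequentially"
    using lims(2) by (simp add: filterlim_at_top)
  from R(2) deg
  show "eventually (\<lambda>n. \<forall>z. (\<lambda>k. log_plus (cmod ((poly (complex_poly (P n)) ^^ k) z)) / 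
           real (Polynomial.degree (P n)) ^ k) \<longlonglongrightarrow> escape_rate (complex_poly (P n)) z) sequentially"
  proof eventually_elim
    case (elim n)
    then show ?case
      using escape_rate_prod_linear(1)[OF facts(3)[of n] elim(1) R(1)]
      by (simp add: facts(4)[of n] flip: facts(5)[of n])
  qed
  let ?g = "\<lambda>n. escape_rate (complex_poly (P n)) z"
  let ?l = "\<lambda>n. log_plus (cmod (poly (complex_poly (P n)) z)) / real (Polynomial.degree (P n))"
  have "(\<lambda>n. ?g n - ?l n) \<longlonglongrightarrow> 0"
  proof (rule Lim_null_comparison)
    show "(\<lambda>n. 2 * ln (2 * R) / real (Polynomial.degree (P n))) \<longlonglongrightarrow> 0"
      by (intro real_tendsto_divide_at_top[OF tendsto_const] filterlim_compose[OF filterlim_real_sequentially lims(2)])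
    show "eventually (\<lambda>n. norm (?g n - ?l n) \<le> 2 * ln (2 * R) / real (Polynomial.degree (P n))) sequentially"
      using R(2) deg
    proof eventually_elim
      case (elim n)
      then show ?case
        using escape_rate_prod_linear(2)[OF facts(3)[of n] elim(1) R(1)]
        by (simp add: facts(4)[of n] flip: facts(5)[of n])
    qed
  qed
  from tendsto_add[OF this lims(1)[of z]] show "?g \<longlonglongrightarrow> green_function E z"
    by simp
qed


section \<open>Non-archimedean places\<close>

locale complex_subfield =
  fixes K :: "complex set"
  assumes subfield_K: "subfield K complex_field"
begin

lemma one_mem: "1 \<in> K"
  using subringE(3)[OF subfieldE(1)[OF subfield_K]] by (simp add: complex_field_simps)

lemma zero_mem: "0 \<in> K"
  using subringE(2)[OF subfieldE(1)[OF subfield_K]] by (simp add: complex_field_simps)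

lemma add_mem: "x \<in> K \<Longrightarrow> y \<in> K \<Longrightarrow> x + y \<in> K"
  using subringE(7)[OF subfieldE(1)[OF subfield_K], of x y] by (simp add: complex_field_simps)

lemma mult_mem: "x \<in> K \<Longrightarrow> y \<in> K \<Longrightarrow> x * y \<in> K"
  using subringE(6)[OF subfieldE(1)[OF subfield_K], of x y] by (simp add: complex_field_simps)

lemma uminus_mem: "x \<in> K \<Longrightarrow> - x \<in> K"
  using subringE(5)[OF subfieldE(1)[OF subfield_K], of x] by (simp add: complex_field_uminus)

lemma inverse_mem: "x \<in> K \<Longrightarrow> inverse x \<in> K"
proof (cases "x = 0")
  case False
  interpret C: field complex_field
    by (rule field_from_type_algebra)
  assume "x \<in> K"
  with False show ?thesis
    using C.subfield_m_inv(1)[OF subfield_K, of x] by (simp add: complex_field_simps complex_field_inv)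
qed simp

lemma diff_mem: "x \<in> K \<Longrightarrow> y \<in> K \<Longrightarrow> x - y \<in> K"
  using add_mem[OF _ uminus_mem, of x y] by simp

lemma divide_mem: "x \<in> K \<Longrightarrow> y \<in> K \<Longrightarrow> x / y \<in> K"
  unfolding divide_inverse by (intro mult_mem inverse_mem)

lemma of_nat_mem: "of_nat n \<in> K"
  by (induction n) (auto intro: zero_mem one_mem add_mem)

lemma of_int_mem: "of_int n \<in> K"
  by (cases n) (auto intro: of_nat_mem uminus_mem simp del: of_nat_Suc)

lemma of_rat_mem: "of_rat q \<in> K"
  by (cases q) (auto simp: of_rat_rat intro!: divide_mem of_int_mem)

lemma power_mem: "x \<in> K \<Longrightarrow> x ^ n \<in> K"
  by (induction n) (auto intro: one_mem mult_mem)

lemma sum_mem: "(\<And>i. i \<in> I \<Longrightarrow> f i \<in> K) \<Longrightarrow> (\<Sum>i\<in>I. f i) \<in> K"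
  by (induction I rule: infinite_finite_induct) (auto intro: zero_mem add_mem)

lemma poly_mem: "(\<And>i. Polynomial.coeff p i \<in> K) \<Longrightarrow> x \<in> K \<Longrightarrow> poly p x \<in> K"
  unfolding poly_altdef by (intro sum_mem mult_mem power_mem)

lemma int_poly_mem: "x \<in> K \<Longrightarrow> poly (complex_poly p) x \<in> K"
  by (intro poly_mem) (auto simp: coeff_map_poly intro: of_int_mem)

lemma int_poly_iterate_mem: "x \<in> K \<Longrightarrow> (poly (complex_poly p) ^^ k) x \<in> K"
  by (induction k) (auto intro: int_poly_mem)

end

locale valued_subfield = complex_subfield +
  fixes v :: "complex \<Rightarrow> real"
  assumes absolute_value: "absolute_value K v"
begin

lemma v_nonneg: "x \<in> K \<Longrightarrow> 0 \<le> v x"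
  and v_eq_0_iff: "x \<in> K \<Longrightarrow> v x = 0 \<longleftrightarrow> x = 0"
  and v_mult: "x \<in> K \<Longrightarrow> y \<in> K \<Longrightarrow> v (x * y) = v x * v y"
  and v_triangle: "x \<in> K \<Longrightarrow> y \<in> K \<Longrightarrow> v (x + y) \<le> v x + v y"
  using absolute_value by (auto simp: absolute_value_def)

lemma v_0: "v 0 = 0"
  using v_eq_0_iff[OF zero_mem] by simp

lemma v_1: "v 1 = 1"
  using v_mult[OF one_mem one_mem] v_eq_0_iff[OF one_mem] by simp

lemma v_power: "x \<in> K \<Longrightarrow> v (x ^ n) = v x ^ n"
  by (induction n) (auto simp: v_1 v_mult power_mem)

lemma v_uminus: "x \<in> K \<Longrightarrow> v (- x) = v x"
proof -
  assume x: "x \<in> K"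
  have "v (- 1) * v (- 1) = 1"
    using v_mult[of "- 1" "- 1"] by (simp add: v_1 uminus_mem one_mem)
  then have "v (- 1) = 1"
    using v_nonneg[of "- 1"] by (simp add: uminus_mem one_mem square_eq_1_iff)
  then show ?thesis
    using v_mult[of "- 1" x] x by (simp add: uminus_mem one_mem)
qed

lemma v_diff_abs: "x \<in> K \<Longrightarrow> y \<in> K \<Longrightarrow> \<bar>v x - v y\<bar> \<le> v (x - y)"
  using v_triangle[of "x - y" y] v_triangle[of "y - x" x] v_uminus[of "x - y"]
  by (auto simp: diff_mem)

lemma v_sum: "finite I \<Longrightarrow> (\<And>i. i \<in> I \<Longrightarrow> f i \<in> K) \<Longrightarrow> v (\<Sum>i\<in>I. f i) \<le> (\<Sum>i\<in>I. v (f i))"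
proof (induction I rule: finite_induct)
  case (insert i I)
  then have "v (f i + sum f I) \<le> v (f i) + v (sum f I)"
    by (intro v_triangle sum_mem) auto
  with insert show ?case by force
qed (simp add: v_0)

end

lemma padic_abs_of_int_le_1:
  assumes "prime p"
  shows "padic_abs p (of_int n) \<le> 1"
proof (cases "n = 0")
  case False
  have "real p powi (- int k) \<le> 1" for k
    using prime_gt_0_nat[OF assms] by (simp add: power_int_minus inverse_le_1_iff)
  then show ?thesis
    using False by (simp add: padic_abs_def)
qed (simp add: padic_abs_def)

text \<open>Covers all p-adic absolute values without naming p: boundedness on the integers already
  yields the ultrametric inequality.\<close>

locale integral_valued_subfield = valued_subfield +
  assumes v_of_int: "v (of_int n) \<le> 1"
begin

text \<open>Comparing \<open>v ((x + y) ^ n)\<close> with its binomial expansion, whose coefficients have absolute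
  value at most 1, and letting \<open>n\<close> tend to infinity.\<close>

lemma ultrametric:
  assumes x: "x \<in> K" and y: "y \<in> K"
  shows "v (x + y) \<le> max (v x) (v y)"
proof (rule ccontr)
  assume *: "\<not> ?thesis"
  define M where "M = max (v x) (v y)"
  define t where "t = v (x + y) / M"
  have "0 \<le> M"
    unfolding M_def using v_nonneg[OF x] by simp
  have "M \<noteq> 0"
  proof
    assume "M = 0"
    then have "v x = 0" "v y = 0"
      using v_nonneg[OF x] v_nonneg[OF y] by (auto simp: M_def max_def split: if_splits)
    then show False
      using * v_eq_0_iff x y by (simp add: v_0)
  qed
  then have M: "0 < M"
    using \<open>0 \<le> M\<close> by simp
  then have t: "1 < t"
    using * unfolding t_def M_def[symmetric] by (simp add: not_le)
  have bound: "t ^ n \<le> real n + 1" for n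
  proof -
    have "v (x + y) ^ n = v (\<Sum>k\<le>n. of_nat (n choose k) * x ^ k * y ^ (n - k))"
      using v_power[OF add_mem[OF x y], of n] by (simp add: binomial_ring)
    also have "\<dots> \<le> (\<Sum>k\<le>n. v (of_nat (n choose k) * x ^ k * y ^ (n - k)))"
      using x y by (intro v_sum mult_mem power_mem of_nat_mem) auto
    also have "\<dots> \<le> (\<Sum>k\<le>n. M ^ n)"
    proof (rule sum_mono)
      fix k
      assume k: "k \<in> {..n}"
      have "v (of_nat (n choose k) * x ^ k * y ^ (n - k)) = v (of_nat (n choose k)) * v x ^ k * v y ^ (n - k)"
        using x y by (simp add: v_mult v_power mult_mem power_mem of_nat_mem)
      also have "\<dots> \<le> 1 * M ^ k * M ^ (n - k)"
        using v_nonneg[OF x] v_nonneg[OF y] v_of_int[of "int (n choose k)"] v_nonneg[OF of_nat_mem] \<open>0 \<le> M\<close>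
        by (intro mult_mono power_mono mult_nonneg_nonneg) (auto simp: M_def)
      also have "\<dots> = M ^ n"
        using k by (simp flip: power_add)
      finally show "v (of_nat (n choose k) * x ^ k * y ^ (n - k)) \<le> M ^ n" .
    qed
    also have "\<dots> = (real n + 1) * M ^ n"
      by simp
    finally show ?thesis
      using M by (simp add: t_def power_divide divide_le_eq)
  qed
  have "(\<lambda>n. (real n + 1) / t ^ n) \<longlonglongrightarrow> 0"
    using t by real_asymp
  then have "eventually (\<lambda>n. (real n + 1) / t ^ n < 1) sequentially"
    by (rule order_tendstoD) simp
  then obtain n where "(real n + 1) / t ^ n < 1"
    by (auto simp: eventually_sequentially)
  with bound[of n] t show False
    by (simp add: divide_less_eq)
qed

lemma v_sum_le:
  "finite I \<Longrightarrow> (\<And>i. i \<in> I \<Longrightarrow> f i \<in> K) \<Longrightarrow> (\<And>i. i \<in> I \<Longrightarrow> v (f i) \<le> B) \<Longrightarrow> 0 \<le> B \<Longrightarrow> v (\<Sum>i\<in>I. f i) \<le> B"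
proof (induction I rule: finite_induct)
  case (insert i I)
  then have "v (f i + sum f I) \<le> max (v (f i)) (v (sum f I))"
    by (intro ultrametric sum_mem) auto
  with insert show ?case by force
qed (simp add: v_0)

text \<open>If v x <= 1 both sides are 0. If v x > 1 the leading term strictly dominates the others,
  whose integer coefficients have absolute value at most 1.\<close>

lemma log_plus_monic_int_poly:
  assumes monic: "Polynomial.lead_coeff p = 1" and x: "x \<in> K"
  shows "log_plus (v (poly (complex_poly p) x)) = real (Polynomial.degree p) * log_plus (v x)"
proof -
  define d where "d = Polynomial.degree p"
  define c where "c i = (of_int (Polynomial.coeff p i) :: complex)" for i
  define s where "s = (\<Sum>i<d. c i * x ^ i)"
  have c: "c i \<in> K" "v (c i) \<le> 1" for i
    by (simp_all add: c_def of_int_mem v_of_int)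
  have s: "s \<in> K"
    unfolding s_def by (intro sum_mem mult_mem power_mem c x)
  have "Polynomial.degree (complex_poly p) = d"
    by (simp add: d_def degree_map_poly)
  then have "poly (complex_poly p) x = (\<Sum>i\<le>d. c i * x ^ i)"
    by (simp add: poly_altdef coeff_map_poly c_def)
  also have "\<dots> = s + c d * x ^ d"
    by (simp add: s_def lessThan_Suc_atMost[symmetric])
  also have "c d = 1"
    using monic by (simp add: c_def d_def)
  finally have poly: "poly (complex_poly p) x = s + x ^ d"
    by simp
  have term_le: "v (c i * x ^ i) \<le> v x ^ i" for i
    using c[of i] x v_nonneg[OF x] v_nonneg[OF c(1)] 
    by (simp add: v_mult v_power power_mem mult_left_le_one_le)
  have pK: "poly (complex_poly p) x \<in> K"
    by (rule int_poly_mem[OF x])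
  show ?thesis
  proof (cases "v x \<le> 1")
    case True
    have "v (c i * x ^ i) \<le> 1" for i
      using term_le[of i] power_le_one[OF v_nonneg[OF x] True, of i] by linarith
    then have "v s \<le> 1"
      unfolding s_def by (intro v_sum_le mult_mem power_mem c x) auto
    moreover have "v (x ^ d) \<le> 1"
      using power_le_one[OF v_nonneg[OF x] True] by (simp add: v_power[OF x])
    ultimately have "v (poly (complex_poly p) x) \<le> 1"
      unfolding poly using ultrametric[OF s power_mem[OF x], of d] by linarith
    then show ?thesis
      using True v_nonneg[OF x] v_nonneg[OF pK] by (simp add: log_plus_eq_ln_max max_absorb1)
  next
    case False
    then have gt: "1 < v x" by simp
    show ?thesis
    proof (cases d)
      case 0
      then have "poly (complex_poly p) x = 1"
        unfolding poly s_def by simp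
      then show ?thesis
        using 0 by (simp add: v_1 log_plus_def d_def)
    next
      case (Suc m)
      have "v (c i * x ^ i) \<le> v x ^ m" if "i \<in> {..<d}" for i
      proof -
        have "v x ^ i \<le> v x ^ m"
          using gt that Suc by (intro power_increasing) auto
        with term_le[of i] show ?thesis by (rule order_trans)
      qed
      then have "v s \<le> v x ^ m"
        unfolding s_def using v_nonneg[OF x] by (intro v_sum_le mult_mem power_mem c x) auto
      also have "\<dots> < v x ^ d"
        using gt Suc by simp
      finally have less: "v s < v x ^ d" .
      have "v (poly (complex_poly p) x) \<le> v x ^ d"
        unfolding poly using ultrametric[OF s power_mem[OF x], of d] less by (simp add: v_power[OF x])
      moreover have "v x ^ d \<le> v (poly (complex_poly p) x)"
      proof -
        \<comment> \<open>Writing x^d as p(x) - s, the maximum in the ultrametric inequality cannot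
          be v s, which is strictly too small.\<close>
        have "x ^ d = poly (complex_poly p) x + - s"
          unfolding poly by simp
        then have "v x ^ d \<le> max (v (poly (complex_poly p) x)) (v (- s))"
          using ultrametric[OF pK uminus_mem[OF s]] v_power[OF x, of d] by simp
        then show ?thesis
          using less by (simp add: v_uminus[OF s])
      qed
      ultimately have "v (poly (complex_poly p) x) = v x ^ d"
        by simp
      then show ?thesis
        using log_plus_power[OF v_nonneg[OF x], of d] by (simp add: d_def)
    qed
  qed
qed

lemma log_plus_monic_int_poly_iterate:
  assumes "Polynomial.lead_coeff p = 1" "x \<in> K"
  shows "log_plus (v ((poly (complex_poly p) ^^ k) x)) = real (Polynomial.degree p) ^ k * log_plus (v x)"
  by (induction k) (simp_all add: log_plus_monic_int_poly[OF assms(1)] int_poly_iterate_mem assms(2))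

end

lemma finite_height_sum_iterate:
  assumes K: "number_field K" and x: "x \<in> K" and monic: "Polynomial.lead_coeff p = 1"
  shows "finite_height_sum K ((poly (complex_poly p) ^^ k) x) 
    = real (Polynomial.degree p) ^ k * finite_height_sum K x"
proof -
  let ?c = "real (Polynomial.degree p) ^ k"
  have "log_plus (v ((poly (complex_poly p) ^^ k) x)) = ?c * log_plus (v x)" if v: "v \<in> finite_places K" for v
  proof -
    obtain q where q: "prime q" "\<And>r. v (of_rat r) = padic_abs q r"
      using v by (auto simp: finite_places_def)
    interpret integral_valued_subfield K v
    proof (intro integral_valued_subfield.intro valued_subfield.intro complex_subfield.intro
        valued_subfield_axioms.intro integral_valued_subfield_axioms.intro)
      show "subfield K complex_field"
        using K unfolding number_field_def by blast
      show "absolute_value K v"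
        using v by (simp add: finite_places_def)
      show "v (of_int n) \<le> 1" for n
        using padic_abs_of_int_le_1[OF q(1), of n] q(2)[of "of_int n"] by simp
    qed
    show ?thesis
      by (rule log_plus_monic_int_poly_iterate[OF monic x])
  qed
  then have "finite_height_sum K ((poly (complex_poly p) ^^ k) x) =
      (\<Sum>\<^sub>\<infinity>v \<in> finite_places K. ?c * (real (local_degree K v) * log_plus (v x)))"
    unfolding finite_height_sum_def by (intro infsum_cong) simp
  \<comment> \<open>The factor leaves the infinite sum in every case: a family that is not summable
    has value 0 before and after scaling.\<close>
  also have "\<dots> = ?c * finite_height_sum K x"
    unfolding finite_height_sum_def by (rule infsum_cmult_right')
  finally show ?thesis .
qed


section \<open>Multiplicative seminorms on real polynomials\<close>

text \<open>Taking n-th roots makes the constant disappear; this sharpens a bound on a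
  multiplicative function to one with constant 1.\<close>

lemma power_ratio_bounded_imp_le:
  fixes a b C :: real
  assumes "0 \<le> b" and bound: "\<And>n. a ^ n \<le> C * b ^ n" and "0 \<le> a"
  shows "a \<le> b"
proof (rule ccontr)
  assume "\<not> a \<le> b"
  then have ab: "b < a" by simp
  show False
  proof (cases "b = 0")
    case True
    with bound[of 1] ab show False by simp
  next
    case False
    with assms have b: "0 < b" by simp
    have "(a / b) ^ n \<le> C" for n
      using bound[of n] b by (simp add: power_divide divide_le_eq)
    moreover obtain n where "C < (a / b) ^ n"
      using real_arch_pow[of "a / b" C] ab b by auto
    ultimately show False
      by (meson not_le)
  qed
qed

text \<open>Definiteness is deliberately absent: the seminorm induced by evaluation at an algebraic
  number vanishes on its annihilating polynomials, and that is what gets exploited.\<close>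

locale multiplicative_seminorm =
  fixes N :: "real poly \<Rightarrow> real"
  assumes nonneg: "0 \<le> N f"
    and mult: "N (f * g) = N f * N g"
    and triangle: "N (f + g) \<le> N f + N g"
    and const: "N [:c:] = \<bar>c\<bar>"
begin

lemma uminus: "N (- f) = N f"
  using mult[of "[:-1:]" f] by (simp add: const)

lemma power: "N (f ^ n) = N f ^ n"
  using const[of 1] by (induction n) (auto simp: mult one_pCons)

lemma add_null: 
  assumes "N g = 0"
  shows "N (f + g) = N f"
  using triangle[of f g] triangle[of "f + g" "- g"] assms by (simp add: uminus)

text \<open>The product of x - \<theta> and x minus the conjugate of \<theta>; for real \<theta> it
  is the square of a linear polynomial.\<close>

abbreviation quadratic :: "complex \<Rightarrow> real poly" where
  "quadratic \<theta> \<equiv> [:(cmod \<theta>)\<^sup>2, - 2 * Re \<theta>, 1:]"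

abbreviation ev :: "real poly \<Rightarrow> complex \<Rightarrow> complex" where
  "ev f \<equiv> poly (map_poly of_real f)"

lemma ev_simps: "ev (f + g) \<theta> = ev f \<theta> + ev g \<theta>" "ev (f * g) \<theta> = ev f \<theta> * ev g \<theta>"
  "ev (f - g) \<theta> = ev f \<theta> - ev g \<theta>" "ev (f ^ n) \<theta> = ev f \<theta> ^ n"
  "ev [:a, b:] \<theta> = of_real a + of_real b * \<theta>" "ev [:a:] \<theta> = of_real a" "ev 1 \<theta> = 1"
proof -
  show add: "ev (f + g) \<theta> = ev f \<theta> + ev g \<theta>" for f g
  proof -
    have "map_poly complex_of_real (f + g) = map_poly of_real f + map_poly of_real g"
      by (intro poly_eqI) (simp add: coeff_map_poly)
    then show ?thesis by simp
  qed
  show mult: "ev (f * g) \<theta> = ev f \<theta> * ev g \<theta>" for f g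
  proof -
    have "map_poly complex_of_real (f * g) = map_poly of_real f * map_poly of_real g"
      by (intro poly_eqI) (simp add: coeff_map_poly coeff_mult)
    then show ?thesis by simp
  qed
  have "ev (f - g) \<theta> + ev g \<theta> = ev f \<theta>"
    using add[of "f - g" g] by simp
  then show "ev (f - g) \<theta> = ev f \<theta> - ev g \<theta>"
    by (simp add: algebra_simps)
  show one: "ev 1 \<theta> = 1"
    by simp
  show "ev (f ^ n) \<theta> = ev f \<theta> ^ n"
    by (induction n) (simp_all only: power_0 power_Suc mult one)
  show "ev [:a, b:] \<theta> = of_real a + of_real b * \<theta>" "ev [:a:] \<theta> = of_real a"
    by (simp_all add: Polynomial.map_poly_pCons)
qed

lemma ev_of_real: "ev f (of_real x) = of_real (poly f x)"
  by (induction f) (simp_all add: Polynomial.map_poly_pCons)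

lemma quadratic_real:
  assumes "Im \<theta> = 0"
  shows "quadratic \<theta> = [:- Re \<theta>, 1:] * [:- Re \<theta>, 1:]"
proof -
  have sq: "(cmod \<theta>)\<^sup>2 = Re \<theta> * Re \<theta>"
    unfolding cmod_power2 using assms by (simp add: power2_eq_square)
  show ?thesis
    unfolding sq by simp
qed

lemma degree_less_2: "Polynomial.degree r < 2 \<Longrightarrow> r = [:Polynomial.coeff r 0, Polynomial.coeff r 1:]"
  for r :: "real poly"
  by (intro poly_eqI) (auto simp: coeff_pCons coeff_eq_0 split: nat.split)

lemma ev_quadratic: "ev (quadratic \<theta>) \<theta> = 0"
proof -
  have "ev (quadratic \<theta>) \<theta> = of_real ((cmod \<theta>)\<^sup>2) + \<theta> * (of_real (- 2 * Re \<theta>) + \<theta>)"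
    by (simp add: Polynomial.map_poly_pCons)
  also have "\<dots> = 0"
    by (simp only: cmod_power2) (simp add: complex_eq_iff power2_eq_square algebra_simps)
  finally show ?thesis .
qed

text \<open>A complex root of f splits off a real linear or quadratic factor. By multiplicativity N
  vanishes on that factor or on the quotient, which has smaller degree.\<close>

lemma null_quadratic_exists:
  assumes "f \<noteq> 0" "N f = 0"
  shows "\<exists>\<theta>. N (quadratic \<theta>) = 0"
  using assms
proof (induction "Polynomial.degree f" arbitrary: f rule: less_induct)
  case less
  have "Polynomial.degree f \<noteq> 0"
  proof
    assume "Polynomial.degree f = 0"
    then obtain c where "f = [:c:]" by (rule degree_eq_zeroE)
    with less.prems const show False by simp
  qed
  then have "\<not> constant (ev f)"
    by (simp add: constant_degree degree_map_poly)
  then obtain \<theta> where \<theta>: "ev f \<theta> = 0"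
    using fundamental_theorem_of_algebra by blast
  show ?case
  proof (cases "Im \<theta> = 0")
    case True
    then have "\<theta> = of_real (Re \<theta>)"
      by (simp add: complex_eq_iff)
    then have "of_real (poly f (Re \<theta>)) = (0 :: complex)"
      using \<theta> ev_of_real[of f "Re \<theta>"] by metis
    then have "poly f (Re \<theta>) = 0"
      by simp
    then obtain h where h: "f = [:- Re \<theta>, 1:] * h"
      unfolding poly_eq_0_iff_dvd by (rule dvdE)
    have "h \<noteq> 0"
      using h less.prems by auto
    have "N [:- Re \<theta>, 1:] = 0 \<or> N h = 0"
      using less.prems(2) unfolding h mult by simp
    then show ?thesis
    proof
      assume "N [:- Re \<theta>, 1:] = 0"
      then have "N (quadratic \<theta>) = 0"
        unfolding quadratic_real[OF True] mult by simp
      then show ?thesis by blast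
    next
      assume "N h = 0"
      have "Polynomial.degree f = Suc (Polynomial.degree h)"
        unfolding h using \<open>h \<noteq> 0\<close> by (subst degree_mult_eq) auto
      then show ?thesis
        using less.hyps[OF _ \<open>h \<noteq> 0\<close> \<open>N h = 0\<close>] by simp
    qed
  next
    case False
    define h where "h = f div quadratic \<theta>"
    define r where "r = f mod quadratic \<theta>"
    have f: "f = quadratic \<theta> * h + r"
      unfolding h_def r_def by (rule mult_div_mod_eq[symmetric])
    have "Polynomial.degree r < 2"
      using degree_mod_less'[of "quadratic \<theta>" f] by (cases "r = 0") (auto simp: r_def)
    then obtain a b where ab: "r = [:a, b:]"
      using degree_less_2 by blast
    have "ev r \<theta> = 0"
      using \<theta> unfolding f ev_simps(1,2) ev_quadratic by simp
    then have "b = 0" "a = 0"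
      using False by (auto simp: ab ev_simps complex_eq_iff)
    then have f': "f = quadratic \<theta> * h"
      using f ab by simp
    have "h \<noteq> 0"
      using f' less.prems by auto
    have "N (quadratic \<theta>) = 0 \<or> N h = 0"
      using less.prems(2) unfolding f' mult by simp
    then show ?thesis
    proof
      assume "N h = 0"
      have "Polynomial.degree f = 2 + Polynomial.degree h"
        unfolding f' using \<open>h \<noteq> 0\<close> by (subst degree_mult_eq) auto
      then show ?thesis
        using less.hyps[OF _ \<open>h \<noteq> 0\<close> \<open>N h = 0\<close>] by simp
    qed blast
  qed
qed

text \<open>A null quadratic makes N depend on the value at \<theta> only, so N becomes a
  multiplicative seminorm on R or C. On C it is bounded by a multiple of the modulus, powers remove
  the constant, and inverses give the reverse inequality.\<close>

theorem evaluation_at_complex_number: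
  assumes "f \<noteq> 0" "N f = 0"
  obtains \<theta> where "\<And>g. N g = cmod (ev g \<theta>)"
proof -
  obtain \<theta> where q: "N (quadratic \<theta>) = 0"
    using null_quadratic_exists[OF assms] by blast
  show ?thesis
  proof (cases "Im \<theta> = 0")
    case True
    have lin: "N [:- Re \<theta>, 1:] = 0"
    proof -
      have "N [:- Re \<theta>, 1:] * N [:- Re \<theta>, 1:] = 0"
        using q unfolding quadratic_real[OF True] mult .
      then show ?thesis by simp
    qed
    have \<theta>: "\<theta> = of_real (Re \<theta>)"
      using True by (simp add: complex_eq_iff)
    have "N g = cmod (ev g \<theta>)" for g
    proof -
      have "poly (g - [:poly g (Re \<theta>):]) (Re \<theta>) = 0"
        by simp
      then obtain h where h: "g - [:poly g (Re \<theta>):] = [:- Re \<theta>, 1:] * h"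
        unfolding poly_eq_0_iff_dvd by (rule dvdE)
      have "g = [:poly g (Re \<theta>):] + [:- Re \<theta>, 1:] * h"
        unfolding h[symmetric] by simp
      then have "N g = N ([:poly g (Re \<theta>):] + [:- Re \<theta>, 1:] * h)"
        by simp
      also have "\<dots> = \<bar>poly g (Re \<theta>)\<bar>"
        by (subst add_null) (simp_all only: mult lin const mult_zero_left)
      also have "\<dots> = cmod (of_real (poly g (Re \<theta>)))"
        by simp
      also have "of_real (poly g (Re \<theta>)) = ev g \<theta>"
        using \<theta> ev_of_real[of g "Re \<theta>"] by metis
      finally show ?thesis .
    qed
    then show ?thesis by (rule that)
  next
    case False
    \<comment> \<open>Recovering the real numbers a and b from w = a + b \<theta> costs a factor 1 /
      |Im \<theta>|; the last summand accounts for N of the variable.\<close>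
    define C where "C = 1 + cmod \<theta> / \<bar>Im \<theta>\<bar> + N [:0, 1:] / \<bar>Im \<theta>\<bar>"
    have linear: "N [:a, b:] \<le> C * cmod (ev [:a, b:] \<theta>)" for a b
    proof -
      let ?w = "of_real a + of_real b * \<theta>"
      have "\<bar>b\<bar> * \<bar>Im \<theta>\<bar> \<le> cmod ?w"
        using abs_Im_le_cmod[of ?w] by (simp add: abs_mult)
      then have b: "\<bar>b\<bar> \<le> cmod ?w / \<bar>Im \<theta>\<bar>"
        using False by (simp add: pos_le_divide_eq)
      have "\<bar>a\<bar> = cmod (?w - of_real b * \<theta>)"
        by simp
      also have "\<dots> \<le> cmod ?w + \<bar>b\<bar> * cmod \<theta>"
        by (rule order_trans[OF norm_triangle_ineq4]) (simp add: norm_mult)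
      also have "\<dots> \<le> cmod ?w + cmod ?w / \<bar>Im \<theta>\<bar> * cmod \<theta>"
        using b by (intro add_left_mono mult_right_mono) auto
      finally have a: "\<bar>a\<bar> \<le> cmod ?w + cmod ?w / \<bar>Im \<theta>\<bar> * cmod \<theta>" .
      have "N [:a, b:] = N ([:a:] + [:b:] * [:0, 1:])"
        by simp
      also have "\<dots> \<le> \<bar>a\<bar> + \<bar>b\<bar> * N [:0, 1:]"
        by (rule order_trans[OF triangle]) (simp only: mult const order_refl)
      also have "\<dots> \<le> (cmod ?w + cmod ?w / \<bar>Im \<theta>\<bar> * cmod \<theta>) + cmod ?w / \<bar>Im \<theta>\<bar> * N [:0, 1:]"
        using a b nonneg by (intro add_mono mult_right_mono) auto
      also have "\<dots> = C * cmod ?w"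
        by (simp add: C_def algebra_simps)
      finally show ?thesis
        by (simp add: ev_simps)
    qed
    have bound: "N g \<le> C * cmod (ev g \<theta>)" for g
    proof -
      define r where "r = g mod quadratic \<theta>"
      have g: "g = r + quadratic \<theta> * (g div quadratic \<theta>)"
        unfolding r_def by (rule mod_mult_div_eq[symmetric])
      have "Polynomial.degree r < 2"
        using degree_mod_less'[of "quadratic \<theta>" g] by (cases "r = 0") (auto simp: r_def)
      then obtain a b where ab: "r = [:a, b:]"
        using degree_less_2 by blast
      have "N g = N r"
        by (subst g, rule add_null) (simp only: mult q mult_zero_left)
      moreover have "ev g \<theta> = ev r \<theta>"
        by (subst g) (simp only: ev_simps(1,2) ev_quadratic mult_zero_left add_0_right)
      ultimately show ?thesis
        using linear[of a b] ab by simp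
    qed
    have upper: "N g \<le> cmod (ev g \<theta>)" for g
    proof (rule power_ratio_bounded_imp_le)
      show "N g ^ n \<le> C * cmod (ev g \<theta>) ^ n" for n
        using bound[of "g ^ n"] by (simp add: power ev_simps norm_power)
    qed (auto simp: nonneg)
    have "N g = cmod (ev g \<theta>)" for g
    proof (cases "ev g \<theta> = 0")
      case True
      then show ?thesis
        using upper[of g] nonneg[of g] by simp
    next
      case nz: False
      define u where "u = inverse (ev g \<theta>)"
      define b where "b = Im u / Im \<theta>"
      \<comment> \<open>Since 1 and \<theta> span C over R, the inverse of the value of g is the
        value of a real linear polynomial h, and \<open>g * h - 1\<close> is null.\<close>
      define h where "h = [:Re u - b * Re \<theta>, b:]"
      have "ev h \<theta> = u"
        using False by (simp add: h_def ev_simps complex_eq_iff b_def)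
      then have "ev (g * h - 1) \<theta> = 0"
        using nz by (simp add: ev_simps u_def)
      then have "N (g * h - 1) = 0"
        using upper[of "g * h - 1"] nonneg[of "g * h - 1"] by simp
      then have "N (1 + (g * h - 1)) = N 1"
        by (rule add_null)
      then have "N g * N h = 1"
        using const[of 1] by (simp add: mult one_pCons)
      moreover have "N h \<le> cmod u"
        using upper[of h] \<open>ev h \<theta> = u\<close> by simp
      then have "N g * N h \<le> N g * cmod u"
        using nonneg by (intro mult_left_mono)
      ultimately have "cmod (ev g \<theta>) \<le> N g"
        using nz by (simp add: u_def norm_inverse pos_le_divide_eq flip: divide_inverse)
      with upper[of g] show ?thesis by simp
    qed
    then show ?thesis by (rule that)
  qed
qed

end


section \<open>Archimedean absolute values come from embeddings\<close>

lemma dyadic_floor_tendsto: "(\<lambda>k. of_int \<lfloor>t * 2 ^ k\<rfloor> / 2 ^ k) \<longlonglongrightarrow> (t :: real)"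
proof (rule LIM_zero_cancel, rule Lim_null_comparison)
  show "(\<lambda>k. (1 / 2) ^ k) \<longlonglongrightarrow> (0 :: real)"
    by (intro LIMSEQ_realpow_zero) auto
  show "\<forall>\<^sub>F k in sequentially. norm (of_int \<lfloor>t * 2 ^ k\<rfloor> / 2 ^ k - t) \<le> (1 / 2) ^ k"
  proof (rule always_eventually, rule allI)
    fix k
    have "\<bar>real_of_int \<lfloor>t * 2 ^ k\<rfloor> - t * 2 ^ k\<bar> \<le> 1"
      by linarith
    then have "\<bar>real_of_int \<lfloor>t * 2 ^ k\<rfloor> - t * 2 ^ k\<bar> / 2 ^ k \<le> 1 / 2 ^ k"
      by (intro divide_right_mono) auto
    moreover have "of_int \<lfloor>t * 2 ^ k\<rfloor> / 2 ^ k - t = (real_of_int \<lfloor>t * 2 ^ k\<rfloor> - t * 2 ^ k) / 2 ^ k"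
      by (simp add: field_simps)
    ultimately show "norm (of_int \<lfloor>t * 2 ^ k\<rfloor> / 2 ^ k - t) \<le> (1 / 2) ^ k"
      by (simp add: power_one_over)
  qed
qed

locale arch_valued_subfield = valued_subfield +
  assumes v_of_rat: "v (of_rat q) = \<bar>real_of_rat q\<bar>"
begin

context
  fixes \<beta> :: complex
  assumes \<beta>: "\<beta> \<in> K"
begin

definition rat_eval :: "rat poly \<Rightarrow> complex" where
  "rat_eval h = poly (map_poly of_rat h) \<beta>"

lemma rat_eval_sum: "Polynomial.degree h \<le> D \<Longrightarrow> rat_eval h = (\<Sum>i\<le>D. of_rat (Polynomial.coeff h i) * \<beta> ^ i)"
  unfolding rat_eval_def poly_altdef
  by (intro sum.mono_neutral_cong_left) (auto simp: coeff_map_poly degree_map_poly coeff_eq_0)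

lemma rat_eval_mem: "rat_eval h \<in> K"
  unfolding rat_eval_sum[OF order_refl] by (intro sum_mem mult_mem of_rat_mem power_mem \<beta>)

lemma rat_eval_add: "rat_eval (h + h') = rat_eval h + rat_eval h'"
proof -
  have "map_poly of_rat (h + h') = (map_poly of_rat h + map_poly of_rat h' :: complex poly)"
    by (intro poly_eqI) (simp add: coeff_map_poly of_rat_add)
  then show ?thesis by (simp add: rat_eval_def)
qed

lemma rat_eval_mult: "rat_eval (h * h') = rat_eval h * rat_eval h'"
proof -
  have "map_poly of_rat (h * h') = (map_poly of_rat h * map_poly of_rat h' :: complex poly)"
    by (intro poly_eqI) (simp add: coeff_map_poly coeff_mult of_rat_sum of_rat_mult)
  then show ?thesis by (simp add: rat_eval_def)
qed

definition coeff_dist :: "nat \<Rightarrow> rat poly \<Rightarrow> real poly \<Rightarrow> real" where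
  "coeff_dist D h g = (\<Sum>i\<le>D. \<bar>real_of_rat (Polynomial.coeff h i) - Polynomial.coeff g i\<bar> * v \<beta> ^ i)"

lemma v_rat_eval_diff:
  assumes "Polynomial.degree h \<le> D" "Polynomial.degree h' \<le> D"
  shows "\<bar>v (rat_eval h) - v (rat_eval h')\<bar> \<le> coeff_dist D h g + coeff_dist D h' g"
proof -
  let ?c = "\<lambda>i. Polynomial.coeff h i - Polynomial.coeff h' i"
  have "\<bar>v (rat_eval h) - v (rat_eval h')\<bar> \<le> v (rat_eval h - rat_eval h')"
    by (intro v_diff_abs rat_eval_mem)
  also have "rat_eval h - rat_eval h' = (\<Sum>i\<le>D. of_rat (?c i) * \<beta> ^ i)"
    unfolding rat_eval_sum[OF assms(1)] rat_eval_sum[OF assms(2)]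
    by (simp add: sum_subtractf of_rat_diff left_diff_distrib)
  also have "v \<dots> \<le> (\<Sum>i\<le>D. v (of_rat (?c i) * \<beta> ^ i))"
    by (intro v_sum mult_mem of_rat_mem power_mem \<beta>) auto
  also have "\<dots> = (\<Sum>i\<le>D. \<bar>real_of_rat (?c i)\<bar> * v \<beta> ^ i)"
    by (simp add: v_mult v_power of_rat_mem power_mem \<beta> v_of_rat)
  also have "\<dots> \<le> coeff_dist D h g + coeff_dist D h' g"
    unfolding coeff_dist_def sum.distrib[symmetric]
  proof (rule sum_mono)
    fix i
    have "\<bar>real_of_rat (?c i)\<bar> \<le> \<bar>real_of_rat (Polynomial.coeff h i) - Polynomial.coeff g i\<bar> 
        + \<bar>real_of_rat (Polynomial.coeff h' i) - Polynomial.coeff g i\<bar>"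
      unfolding of_rat_diff by linarith
    then show "\<bar>real_of_rat (?c i)\<bar> * v \<beta> ^ i \<le> \<bar>real_of_rat (Polynomial.coeff h i) - Polynomial.coeff g i\<bar> * v \<beta> ^ i
        + \<bar>real_of_rat (Polynomial.coeff h' i) - Polynomial.coeff g i\<bar> * v \<beta> ^ i"
      unfolding distrib_right[symmetric] using v_nonneg[OF \<beta>] by (intro mult_right_mono) auto
  qed
  finally show ?thesis .
qed

definition approximates :: "(nat \<Rightarrow> rat poly) \<Rightarrow> real poly \<Rightarrow> bool" where
  "approximates h g \<longleftrightarrow> (\<exists>D. \<forall>k. Polynomial.degree (h k) \<le> D) \<and>
     (\<forall>i. (\<lambda>k. real_of_rat (Polynomial.coeff (h k) i)) \<longlonglongrightarrow> Polynomial.coeff g i)"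

lemma coeff_dist_tendsto: "approximates h g \<Longrightarrow> (\<lambda>k. coeff_dist D (h k) g) \<longlonglongrightarrow> 0"
  unfolding coeff_dist_def approximates_def
  by (intro tendsto_null_sum tendsto_mult_left_zero tendsto_rabs_zero) (auto simp: LIM_zero)

definition rat_approx :: "nat \<Rightarrow> real \<Rightarrow> rat" where
  "rat_approx k c = of_int \<lfloor>c * 2 ^ k\<rfloor> / 2 ^ k"

lemma rat_approx_tendsto: "(\<lambda>k. real_of_rat (rat_approx k c)) \<longlonglongrightarrow> c"
proof -
  have "real_of_rat (rat_approx k c) = of_int \<lfloor>c * 2 ^ k\<rfloor> / 2 ^ k" for k
    by (simp add: rat_approx_def of_rat_divide of_rat_power)
  then show ?thesis
    using dyadic_floor_tendsto[of c] by simp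
qed

lemma approximates_exists: "approximates (\<lambda>k. map_poly (rat_approx k) g) g"
  unfolding approximates_def
proof (intro conjI allI exI)
  show "Polynomial.degree (map_poly (rat_approx k) g) \<le> Polynomial.degree g" for k
    by (intro degree_le) (auto simp: coeff_map_poly rat_approx_def coeff_eq_0)
  show "(\<lambda>k. real_of_rat (Polynomial.coeff (map_poly (rat_approx k) g) i)) \<longlonglongrightarrow> Polynomial.coeff g i" for i
    using rat_approx_tendsto[of "Polynomial.coeff g i"] by (simp add: coeff_map_poly rat_approx_def)
qed

text \<open>Extends v composed with evaluation at \<beta> to real polynomials by continuity in the
  coefficients. The dyadic approximation is one choice; \<open>poly_val_tendsto\<close> shows
  independence of it.\<close>

definition poly_val :: "real poly \<Rightarrow> real" where
  "poly_val g = lim (\<lambda>k. v (rat_eval (map_poly (rat_approx k) g)))"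

lemma poly_val_tendsto:
  assumes "approximates h g"
  shows "(\<lambda>k. v (rat_eval (h k))) \<longlonglongrightarrow> poly_val g"
proof -
  let ?h = "\<lambda>k. map_poly (rat_approx k) g"
  obtain D1 D2 where D12: "\<And>k. Polynomial.degree (h k) \<le> D1" "\<And>k. Polynomial.degree (?h k) \<le> D2"
    using assms approximates_exists[of g] unfolding approximates_def by blast
  define D where "D = max D1 D2"
  have D: "Polynomial.degree (h k) \<le> D" "Polynomial.degree (?h k) \<le> D" for k
    using D12[of k] by (auto simp: D_def)
  note lim1 = coeff_dist_tendsto[OF assms, of D] and lim2 = coeff_dist_tendsto[OF approximates_exists, of D g]
  have "Cauchy (\<lambda>k. v (rat_eval (?h k)))"
  proof (rule metric_CauchyI)
    fix e :: real
    assume "0 < e"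
    then have "eventually (\<lambda>k. coeff_dist D (?h k) g < e / 2) sequentially"
      by (intro order_tendstoD(2)[OF lim2]) auto
    then obtain M where M: "\<And>k. M \<le> k \<Longrightarrow> coeff_dist D (?h k) g < e / 2"
      by (auto simp: eventually_sequentially)
    have "dist (v (rat_eval (?h m))) (v (rat_eval (?h n))) < e" if "M \<le> m" "M \<le> n" for m n
      using v_rat_eval_diff[OF D(2)[of m] D(2)[of n], of g] M[OF that(1)] M[OF that(2)] 
      unfolding dist_real_def by linarith
    then show "\<exists>M. \<forall>m\<ge>M. \<forall>n\<ge>M. dist (v (rat_eval (?h m))) (v (rat_eval (?h n))) < e"
      by blast
  qed
  then have "(\<lambda>k. v (rat_eval (?h k))) \<longlonglongrightarrow> poly_val g"
    unfolding poly_val_def by (intro convergent_LIMSEQ_iff[THEN iffD1] Cauchy_convergent)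
  moreover have "(\<lambda>k. v (rat_eval (h k)) - v (rat_eval (?h k))) \<longlonglongrightarrow> 0"
  proof (rule Lim_null_comparison)
    show "(\<lambda>k. coeff_dist D (h k) g + coeff_dist D (?h k) g) \<longlonglongrightarrow> 0"
      using tendsto_add[OF lim1 lim2] by simp
    show "\<forall>\<^sub>F k in sequentially. norm (v (rat_eval (h k)) - v (rat_eval (?h k))) \<le> coeff_dist D (h k) g + coeff_dist D (?h k) g"
      unfolding real_norm_def by (intro always_eventually allI v_rat_eval_diff D)
  qed
  ultimately show ?thesis
    using tendsto_add[of _ 0 sequentially _ "poly_val g"] by fastforce
qed

lemma approximates_add: "approximates h g \<Longrightarrow> approximates h' g' \<Longrightarrow> approximates (\<lambda>k. h k + h' k) (g + g')"
  unfolding approximates_def coeff_add of_rat_add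
proof (elim conjE exE, intro conjI allI exI)
  fix D D' k
  assume "\<forall>k. Polynomial.degree (h k) \<le> D" "\<forall>k. Polynomial.degree (h' k) \<le> D'"
  then show "Polynomial.degree (h k + h' k) \<le> max D D'"
    by (meson degree_add_le_max max.mono order_trans)
qed (auto intro: tendsto_add)

lemma approximates_mult: "approximates h g \<Longrightarrow> approximates h' g' \<Longrightarrow> approximates (\<lambda>k. h k * h' k) (g * g')"
  unfolding approximates_def coeff_mult of_rat_sum of_rat_mult
proof (elim conjE exE, intro conjI allI exI)
  fix D D' k
  assume "\<forall>k. Polynomial.degree (h k) \<le> D" "\<forall>k. Polynomial.degree (h' k) \<le> D'"
  then show "Polynomial.degree (h k * h' k) \<le> D + D'"
    by (meson degree_mult_le add_mono order_trans)
qed (auto intro!: tendsto_sum tendsto_mult)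

lemma approximates_rat: "approximates (\<lambda>_. h) (map_poly of_rat h)"
  unfolding approximates_def by (auto simp: coeff_map_poly)

lemma poly_val_rat: "poly_val (map_poly of_rat h) = v (rat_eval h)"
  using poly_val_tendsto[OF approximates_rat[of h]] by (simp add: LIMSEQ_const_iff)

lemma multiplicative_seminorm_poly_val: "multiplicative_seminorm poly_val"
proof
  fix f g :: "real poly" and c :: real
  let ?a = "\<lambda>g k. map_poly (rat_approx k) g"
  note lim = poly_val_tendsto[OF approximates_exists]
  show "0 \<le> poly_val f"
    by (rule LIMSEQ_le_const[OF lim[of f]]) (auto intro: v_nonneg rat_eval_mem)
  show "poly_val (f * g) = poly_val f * poly_val g"
  proof (rule LIMSEQ_unique)
    show "(\<lambda>k. v (rat_eval (?a f k * ?a g k))) \<longlonglongrightarrow> poly_val (f * g)"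
      by (intro poly_val_tendsto approximates_mult approximates_exists)
    show "(\<lambda>k. v (rat_eval (?a f k * ?a g k))) \<longlonglongrightarrow> poly_val f * poly_val g"
      using tendsto_mult[OF lim[of f] lim[of g]] by (simp add: rat_eval_mult v_mult rat_eval_mem)
  qed
  show "poly_val (f + g) \<le> poly_val f + poly_val g"
  proof (rule LIMSEQ_le)
    show "(\<lambda>k. v (rat_eval (?a f k + ?a g k))) \<longlonglongrightarrow> poly_val (f + g)"
      by (intro poly_val_tendsto approximates_add approximates_exists)
    show "(\<lambda>k. v (rat_eval (?a f k)) + v (rat_eval (?a g k))) \<longlonglongrightarrow> poly_val f + poly_val g"
      by (intro tendsto_add lim)
  qed (auto simp: rat_eval_add intro!: v_triangle rat_eval_mem)
  show "poly_val [:c:] = \<bar>c\<bar>"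
  proof (rule LIMSEQ_unique)
    have "approximates (\<lambda>k. [:rat_approx k c:]) [:c:]"
      unfolding approximates_def using rat_approx_tendsto[of c] 
      by (auto simp: coeff_pCons split: nat.split)
    then show "(\<lambda>k. v (rat_eval [:rat_approx k c:])) \<longlonglongrightarrow> poly_val [:c:]"
      by (rule poly_val_tendsto)
    have "rat_eval [:q:] = of_rat q" for q
      unfolding rat_eval_def by (simp add: Polynomial.map_poly_pCons)
    then show "(\<lambda>k. v (rat_eval [:rat_approx k c:])) \<longlonglongrightarrow> \<bar>c\<bar>"
      using tendsto_rabs[OF rat_approx_tendsto[of c]] by (simp add: v_of_rat)
  qed
qed

text \<open>The relation f is a null polynomial for the extended seminorm, which is therefore
  evaluation at some \<theta>. As \<theta> depends on \<beta> this is not yet an embedding of K, but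
  the translates by 0, 1 and -1 are enough for the parallelogram law.\<close>

lemma v_rational_translate:
  assumes f: "f \<noteq> 0" "poly (map_poly of_rat f) \<beta> = 0"
  obtains \<theta> where "\<And>q. v (\<beta> + of_rat q) = cmod (\<theta> + of_rat q)"
proof -
  interpret multiplicative_seminorm poly_val
    by (rule multiplicative_seminorm_poly_val)
  have "poly_val (map_poly of_rat f) = 0"
    using f(2) by (simp add: poly_val_rat rat_eval_def v_0)
  moreover have "map_poly of_rat f \<noteq> (0 :: real poly)"
    using f(1) by (metis coeff_map_poly leading_coeff_0_iff of_rat_0 of_rat_eq_0_iff coeff_0)
  ultimately obtain \<theta> where \<theta>: "\<And>g. poly_val g = cmod (ev g \<theta>)"
    using evaluation_at_complex_number by metis
  have "v (\<beta> + of_rat q) = cmod (\<theta> + of_rat q)" for q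
  proof -
    have "v (\<beta> + of_rat q) = v (rat_eval [:q, 1:])"
      by (simp add: rat_eval_def Polynomial.map_poly_pCons add.commute)
    also have "\<dots> = poly_val (map_poly of_rat [:q, 1:])"
      by (rule poly_val_rat[symmetric])
    also have "map_poly of_rat [:q, 1:] = [:real_of_rat q, 1:]"
      by (simp add: Polynomial.map_poly_pCons)
    also have "poly_val [:real_of_rat q, 1:] = cmod (of_real (real_of_rat q) + \<theta>)"
      unfolding \<theta> by (simp add: Polynomial.map_poly_pCons)
    also have "of_real (real_of_rat q) = (of_rat q :: complex)"
      by (cases q) (simp add: of_rat_rat)
    finally show ?thesis
      by (simp add: add.commute)
  qed
  then show ?thesis by (rule that)
qed

end

end

section \<open>The squared absolute value as a multiplicative quadratic form\<close>

locale algebraic_valued_subfield = arch_valued_subfield +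
  assumes algebraic_K: "x \<in> K \<Longrightarrow> \<exists>f. f \<noteq> 0 \<and> poly (map_poly of_rat f) x = 0"
begin

lemma v_translate: "x \<in> K \<Longrightarrow> \<exists>\<theta>. \<forall>q. v (x + of_rat q) = cmod (\<theta> + of_rat q)"
  using algebraic_K[of x] v_rational_translate[of x] by blast

definition Q :: "complex \<Rightarrow> real" where
  "Q x = (v x)\<^sup>2"

lemma Q_mult: "x \<in> K \<Longrightarrow> y \<in> K \<Longrightarrow> Q (x * y) = Q x * Q y"
  by (simp add: Q_def v_mult power_mult_distrib)

lemma Q_0: "Q 0 = 0" and Q_1: "Q 1 = 1"
  by (simp_all add: Q_def v_0 v_1)

text \<open>Dividing by y reduces to the elements z - 1, z and z + 1, on which v is the complex
  modulus of translates of one number \<theta>.\<close>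

lemma parallelogram:
  assumes "x \<in> K" "y \<in> K"
  shows "Q (x + y) + Q (x - y) = 2 * Q x + 2 * Q y"
proof (cases "y = 0")
  case True
  then show ?thesis by (simp add: Q_0)
next
  case False
  define z where "z = x / y"
  have z: "z \<in> K"
    unfolding z_def by (intro divide_mem assms)
  obtain \<theta> where \<theta>: "\<And>q. v (z + of_rat q) = cmod (\<theta> + of_rat q)"
    using v_translate[OF z] by blast
  have "Q (z + 1) + Q (z - 1) = (cmod (\<theta> + 1))\<^sup>2 + (cmod (\<theta> - 1))\<^sup>2"
    using \<theta>[of 1] \<theta>[of "-1"] by (simp add: Q_def)
  also have "\<dots> = 2 * (cmod \<theta>)\<^sup>2 + 2"
    unfolding cmod_power2 by (simp add: power2_eq_square algebra_simps)
  also have "cmod \<theta> = v z"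
    using \<theta>[of 0] by simp
  finally have "Q (z + 1) + Q (z - 1) = 2 * Q z + 2"
    by (simp add: Q_def)
  then have "(Q (z + 1) + Q (z - 1)) * Q y = (2 * Q z + 2) * Q y"
    by simp
  then have "Q ((z + 1) * y) + Q ((z - 1) * y) = 2 * Q (z * y) + 2 * Q y"
    using Q_mult[OF add_mem[OF z one_mem] assms(2)] Q_mult[OF diff_mem[OF z one_mem] assms(2)]
      Q_mult[OF z assms(2)] by (simp only: distrib_right)
  moreover have "(z + 1) * y = x + y" "(z - 1) * y = x - y" "z * y = x"
    using False by (simp_all add: z_def field_simps)
  ultimately show ?thesis by simp
qed

text \<open>The Jordan-von Neumann argument: this consequence of the parallelogram law is additivity
  of the polarised form.\<close>

lemma Q_add3:
  assumes x: "x \<in> K" and y: "y \<in> K" and z: "z \<in> K"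
  shows "Q (x + y + z) + Q x + Q y + Q z = Q (x + y) + Q (x + z) + Q (y + z)"
proof -
  have a: "Q ((x + z) + y) + Q ((x + z) - y) = 2 * Q (x + z) + 2 * Q y"
    by (intro parallelogram add_mem x y z)
  have b: "Q ((y + z) + x) + Q ((y + z) - x) = 2 * Q (y + z) + 2 * Q x"
    by (intro parallelogram add_mem x y z)
  have c: "Q (z + (x - y)) + Q (z - (x - y)) = 2 * Q z + 2 * Q (x - y)"
    by (intro parallelogram diff_mem x y z)
  have d: "Q (x + y) + Q (x - y) = 2 * Q x + 2 * Q y"
    by (intro parallelogram x y)
  have e: "(x + z) + y = x + y + z" "(y + z) + x = x + y + z" "(x + z) - y = z + (x - y)" "(y + z) - x = z - (x - y)"
    by simp_all
  show ?thesis
    using a b c d unfolding e by linarith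
qed

definition ip :: "complex \<Rightarrow> complex \<Rightarrow> real" where
  "ip x y = (Q (x + y) - Q x - Q y) / 2"

lemma Q_add: "Q (x + y) = Q x + Q y + 2 * ip x y"
  by (simp add: ip_def)

lemma ip_commute: "ip x y = ip y x"
  by (simp add: ip_def add.commute)

lemma ip_add_left:
  assumes "x \<in> K" "y \<in> K" "z \<in> K"
  shows "ip (x + y) z = ip x z + ip y z"
  using Q_add3[OF assms] by (simp add: ip_def)

lemma ip_self: "x \<in> K \<Longrightarrow> ip x x = Q x"
  using parallelogram[of x x] by (simp add: ip_def Q_0)

lemma ip_mult:
  assumes "x \<in> K" "y \<in> K" "z \<in> K"
  shows "ip (x * y) (x * z) = Q x * ip y z"
  unfolding ip_def distrib_left[symmetric] Q_mult[OF assms(1) add_mem[OF assms(2,3)]]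
    Q_mult[OF assms(1,2)] Q_mult[OF assms(1,3)]
  by (simp add: right_diff_distrib)

text \<open>Multiplicativity of Q linearised in both factors, the basic identity of composition
  algebras.\<close>

lemma ip_mult_polarised:
  assumes x: "x \<in> K" and y: "y \<in> K" and w: "w \<in> K" and z: "z \<in> K"
  shows "ip (x * y) (w * z) + ip (w * y) (x * z) = 2 * ip x w * ip y z"
proof -
  have "ip ((x + w) * y) ((x + w) * z) = Q (x + w) * ip y z"
    by (intro ip_mult add_mem assms)
  moreover have "ip ((x + w) * y) ((x + w) * z) =
     ip (x * y) (x * z) + ip (w * y) (x * z) + (ip (x * y) (w * z) + ip (w * y) (w * z))"
  proof -
    have right: "ip u (s + t) = ip u s + ip u t" if "u \<in> K" "s \<in> K" "t \<in> K" for u s t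
      using ip_add_left[OF that(2,3,1)] by (simp only: ip_commute[of u])
    show ?thesis
      unfolding distrib_right
      by (simp only: ip_add_left right add_mem mult_mem x y w z)
  qed
  ultimately show ?thesis
    using ip_mult[OF x y z] ip_mult[OF w y z] by (simp add: Q_add distrib_right)
qed

definition re :: "complex \<Rightarrow> real" where
  "re x = ip x 1"

lemma re_add: "x \<in> K \<Longrightarrow> y \<in> K \<Longrightarrow> re (x + y) = re x + re y"
  unfolding re_def by (intro ip_add_left one_mem)

lemma re_1: "re 1 = 1"
  unfolding re_def using ip_self[OF one_mem] by (simp add: Q_1)

text \<open>Formally, the real part of x times the conjugate 2 re(y) - y of y.\<close>

lemma ip_eq_re:
  assumes "x \<in> K" "y \<in> K"
  shows "ip x y = 2 * re x * re y - re (x * y)"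
  using ip_mult_polarised[OF assms(1,2) one_mem one_mem] by (simp add: re_def ip_commute[of y x])

lemma re_mult4:
  assumes x: "x \<in> K" and y: "y \<in> K" and w: "w \<in> K" and z: "z \<in> K"
  shows "re (x * y * w * z) = re (x * y) * re (w * z) + re (w * y) * re (x * z) - ip x w * ip y z"
proof -
  have "ip (x * y) (w * z) = 2 * re (x * y) * re (w * z) - re (x * y * w * z)"
    using ip_eq_re[OF mult_mem[OF x y] mult_mem[OF w z]] by (simp add: mult_ac)
  moreover have "ip (w * y) (x * z) = 2 * re (w * y) * re (x * z) - re (x * y * w * z)"
    using ip_eq_re[OF mult_mem[OF w y] mult_mem[OF x z]] by (simp add: mult_ac)
  ultimately show ?thesis
    using ip_mult_polarised[OF assms] by linarith
qed

text \<open>Cauchy-Schwarz against 1, read off from the number \<theta> attached to x, whose real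
  part is \<open>re x\<close>.\<close>

lemma re_square_le: "x \<in> K \<Longrightarrow> (re x)\<^sup>2 \<le> Q x"
proof -
  assume x: "x \<in> K"
  obtain \<theta> where \<theta>: "\<And>q. v (x + of_rat q) = cmod (\<theta> + of_rat q)"
    using v_translate[OF x] by blast
  have Q: "Q x = (cmod \<theta>)\<^sup>2" "Q (x + 1) = (cmod (\<theta> + 1))\<^sup>2"
    using \<theta>[of 0] \<theta>[of 1] by (simp_all add: Q_def)
  have "re x = Re \<theta>"
    unfolding re_def ip_def Q Q_1 unfolding cmod_power2 by (simp add: power2_eq_square algebra_simps)
  then show ?thesis
    by (simp add: Q cmod_power2)
qed

text \<open>The Gram determinant of \<open>1\<close>, \<open>x\<close>, \<open>j\<close> vanishes: a commutative composition algebra has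
  dimension at most 2.\<close>

lemma gram_identity:
  assumes x: "x \<in> K" and j: "j \<in> K"
  shows "(ip x j - re x * re j)\<^sup>2 = (Q x - (re x)\<^sup>2) * (Q j - (re j)\<^sup>2)"
proof -
  have "re (x * x * j * j) = re (x * x) * re (j * j) + re (j * x) * re (x * j) - ip x j * ip x j"
    by (rule re_mult4[OF x x j j])
  moreover have "re (x * j * x * j) = re (x * j) * re (x * j) + re (x * j) * re (x * j) - ip x x * ip j j"
    by (rule re_mult4[OF x j x j])
  moreover have "x * x * j * j = x * j * x * j" "j * x = x * j"
    by simp_all
  ultimately have eq: "re (x * x) * re (j * j) - (ip x j)\<^sup>2 = (re (x * j))\<^sup>2 - Q x * Q j"
    using ip_self[OF x] ip_self[OF j] by (simp add: power2_eq_square)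
  have "re (x * x) = 2 * (re x)\<^sup>2 - Q x" "re (j * j) = 2 * (re j)\<^sup>2 - Q j" "re (x * j) = 2 * re x * re j - ip x j"
    using ip_eq_re[OF x x] ip_eq_re[OF j j] ip_eq_re[OF x j] ip_self[OF x] ip_self[OF j]
    by (simp_all add: power2_eq_square)
  with eq have "(2 * (re x)\<^sup>2 - Q x) * (2 * (re j)\<^sup>2 - Q j) - (ip x j)\<^sup>2 = (2 * re x * re j - ip x j)\<^sup>2 - Q x * Q j"
    by simp
  then show ?thesis
    by (simp add: power2_eq_square algebra_simps)
qed

text \<open>The real part is \<open>re\<close>, the imaginary part the coordinate along some j made
  orthogonal to 1. The vanishing Gram determinant says that these two coordinates carry all of Q,
  and the product rules come from \<open>ip_eq_re\<close> and \<open>re_mult4\<close>. If no such j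
  exists, the imaginary part is 0.\<close>

theorem embedding_exists:
  obtains \<sigma> :: "complex \<Rightarrow> complex" where
    "\<And>x y. x \<in> K \<Longrightarrow> y \<in> K \<Longrightarrow> \<sigma> (x + y) = \<sigma> x + \<sigma> y"
    "\<And>x y. x \<in> K \<Longrightarrow> y \<in> K \<Longrightarrow> \<sigma> (x * y) = \<sigma> x * \<sigma> y"
    "\<sigma> 1 = 1" "\<And>x. x \<in> K \<Longrightarrow> v x = cmod (\<sigma> x)"
proof -
  have "\<exists>B :: complex \<Rightarrow> real. (\<forall>x\<in>K. \<forall>y\<in>K. B (x + y) = B x + B y) \<and> B 1 = 0 \<and>
      (\<forall>x\<in>K. Q x = (re x)\<^sup>2 + (B x)\<^sup>2) \<and> (\<forall>x\<in>K. \<forall>y\<in>K. B (x * y) = re x * B y + re y * B x)"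
  proof (cases "\<forall>x\<in>K. Q x = (re x)\<^sup>2")
    case True
    then show ?thesis
      by (intro exI[of _ "\<lambda>_. 0"]) auto
  next
    case False
    then obtain j where j: "j \<in> K" "Q j \<noteq> (re j)\<^sup>2"
      by blast
    \<comment> \<open>Length of the component of j orthogonal to 1, used to normalise the second
      coordinate.\<close>
    define s where "s = sqrt (Q j - (re j)\<^sup>2)"
    have s2: "s\<^sup>2 = Q j - (re j)\<^sup>2"
      unfolding s_def using re_square_le[OF j(1)] by simp
    have s: "s \<noteq> 0"
      using j(2) s2 by auto
    define B where "B x = (ip x j - re x * re j) / s" for x
    have add: "B (x + y) = B x + B y" if "x \<in> K" "y \<in> K" for x y
      unfolding B_def ip_add_left[OF that j(1)] re_add[OF that] distrib_right
      by (simp add: diff_divide_distrib add_divide_distrib)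
    have one: "B 1 = 0"
    proof -
      have "ip 1 j = re j"
        unfolding re_def by (rule ip_commute)
      then show ?thesis
        by (simp add: B_def re_1)
    qed
    have norm: "Q x = (re x)\<^sup>2 + (B x)\<^sup>2" if "x \<in> K" for x
    proof -
      have "(B x)\<^sup>2 = (Q x - (re x)\<^sup>2) * s\<^sup>2 / s\<^sup>2"
        unfolding B_def power_divide gram_identity[OF that j(1)] s2 ..
      then show ?thesis
        using s by simp
    qed
    have ip: "ip x y = re x * re y + B x * B y" if "x \<in> K" "y \<in> K" for x y
    proof -
      have "Q (x + y) = (re x + re y)\<^sup>2 + (B x + B y)\<^sup>2"
        using norm[OF add_mem[OF that]] add[OF that] re_add[OF that] by simp
      then show ?thesis
        unfolding ip_def norm[OF that(1)] norm[OF that(2)] by (simp add: power2_eq_square algebra_simps)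
    qed
    have re_mult: "re (x * y) = re x * re y - B x * B y" if "x \<in> K" "y \<in> K" for x y
      using ip_eq_re[OF that] ip[OF that] by simp
    have Bj: "B j = s"
    proof -
      have "B j = s\<^sup>2 / s"
        unfolding B_def s2 ip_self[OF j(1)] by (simp add: power2_eq_square)
      then show ?thesis
        by (simp add: power2_eq_square)
    qed
    have mult: "B (x * y) = re x * B y + re y * B x" if x: "x \<in> K" and y: "y \<in> K" for x y
    proof -
      have "re (x * y * 1 * j) = re (x * y) * re (1 * j) + re (1 * y) * re (x * j) - ip x 1 * ip y j"
        by (rule re_mult4[OF x y one_mem j(1)])
      then have "re (x * y * j) = re (x * y) * re j + re y * re (x * j) - re x * ip y j"
        by (simp add: re_def)
      moreover have "re (x * y * j) = re (x * y) * re j - B (x * y) * s"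
        using re_mult[OF mult_mem[OF x y] j(1)] Bj by simp
      moreover have "re (x * j) = re x * re j - B x * s"
        using re_mult[OF x j(1)] Bj by simp
      moreover have "ip y j = re y * re j + B y * s"
        using ip[OF y j(1)] Bj by simp
      ultimately have "B (x * y) * s = re x * (re y * re j + B y * s) - re y * (re x * re j - B x * s)"
        by (simp only:)
      then have "B (x * y) * s = (re x * B y + re y * B x) * s"
        by (simp add: algebra_simps)
      then show ?thesis
        using s by simp
    qed
    show ?thesis
      by (intro exI[of _ B] conjI ballI; (rule add one norm mult; assumption)?)
  qed
  then obtain B :: "complex \<Rightarrow> real" where add: "\<And>x y. x \<in> K \<Longrightarrow> y \<in> K \<Longrightarrow> B (x + y) = B x + B y" 
    and one: "B 1 = 0" and norm: "\<And>x. x \<in> K \<Longrightarrow> Q x = (re x)\<^sup>2 + (B x)\<^sup>2"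
    and mult: "\<And>x y. x \<in> K \<Longrightarrow> y \<in> K \<Longrightarrow> B (x * y) = re x * B y + re y * B x"
    by blast
  have re_mult: "re (x * y) = re x * re y - B x * B y" if "x \<in> K" "y \<in> K" for x y
  proof -
    have "Q (x + y) = (re x + re y)\<^sup>2 + (B x + B y)\<^sup>2"
      using norm[OF add_mem[OF that]] add[OF that] re_add[OF that] by simp
    then have "ip x y = re x * re y + B x * B y"
      unfolding ip_def norm[OF that(1)] norm[OF that(2)] by (simp add: power2_eq_square algebra_simps)
    then show ?thesis
      using ip_eq_re[OF that] by simp
  qed
  show ?thesis
  proof (rule that[of "\<lambda>x. Complex (re x) (B x)"])
    show "v x = cmod (Complex (re x) (B x))" if "x \<in> K" for x
    proof -
      have "cmod (Complex (re x) (B x)) = sqrt (Q x)"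
        using norm[OF that] by (simp add: cmod_def)
      then show ?thesis
        using v_nonneg[OF that] by (simp add: Q_def)
    qed
  qed (auto simp: complex_eq_iff re_add add re_mult mult re_1 one)
qed

end


section \<open>Completions at archimedean places\<close>

definition place_of :: "complex set \<Rightarrow> (complex \<Rightarrow> complex) \<Rightarrow> complex \<Rightarrow> real" where
  "place_of K \<sigma> = restrict (\<lambda>x. cmod (\<sigma> x)) K"

definition conj_embedding :: "complex set \<Rightarrow> (complex \<Rightarrow> complex) \<Rightarrow> complex \<Rightarrow> complex" where
  "conj_embedding K \<sigma> = restrict (\<lambda>x. cnj (\<sigma> x)) K"

lemma embeddings_iff:
  "\<sigma> \<in> embeddings K \<longleftrightarrow> \<sigma> \<in> extensional K \<and> \<sigma> 1 = 1 \<and>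
     (\<forall>x\<in>K. \<forall>y\<in>K. \<sigma> (x + y) = \<sigma> x + \<sigma> y \<and> \<sigma> (x * y) = \<sigma> x * \<sigma> y)"
  unfolding embeddings_def Ring.ring_hom_def by (auto simp: complex_field_simps)

locale embedded_subfield = complex_subfield +
  fixes \<sigma> :: "complex \<Rightarrow> complex"
  assumes embedding: "\<sigma> \<in> embeddings K"
begin

lemma ext: "\<sigma> \<in> extensional K"
  and one: "\<sigma> 1 = 1"
  and add: "x \<in> K \<Longrightarrow> y \<in> K \<Longrightarrow> \<sigma> (x + y) = \<sigma> x + \<sigma> y"
  and mult: "x \<in> K \<Longrightarrow> y \<in> K \<Longrightarrow> \<sigma> (x * y) = \<sigma> x * \<sigma> y"
  using embedding by (auto simp: embeddings_iff)

lemma zero: "\<sigma> 0 = 0"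
  using add[OF zero_mem zero_mem] by simp

lemma uminus: "x \<in> K \<Longrightarrow> \<sigma> (- x) = - \<sigma> x"
  using add[of x "- x"] by (simp add: uminus_mem zero eq_neg_iff_add_eq_0 add.commute)

lemma diff: "x \<in> K \<Longrightarrow> y \<in> K \<Longrightarrow> \<sigma> (x - y) = \<sigma> x - \<sigma> y"
  using add[of x "- y"] by (simp add: uminus_mem uminus)

lemma nonzero: "x \<in> K \<Longrightarrow> \<sigma> x = 0 \<longleftrightarrow> x = 0"
proof
  assume x: "x \<in> K" "\<sigma> x = 0"
  show "x = 0"
  proof (rule ccontr)
    assume "x \<noteq> 0"
    then have "\<sigma> x * \<sigma> (inverse x) = 1"
      using mult[OF x(1) inverse_mem[OF x(1)]] by (simp add: one)
    with x(2) show False by simp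
  qed
qed (simp add: zero)

lemma of_nat: "\<sigma> (of_nat n) = of_nat n"
  by (induction n) (simp_all add: zero add one one_mem of_nat_mem)

lemma of_int: "\<sigma> (of_int n) = of_int n"
  by (cases n) (simp_all only: of_int_of_nat_eq of_int_minus of_nat uminus of_nat_mem)

lemma of_rat: "\<sigma> (of_rat q) = of_rat q"
proof (cases q)
  case (Fract a b)
  have "\<sigma> (of_rat q) * \<sigma> (of_int b) = \<sigma> (of_rat q * of_int b)"
    by (intro mult[symmetric] of_rat_mem of_int_mem)
  also have "of_rat q * of_int b = (of_int a :: complex)"
    using Fract by (simp add: of_rat_rat)
  finally show ?thesis
    using Fract by (simp add: of_int of_rat_rat field_simps)
qed

lemma power: "x \<in> K \<Longrightarrow> \<sigma> (x ^ n) = \<sigma> x ^ n"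
  by (induction n) (simp_all add: one mult power_mem)

lemma sum: "finite I \<Longrightarrow> (\<And>i. i \<in> I \<Longrightarrow> f i \<in> K) \<Longrightarrow> \<sigma> (\<Sum>i\<in>I. f i) = (\<Sum>i\<in>I. \<sigma> (f i))"
  by (induction I rule: finite_induct) (simp_all add: zero add sum_mem)

lemma int_poly: 
  assumes x: "x \<in> K"
  shows "\<sigma> (poly (complex_poly p) x) = poly (complex_poly p) (\<sigma> x)"
proof -
  have "\<sigma> (poly (complex_poly p) x) = (\<Sum>i\<le>Polynomial.degree p. \<sigma> (of_int (Polynomial.coeff p i) * x ^ i))"
    unfolding poly_altdef using x
    by (simp add: degree_map_poly coeff_map_poly sum mult_mem of_int_mem power_mem)
  also have "\<dots> = poly (complex_poly p) (\<sigma> x)"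
    unfolding poly_altdef using x
    by (simp add: degree_map_poly coeff_map_poly mult of_int_mem power_mem of_int power)
  finally show ?thesis .
qed

lemma int_poly_iterate: "x \<in> K \<Longrightarrow> \<sigma> ((poly (complex_poly p) ^^ k) x) = (poly (complex_poly p) ^^ k) (\<sigma> x)"
  by (induction k) (simp_all add: int_poly int_poly_iterate_mem)

abbreviation v :: "complex \<Rightarrow> real" where
  "v \<equiv> place_of K \<sigma>"

lemma v_eq: "x \<in> K \<Longrightarrow> v x = cmod (\<sigma> x)"
  by (simp add: place_of_def)

lemma place_of_mem: "v \<in> infinite_places K"
  unfolding infinite_places_def absolute_value_def
proof (intro CollectI conjI ballI allI)
  show "v \<in> extensional K"
    by (simp add: place_of_def)
  show "v (of_rat q) = real_of_rat \<bar>q\<bar>" for q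
    unfolding v_eq[OF of_rat_mem] of_rat
    by (cases q) (simp add: of_rat_rat abs_rat norm_divide)
qed (auto simp: v_eq nonzero mult mult_mem add add_mem norm_mult norm_triangle_ineq)

lemma conj_embedding_mem: "conj_embedding K \<sigma> \<in> embeddings K"
  unfolding embeddings_iff conj_embedding_def
  by (simp add: one one_mem add add_mem mult mult_mem)

lemma place_of_conj: "place_of K (conj_embedding K \<sigma>) = v"
  by (rule HOL.ext) (simp add: place_of_def conj_embedding_def restrict_def)

text \<open>Equal moduli at x and x + 1 fix the real part, so each x goes to \<sigma> x or to its
  conjugate. If both alternatives failed somewhere, the sum of the two witnesses would satisfy
  neither.\<close>

lemma place_of_eq_imp:
  assumes \<tau>: "\<tau> \<in> embeddings K" and eq: "place_of K \<tau> = v"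
  shows "\<tau> = \<sigma> \<or> \<tau> = conj_embedding K \<sigma>"
proof -
  interpret T: embedded_subfield K \<tau>
    by (intro embedded_subfield.intro embedded_subfield_axioms.intro complex_subfield_axioms \<tau>)
  have norm_eq: "cmod (\<tau> x) = cmod (\<sigma> x)" if "x \<in> K" for x
    using T.v_eq[OF that] v_eq[OF that] eq by simp
  have cases: "\<tau> x = \<sigma> x \<or> \<tau> x = cnj (\<sigma> x)" if x: "x \<in> K" for x
  proof -
    have "cmod (\<tau> x + 1) = cmod (\<sigma> x + 1)"
      using norm_eq[OF add_mem[OF x one_mem]] by (simp add: add T.add x one_mem one T.one)
    then have "(cmod (\<tau> x + 1))\<^sup>2 = (cmod (\<sigma> x + 1))\<^sup>2" "(cmod (\<tau> x))\<^sup>2 = (cmod (\<sigma> x))\<^sup>2"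
      using norm_eq[OF x] by simp_all
    then have sq: "(Re (\<tau> x) + 1)\<^sup>2 + (Im (\<tau> x))\<^sup>2 = (Re (\<sigma> x) + 1)\<^sup>2 + (Im (\<sigma> x))\<^sup>2"
      "(Re (\<tau> x))\<^sup>2 + (Im (\<tau> x))\<^sup>2 = (Re (\<sigma> x))\<^sup>2 + (Im (\<sigma> x))\<^sup>2"
      unfolding cmod_power2 by simp_all
    then have re: "Re (\<tau> x) = Re (\<sigma> x)"
      by (simp add: power2_sum)
    with sq(2) have "(Im (\<tau> x))\<^sup>2 = (Im (\<sigma> x))\<^sup>2"
      by simp
    then have "Im (\<tau> x) = Im (\<sigma> x) \<or> Im (\<tau> x) = - Im (\<sigma> x)"
      by (simp add: power2_eq_iff)
    with re show ?thesis
      by (auto simp: complex_eq_iff)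
  qed
  show ?thesis
  proof (rule ccontr)
    assume "\<not> ?thesis"
    then have "\<tau> \<noteq> \<sigma>" "\<tau> \<noteq> conj_embedding K \<sigma>"
      by auto
    obtain x where x: "x \<in> K" "\<tau> x \<noteq> \<sigma> x"
      using \<open>\<tau> \<noteq> \<sigma>\<close> extensionalityI[OF T.ext ext] by blast
    obtain y where y: "y \<in> K" "\<tau> y \<noteq> conj_embedding K \<sigma> y"
      using \<open>\<tau> \<noteq> conj_embedding K \<sigma>\<close> extensionalityI[OF T.ext, of "conj_embedding K \<sigma>"]
      unfolding conj_embedding_def by blast
    then have y: "y \<in> K" "\<tau> y \<noteq> cnj (\<sigma> y)"
      by (simp_all add: conj_embedding_def)
    have "\<tau> x = cnj (\<sigma> x)" "\<tau> y = \<sigma> y"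
      using cases[OF x(1)] cases[OF y(1)] x y by auto
    then have "\<tau> (x + y) = cnj (\<sigma> x) + \<sigma> y" "\<sigma> (x + y) = \<sigma> x + \<sigma> y"
      using x y by (simp_all add: add T.add)
    with cases[OF add_mem[OF x(1) y(1)]] \<open>\<tau> x = cnj (\<sigma> x)\<close> \<open>\<tau> y = \<sigma> y\<close> x(2) y(2) show False
      by auto
  qed
qed

lemma fiber: "{\<tau> \<in> embeddings K. place_of K \<tau> = v} = {\<sigma>, conj_embedding K \<sigma>}"
  using place_of_eq_imp embedding conj_embedding_mem place_of_conj by auto

definition real_embedding :: bool where
  "real_embedding \<longleftrightarrow> (\<forall>x\<in>K. \<sigma> x \<in> \<real>)"

lemma conj_eq_iff: "conj_embedding K \<sigma> = \<sigma> \<longleftrightarrow> real_embedding"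
proof
  assume eq: "conj_embedding K \<sigma> = \<sigma>"
  show real_embedding
    unfolding real_embedding_def
  proof
    fix x assume "x \<in> K"
    then have "cnj (\<sigma> x) = \<sigma> x"
      using fun_cong[OF eq, of x] by (simp add: conj_embedding_def)
    then show "\<sigma> x \<in> \<real>"
      by (simp add: Reals_cnj_iff)
  qed
next
  assume real_embedding
  then show "conj_embedding K \<sigma> = \<sigma>"
    using ext unfolding real_embedding_def conj_embedding_def
    by (intro extensionalityI[of _ K]) (auto simp: Reals_cnj_iff)
qed

section \<open>The completion as a subfield of the complex numbers\<close>

lemma cauchy_seqs_iff: "x \<in> cauchy_seqs K v \<longleftrightarrow> range x \<subseteq> K \<and> convergent (\<lambda>n. \<sigma> (x n))"
proof -
  have "(\<forall>e>0. \<exists>N. \<forall>m\<ge>N. \<forall>n\<ge>N. v (x m - x n) < e) \<longleftrightarrow> Cauchy (\<lambda>n. \<sigma> (x n))" if "range x \<subseteq> K"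
  proof -
    have "v (x m - x n) = dist (\<sigma> (x m)) (\<sigma> (x n))" for m n
    proof -
      have "x m \<in> K" "x n \<in> K" using that by auto
      then show ?thesis
        by (simp add: v_eq diff_mem diff dist_norm)
    qed
    then show ?thesis
      by (simp add: Cauchy_def)
  qed
  then show ?thesis
    unfolding cauchy_seqs_def Cauchy_convergent_iff[symmetric] by blast
qed

lemma null_seqs_iff: "x \<in> null_seqs K v \<longleftrightarrow> range x \<subseteq> K \<and> (\<lambda>n. \<sigma> (x n)) \<longlonglongrightarrow> 0"
proof -
  have "((\<lambda>n. v (x n)) \<longlonglongrightarrow> 0) \<longleftrightarrow> (\<lambda>n. \<sigma> (x n)) \<longlonglongrightarrow> 0" if "range x \<subseteq> K"
  proof -
    have "v (x n) = cmod (\<sigma> (x n))" for n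
      using that by (intro v_eq) auto
    then show ?thesis
      by (simp add: tendsto_norm_zero_iff)
  qed
  then show ?thesis
    unfolding null_seqs_def by blast
qed

abbreviation CR :: "(nat \<Rightarrow> complex) ring" where
  "CR \<equiv> cauchy_ring K v"

lemma CR_simps:
  "carrier CR = cauchy_seqs K v" "x \<otimes>\<^bsub>CR\<^esub> y = (\<lambda>n. x n * y n)" "x \<oplus>\<^bsub>CR\<^esub> y = (\<lambda>n. x n + y n)"
  "\<one>\<^bsub>CR\<^esub> = (\<lambda>_. 1)" "\<zero>\<^bsub>CR\<^esub> = (\<lambda>_. 0)"
  by (simp_all add: cauchy_ring_def)

lemma cauchy_seqs_add: "x \<in> cauchy_seqs K v \<Longrightarrow> y \<in> cauchy_seqs K v \<Longrightarrow> (\<lambda>n. x n + y n) \<in> cauchy_seqs K v"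
  and cauchy_seqs_mult: "x \<in> cauchy_seqs K v \<Longrightarrow> y \<in> cauchy_seqs K v \<Longrightarrow> (\<lambda>n. x n * y n) \<in> cauchy_seqs K v"
  unfolding cauchy_seqs_iff
  by (auto simp: image_subset_iff add mult intro!: add_mem mult_mem convergent_add convergent_mult)

lemma cauchy_seqs_uminus: "x \<in> cauchy_seqs K v \<Longrightarrow> (\<lambda>n. - x n) \<in> cauchy_seqs K v"
  unfolding cauchy_seqs_iff
  by (auto simp: image_subset_iff uminus convergent_minus_iff[symmetric] intro!: uminus_mem)

lemma cauchy_seqs_const: "c \<in> K \<Longrightarrow> (\<lambda>_. c) \<in> cauchy_seqs K v"
  unfolding cauchy_seqs_iff by (auto intro: convergent_const)

lemma ring_CR: "ring CR"
proof (rule ringI)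
  show "abelian_group CR"
  proof (rule abelian_groupI; unfold CR_simps)
    show "\<exists>y\<in>cauchy_seqs K v. (\<lambda>n. y n + x n) = (\<lambda>_. 0)" if "x \<in> cauchy_seqs K v" for x
      by (rule bexI[OF _ cauchy_seqs_uminus[OF that]]) simp
  qed (auto intro: cauchy_seqs_add cauchy_seqs_const zero_mem)
  show "Group.monoid CR"
    by (rule monoidI; unfold CR_simps) (auto intro: cauchy_seqs_mult cauchy_seqs_const one_mem)
qed (auto simp: CR_simps distrib_left distrib_right)

definition limit :: "(nat \<Rightarrow> complex) \<Rightarrow> complex" where
  "limit x = lim (\<lambda>n. \<sigma> (x n))"

lemma limit_tendsto: "x \<in> cauchy_seqs K v \<Longrightarrow> (\<lambda>n. \<sigma> (x n)) \<longlonglongrightarrow> limit x"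
  unfolding limit_def cauchy_seqs_iff by (simp add: convergent_LIMSEQ_iff)

lemma limit_unique: "(\<lambda>n. \<sigma> (x n)) \<longlonglongrightarrow> l \<Longrightarrow> limit x = l"
  unfolding limit_def by (rule limI)

lemma ring_complex_field: "ring complex_field"
  using field.is_ring[OF field_from_type_algebra] .

lemma ring_hom_limit: "ring_hom_ring CR complex_field limit"
proof (rule ring_hom_ringI[OF ring_CR ring_complex_field]; unfold CR_simps complex_field_simps)
  fix x y
  assume x: "x \<in> cauchy_seqs K v" and y: "y \<in> cauchy_seqs K v"
  have mem: "x n \<in> K" "y n \<in> K" for n
    using x y by (auto simp: cauchy_seqs_iff)
  show "limit (\<lambda>n. x n * y n) = limit x * limit y"
    by (rule limit_unique) (simp only: mult mem tendsto_mult[OF limit_tendsto[OF x] limit_tendsto[OF y]])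
  show "limit (\<lambda>n. x n + y n) = limit x + limit y"
    by (rule limit_unique) (simp only: add mem tendsto_add[OF limit_tendsto[OF x] limit_tendsto[OF y]])
next
  show "limit (\<lambda>_. 1) = 1"
    by (rule limit_unique) (simp add: one)
qed simp

lemma kernel_limit: "a_kernel CR complex_field limit = null_seqs K v"
  unfolding a_kernel_def' CR_simps complex_field_simps
proof (intro equalityI subsetI)
  fix x
  assume "x \<in> {x \<in> cauchy_seqs K v. limit x = 0}"
  then have x: "x \<in> cauchy_seqs K v" "limit x = 0"
    by simp_all
  then show "x \<in> null_seqs K v"
    using limit_tendsto[OF x(1)] unfolding null_seqs_iff cauchy_seqs_iff by simp
next
  fix x
  assume "x \<in> null_seqs K v"
  then have x: "range x \<subseteq> K" "(\<lambda>n. \<sigma> (x n)) \<longlonglongrightarrow> 0"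
    unfolding null_seqs_iff by simp_all
  then have "x \<in> cauchy_seqs K v"
    unfolding cauchy_seqs_iff convergent_def by blast
  then show "x \<in> {x \<in> cauchy_seqs K v. limit x = 0}"
    using limit_unique[OF x(2)] by simp
qed

lemma real_rational_limit:
  obtains x :: "nat \<Rightarrow> complex" where "range x \<subseteq> \<rat>" "x \<longlonglongrightarrow> of_real t"
proof -
  define q where "q k = (of_int \<lfloor>t * 2 ^ k\<rfloor> / 2 ^ k :: real)" for k
  have "q \<longlonglongrightarrow> t"
    unfolding q_def by (rule dyadic_floor_tendsto)
  then have lim: "(\<lambda>k. complex_of_real (q k)) \<longlonglongrightarrow> of_real t"
    by (rule tendsto_of_real)
  have "complex_of_real (q k) \<in> \<rat>" for k
    by (simp add: q_def)
  then have "range (\<lambda>k. complex_of_real (q k)) \<subseteq> \<rat>"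
    by blast
  then show ?thesis
    using lim by (rule that)
qed

lemma rat_subset: "\<rat> \<subseteq> K"
  by (auto elim!: Rats_cases intro: of_rat_mem)

lemma fixes_rat: "x \<in> \<rat> \<Longrightarrow> \<sigma> x = x"
  by (auto elim!: Rats_cases simp: of_rat)

lemma limit_rational: "limit ` {x \<in> cauchy_seqs K v. range x \<subseteq> \<rat>} = \<real>"
proof (intro equalityI subsetI)
  fix z
  assume "z \<in> limit ` {x \<in> cauchy_seqs K v. range x \<subseteq> \<rat>}"
  then obtain x where x: "x \<in> cauchy_seqs K v" "range x \<subseteq> \<rat>" "z = limit x"
    by auto
  have "\<sigma> (x n) \<in> \<real>" for n
  proof -
    have "x n \<in> \<rat>"
      using x(2) by auto
    moreover have "of_rat q \<in> (\<real> :: complex set)" for q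
      by (cases q) (simp add: of_rat_rat)
    ultimately show ?thesis
      using fixes_rat[of "x n"] by (auto elim: Rats_cases)
  qed
  then show "z \<in> \<real>"
    unfolding x(3) by (rule closed_sequentially[OF closed_complex_Reals _ limit_tendsto[OF x(1)]])
next
  fix z :: complex
  assume "z \<in> \<real>"
  then obtain t where t: "z = of_real t"
    by (auto simp: Reals_def)
  obtain x :: "nat \<Rightarrow> complex" where x: "range x \<subseteq> \<rat>" "x \<longlonglongrightarrow> of_real t"
    using real_rational_limit by blast
  have eq: "(\<lambda>n. \<sigma> (x n)) = x"
  proof (rule HOL.ext)
    fix n
    have "x n \<in> \<rat>"
      using x(1) by auto
    then show "\<sigma> (x n) = x n"
      by (rule fixes_rat)
  qed
  have lim: "(\<lambda>n. \<sigma> (x n)) \<longlonglongrightarrow> z"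
    unfolding eq t by (rule x(2))
  have "range x \<subseteq> K"
    using x(1) rat_subset by (rule subset_trans)
  then have "x \<in> cauchy_seqs K v"
    using lim unfolding cauchy_seqs_iff convergent_def by blast
  moreover have "limit x = z"
    by (rule limit_unique[OF lim])
  ultimately show "z \<in> limit ` {x \<in> cauchy_seqs K v. range x \<subseteq> \<rat>}"
    using x(1) by blast
qed

text \<open>Rational sequences already reach every real number; one non-real value \<sigma> j spans
  the plane together with the reals.\<close>

lemma limit_image: "limit ` cauchy_seqs K v = (if real_embedding then \<real> else UNIV)"
proof (cases real_embedding)
  case True
  have "limit x \<in> \<real>" if "x \<in> cauchy_seqs K v" for x
  proof (rule closed_sequentially[OF closed_complex_Reals _ limit_tendsto[OF that]])
    show "\<sigma> (x n) \<in> \<real>" for n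
      using True that by (auto simp: real_embedding_def cauchy_seqs_iff)
  qed
  moreover have "\<real> \<subseteq> limit ` cauchy_seqs K v"
    unfolding limit_rational[symmetric] by auto
  ultimately show ?thesis
    using True by auto
next
  case False
  then obtain j where j: "j \<in> K" "\<sigma> j \<notin> \<real>"
    by (auto simp: real_embedding_def)
  have Imj: "Im (\<sigma> j) \<noteq> 0"
    using j(2) by (simp add: complex_is_Real_iff)
  have "z \<in> limit ` cauchy_seqs K v" for z
  proof -
    define b where "b = Im z / Im (\<sigma> j)"
    define a where "a = Re z - b * Re (\<sigma> j)"
    have z: "z = of_real a + of_real b * \<sigma> j"
      using Imj by (simp add: complex_eq_iff a_def b_def)
    have "of_real a \<in> limit ` {x \<in> cauchy_seqs K v. range x \<subseteq> \<rat>}" "of_real b \<in> limit ` {x \<in> cauchy_seqs K v. range x \<subseteq> \<rat>}"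
      unfolding limit_rational by simp_all
    then obtain x y where x: "x \<in> cauchy_seqs K v" "limit x = of_real a" and y: "y \<in> cauchy_seqs K v" "limit y = of_real b"
      unfolding image_iff by force
    interpret ring_hom_ring CR complex_field limit
      by (rule ring_hom_limit)
    have c: "(\<lambda>_. j) \<in> cauchy_seqs K v" "limit (\<lambda>_. j) = \<sigma> j"
      using j(1) by (auto intro!: cauchy_seqs_const limit_unique)
    let ?w = "\<lambda>n. x n + y n * j"
    have "?w \<in> cauchy_seqs K v"
      using cauchy_seqs_add[OF x(1) cauchy_seqs_mult[OF y(1) c(1)]] .
    moreover have "limit ?w = z"
      using hom_add[of x "\<lambda>n. y n * j"] hom_mult[of y "\<lambda>_. j"] x y c cauchy_seqs_mult[OF y(1) c(1)]
      by (simp add: CR_simps complex_field_simps z)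
    ultimately show ?thesis by blast
  qed
  then show ?thesis
    using False by auto
qed

end


section \<open>Canonical heights as sums over embeddings\<close>

context
begin

interpretation C: field complex_field
  by (rule field_from_type_algebra)

lemma subfield_Reals: "subfield \<real> complex_field"
proof (rule C.subfieldI')
  show "subring \<real> complex_field"
    by (rule C.subringI) (auto simp: complex_field_simps complex_field_uminus)
  show "inv\<^bsub>complex_field\<^esub> k \<in> \<real>" if "k \<in> \<real> - {\<zero>\<^bsub>complex_field\<^esub>}" for k
    using that by (auto simp: complex_field_inv complex_field_simps)
qed

lemma dimension_Reals: "ring.dimension (complex_field\<lparr>carrier := \<real>\<rparr>) 1 \<real> \<real>"
  and subfield_Reals_Reals: "subfield \<real> (complex_field\<lparr>carrier := \<real>\<rparr>)"
proof -
  interpret R: field "complex_field\<lparr>carrier := \<real>\<rparr>"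
    by (rule C.subfield_iff(2)[OF subfield_Reals])
  show "subfield \<real> (complex_field\<lparr>carrier := \<real>\<rparr>)"
    using R.carrier_is_subfield by simp
  then show "ring.dimension (complex_field\<lparr>carrier := \<real>\<rparr>) 1 \<real> \<real>"
    by (rule R.dimension_one)
qed

lemma complex_field_carrier_UNIV: "complex_field\<lparr>carrier := UNIV\<rparr> = complex_field"
  by (simp add: ring_of_type_algebra_def)

lemma dimension_complex: "ring.dimension complex_field 2 \<real> UNIV"
proof -
  have "C.dimension (Suc 1) \<real> (C.line_extension \<real> \<i> \<real>)"
    by (rule C.Suc_dim[OF _ _ C.dimension_one[OF subfield_Reals]])
       (simp_all add: complex_field_simps complex_is_Real_iff)
  also have "C.line_extension \<real> \<i> \<real> = UNIV"
  proof -
    have "z \<in> C.line_extension \<real> \<i> \<real>" for z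
      unfolding C.line_extension_mem_iff complex_field_simps
      by (intro bexI[of _ "of_real (Im z)"] bexI[of _ "of_real (Re z)"]) (simp_all add: complex_eq_iff)
    then show ?thesis by blast
  qed
  finally show ?thesis
    by (simp add: numeral_2_eq_2)
qed

lemma rational_root_of_number_field:
  assumes K: "number_field K" and x: "x \<in> K"
  shows "\<exists>f. f \<noteq> 0 \<and> poly (map_poly of_rat f) x = 0"
proof -
  have sub: "subring K complex_field"
    using K subfieldE(1) unfolding number_field_def by blast
  have "(C.algebraic over \<rat>) x"
    using C.finite_dimension_imp_algebraic[OF subfield_Rats sub _ x] K unfolding number_field_def by blast
  then obtain p where p: "p \<in> carrier (univ_poly complex_field \<rat>)" "p \<noteq> []" "C.eval p x = \<zero>\<^bsub>complex_field\<^esub>"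
    using C.algebraicE[OF subfieldE(1)[OF subfield_Rats], of x] by (auto simp: complex_field_simps)
  have rats: "set p \<subseteq> \<rat>" and hd: "hd p \<noteq> 0"
    using p(1,2) unfolding univ_poly_def polynomial_def by (auto simp: complex_field_simps)
  define g where "g = Poly (rev p)"
  have g0: "poly g x = 0"
    using p(3) by (simp add: complex_field_eval g_def complex_field_simps)
  have "last (rev p) \<noteq> 0"
    using hd p(2) by (simp add: last_rev)
  then have "g \<noteq> 0"
    unfolding g_def using p(2) by (metis Poly_eq_0 last_in_set rev_is_Nil_conv set_replicate_conv_if singletonD empty_iff)
  have coeff: "Polynomial.coeff g i \<in> \<rat>" for i
    using rats unfolding g_def coeff_Poly_eq nth_default_def by (auto simp: rev_nth subset_iff)
  \<comment> \<open>A one-sided inverse of \<open>of_rat\<close>, fixed at 0 so that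
    \<open>map_poly\<close> acts on each coefficient.\<close>
  define rat_of where "rat_of z = (if z = 0 then 0 else SOME q. z = of_rat q)" for z :: complex
  have rat_of: "of_rat (rat_of z) = z" if zr: "z \<in> \<rat>" for z
  proof (cases "z = 0")
    case False
    obtain q where "z = of_rat q"
      using zr by (rule Rats_cases)
    then have "z = of_rat (SOME q. z = of_rat q)"
      by (rule someI)
    then show ?thesis
      using False by (simp add: rat_of_def)
  qed (simp add: rat_of_def)
  define f where "f = map_poly rat_of g"
  have "map_poly of_rat f = g"
    by (intro poly_eqI) (simp add: f_def coeff_map_poly rat_of_def[of 0] rat_of coeff)
  then show ?thesis
    using \<open>g \<noteq> 0\<close> g0 by (intro exI[of _ f]) auto
qed

end

context embedded_subfield
begin

text \<open>Taking limits of \<sigma> along Cauchy sequences is a ring homomorphism with the null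
  sequences as kernel. The completion is thus isomorphic to R or C, and the dimension over R is
  carried back along \<open>\<psi>\<close>.\<close>

theorem local_degree_eq: "local_degree K v = (if real_embedding then 1 else 2)"
proof -
  let ?S = "complex_field\<lparr>carrier := limit ` carrier CR\<rparr>"
  let ?Q = "completion K v"
  let ?n = "if real_embedding then 1 else (2 :: nat)"
  define \<phi> where "\<phi> = (\<lambda>Y. the_elem (limit ` Y))"
  define \<psi> where "\<psi> = inv_into (carrier ?Q) \<phi>"
  interpret L: ring_hom_ring CR complex_field limit
    by (rule ring_hom_limit)
  have Q: "?Q = CR Quot a_kernel CR complex_field limit"
    unfolding completion_def kernel_limit ..
  have ring_Q: "ring ?Q"
    unfolding Q by (rule ideal.quotient_is_ring[OF L.kernel_is_ideal])
  have ring_S: "ring ?S"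
    by (rule L.img_is_ring)
  have \<phi>: "\<phi> \<in> ring_iso ?Q ?S"
    unfolding \<phi>_def Q by (rule L.FactRing_iso_set_aux)
  have \<psi>: "\<psi> \<in> ring_iso ?S ?Q"
    unfolding \<psi>_def by (rule ring_iso_set_sym[OF ring_Q \<phi>])
  have \<phi>_bij: "bij_betw \<phi> (carrier ?Q) (carrier ?S)" and \<psi>_bij: "bij_betw \<psi> (carrier ?S) (carrier ?Q)"
    using \<phi> \<psi> by (auto simp: ring_iso_def)
  have \<psi>_hom: "\<psi> \<in> Ring.ring_hom ?S ?Q"
    using \<psi> by (simp add: ring_iso_def)
  interpret P: ring_hom_ring ?S ?Q \<psi>
    by (rule ring_hom_ringI2[OF ring_S ring_Q \<psi>_hom])
  have carrier_S: "limit ` carrier CR = (if real_embedding then \<real> else UNIV)"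
    unfolding CR_simps limit_image ..
  have S: "?S = (if real_embedding then complex_field\<lparr>carrier := \<real>\<rparr> else complex_field)"
    unfolding carrier_S by (simp add: complex_field_carrier_UNIV)
  have sub: "subfield \<real> ?S"
    unfolding S using subfield_Reals subfield_Reals_Reals by simp
  have dim: "ring.dimension ?S ?n \<real> (carrier ?S)"
    unfolding S using dimension_Reals dimension_complex by (simp add: complex_field_simps)
  have one_zero: "\<one>\<^bsub>?Q\<^esub> \<noteq> \<zero>\<^bsub>?Q\<^esub>"
  proof
    assume "\<one>\<^bsub>?Q\<^esub> = \<zero>\<^bsub>?Q\<^esub>"
    then have "\<psi> \<one>\<^bsub>?S\<^esub> = \<psi> \<zero>\<^bsub>?S\<^esub>"
      by (simp only: P.hom_one P.hom_zero)
    then have "\<one>\<^bsub>?S\<^esub> = \<zero>\<^bsub>?S\<^esub>"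
      using \<psi>_bij unfolding bij_betw_def inj_on_def by blast
    then show False
      by (simp add: complex_field_simps)
  qed
  \<comment> \<open>The base field of \<open>local_degree\<close> is the closure of the rationals,
    so the isomorphism must match it with the reals.\<close>
  have rat: "rat_completion K v = \<psi> ` \<real>"
  proof -
    let ?R = "{x \<in> cauchy_seqs K v. range x \<subseteq> \<rat>}"
    have rc: "rat_completion K v = (\<lambda>x. a_kernel CR complex_field limit +>\<^bsub>CR\<^esub> x) ` ?R"
      unfolding rat_completion_def kernel_limit ..
    have sub_carrier: "rat_completion K v \<subseteq> carrier ?Q"
      unfolding rc Q FactRing_def A_RCOSETS_def' by (auto simp: CR_simps)
    have "\<phi> (a_kernel CR complex_field limit +>\<^bsub>CR\<^esub> x) = limit x" if "x \<in> ?R" for x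
      unfolding \<phi>_def using that by (intro L.the_elem_simp) (simp add: CR_simps)
    then have "\<phi> ` rat_completion K v = limit ` ?R"
      unfolding rc image_image by (intro image_cong) auto
    then have "\<phi> ` rat_completion K v = \<real>"
      unfolding limit_rational .
    then show ?thesis
      unfolding \<psi>_def using inv_into_image_cancel[OF bij_betw_imp_inj_on[OF \<phi>_bij] sub_carrier] by simp
  qed
  have carr: "carrier ?Q = \<psi> ` carrier ?S"
    using \<psi>_bij by (simp add: bij_betw_def)
  have "P.S.dimension ?n (\<psi> ` \<real>) (\<psi> ` carrier ?S)"
    using P.inj_hom_dimension[OF sub one_zero _ dim] \<psi>_bij by (simp add: bij_betw_def)
  moreover have "subfield (\<psi> ` \<real>) ?Q"
    by (rule P.img_is_subfield(2)[OF sub one_zero])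
  ultimately have "P.S.dim (\<psi> ` \<real>) (\<psi> ` carrier ?S) = ?n"
    using P.S.dimI unfolding over_def by blast
  then show ?thesis
    unfolding local_degree_def rat carr .
qed

lemma local_degree_eq_card: "local_degree K v = card {\<tau> \<in> embeddings K. place_of K \<tau> = v}"
  unfolding local_degree_eq fiber using conj_eq_iff by (auto simp: card_insert_if)

end

text \<open>This turns the archimedean part of the height into a sum over embeddings; the nontrivial
  inclusion is \<open>embedding_exists\<close>.\<close>

lemma infinite_places_eq:
  assumes K: "number_field K"
  shows "infinite_places K = place_of K ` embeddings K"
proof (intro equalityI subsetI)
  have sub: "complex_subfield K"
    using K unfolding number_field_def by (intro complex_subfield.intro) blast
  fix v
  assume v: "v \<in> infinite_places K"
  interpret algebraic_valued_subfield K v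
  proof (intro algebraic_valued_subfield.intro arch_valued_subfield.intro valued_subfield.intro
      valued_subfield_axioms.intro arch_valued_subfield_axioms.intro algebraic_valued_subfield_axioms.intro sub)
    show "absolute_value K v" "v (of_rat q) = \<bar>real_of_rat q\<bar>" for q
    proof -
      have "real_of_rat \<bar>q\<bar> = \<bar>real_of_rat q\<bar>"
        by (cases q) (simp add: abs_rat of_rat_rat)
      then show "absolute_value K v" "v (of_rat q) = \<bar>real_of_rat q\<bar>"
        using v by (simp_all add: infinite_places_def)
    qed
    show "\<exists>f. f \<noteq> 0 \<and> poly (map_poly of_rat f) x = 0" if "x \<in> K" for x
      by (rule rational_root_of_number_field[OF K that])
  qed
  obtain \<sigma> :: "complex \<Rightarrow> complex" where \<sigma>: "\<And>x y. x \<in> K \<Longrightarrow> y \<in> K \<Longrightarrow> \<sigma> (x + y) = \<sigma> x + \<sigma> y"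
    "\<And>x y. x \<in> K \<Longrightarrow> y \<in> K \<Longrightarrow> \<sigma> (x * y) = \<sigma> x * \<sigma> y" "\<sigma> 1 = 1" "\<And>x. x \<in> K \<Longrightarrow> v x = cmod (\<sigma> x)"
    using embedding_exists by blast
  have "restrict \<sigma> K \<in> embeddings K"
    unfolding embeddings_iff by (simp add: \<sigma>(1-3) one_mem add_mem mult_mem)
  moreover have "v \<in> extensional K"
    using v by (simp add: infinite_places_def)
  then have "v = place_of K (restrict \<sigma> K)"
    by (intro extensionalityI[of _ K]) (simp_all add: place_of_def \<sigma>(4))
  ultimately show "v \<in> place_of K ` embeddings K"
    by (intro image_eqI)
next
  fix v
  assume "v \<in> place_of K ` embeddings K"
  then obtain \<sigma> where \<sigma>: "\<sigma> \<in> embeddings K" "v = place_of K \<sigma>"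
    by blast
  interpret embedded_subfield K \<sigma>
    using K \<sigma>(1) unfolding number_field_def
    by (intro embedded_subfield.intro embedded_subfield_axioms.intro complex_subfield.intro) blast+
  show "v \<in> infinite_places K"
    unfolding \<sigma>(2) by (rule place_of_mem)
qed

text \<open>Embeddings are grouped by the place they induce, and the size of a fibre is the local
  degree.\<close>

lemma sum_infinite_places:
  assumes K: "number_field K" and x: "x \<in> K"
  shows "(\<Sum>v \<in> infinite_places K. real (local_degree K v) * F (v x)) = (\<Sum>\<sigma> \<in> embeddings K. F (cmod (\<sigma> x)))"
proof -
  have emb: "embedded_subfield K \<sigma>" if "\<sigma> \<in> embeddings K" for \<sigma>
    using K that unfolding number_field_def
    by (intro embedded_subfield.intro embedded_subfield_axioms.intro complex_subfield.intro) blast+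
  have fiber_finite: "finite {\<tau> \<in> embeddings K. place_of K \<tau> = v}" if v: "v \<in> place_of K ` embeddings K" for v
  proof -
    obtain \<sigma> where "\<sigma> \<in> embeddings K" "v = place_of K \<sigma>"
      using v by blast
    then show ?thesis
      using embedded_subfield.fiber[OF emb] by simp
  qed
  show ?thesis
  proof (cases "finite (embeddings K)")
    case True
    have "(\<Sum>\<sigma> \<in> embeddings K. F (cmod (\<sigma> x))) = 
        (\<Sum>v \<in> place_of K ` embeddings K. \<Sum>\<sigma> \<in> {\<tau> \<in> embeddings K. place_of K \<tau> = v}. F (cmod (\<sigma> x)))"
      by (rule sum.image_gen[OF True])
    also have "\<dots> = (\<Sum>v \<in> infinite_places K. real (local_degree K v) * F (v x))"
      unfolding infinite_places_eq[OF K]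
    proof (rule sum.cong[OF refl])
      fix v
      assume "v \<in> place_of K ` embeddings K"
      then obtain \<sigma> where \<sigma>: "\<sigma> \<in> embeddings K" "v = place_of K \<sigma>"
        by blast
      have "(\<Sum>\<tau> \<in> {\<tau> \<in> embeddings K. place_of K \<tau> = v}. F (cmod (\<tau> x))) = 
          (\<Sum>\<tau> \<in> {\<tau> \<in> embeddings K. place_of K \<tau> = v}. F (v x))"
        using x by (intro sum.cong refl) (auto simp: place_of_def)
      also have "\<dots> = real (local_degree K v) * F (v x)"
        unfolding \<sigma>(2) embedded_subfield.local_degree_eq_card[OF emb[OF \<sigma>(1)]] by simp
      finally show "(\<Sum>\<tau> \<in> {\<tau> \<in> embeddings K. place_of K \<tau> = v}. F (cmod (\<tau> x))) = real (local_degree K v) * F (v x)" .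
    qed
    finally show ?thesis ..
  next
    \<comment> \<open>Fibres are finite, so infinitely many embeddings would mean infinitely many
      places, and both sums would have the default value 0.\<close>
    case False
    have "infinite (infinite_places K)"
    proof
      assume fin: "finite (infinite_places K)"
      have "embeddings K \<subseteq> (\<Union>v \<in> infinite_places K. {\<tau> \<in> embeddings K. place_of K \<tau> = v})"
        unfolding infinite_places_eq[OF K] by blast
      moreover have "finite (\<Union>v \<in> infinite_places K. {\<tau> \<in> embeddings K. place_of K \<tau> = v})"
        using fin fiber_finite unfolding infinite_places_eq[OF K] by blast
      ultimately show False
        using False finite_subset by blast
    qed
    with False show ?thesis by simp
  qed
qed

lemma number_field_embedding: "number_field K \<Longrightarrow> \<sigma> \<in> embeddings K \<Longrightarrow> embedded_subfield K \<sigma>"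
  unfolding number_field_def
  by (intro embedded_subfield.intro embedded_subfield_axioms.intro complex_subfield.intro) blast+

text \<open>The finite part grows by exactly d^k and is constant after normalisation. Embeddings
  commute with integer polynomials, so each archimedean term is an escape rate at
  \<open>\<sigma> x\<close>.\<close>

lemma canonical_height_eq:
  fixes p :: "int poly"
  assumes K: "number_field K" and x: "x \<in> K" and monic: "Polynomial.lead_coeff p = 1"
    and deg: "Polynomial.degree p \<noteq> 0"
    and escape: "\<And>z. (\<lambda>k. log_plus (cmod ((poly (complex_poly p) ^^ k) z)) / real (Polynomial.degree p) ^ k) 
      \<longlonglongrightarrow> g z"
  shows "canonical_height K (complex_poly p) x = 
    ((\<Sum>\<sigma> \<in> embeddings K. g (\<sigma> x)) + finite_height_sum K x) / real (field_degree K)"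
proof -
  let ?d = "real (Polynomial.degree p)"
  let ?P = "poly (complex_poly p)"
  interpret complex_subfield K
    using K unfolding number_field_def by (intro complex_subfield.intro) blast
  have weil: "weil_height K ((?P ^^ k) x) / ?d ^ k =
      ((\<Sum>\<sigma> \<in> embeddings K. log_plus (cmod ((?P ^^ k) (\<sigma> x))) / ?d ^ k) + finite_height_sum K x) / real (field_degree K)" for k
  proof -
    have "(\<Sum>v \<in> infinite_places K. real (local_degree K v) * log_plus (v ((?P ^^ k) x))) = 
        (\<Sum>\<sigma> \<in> embeddings K. log_plus (cmod (\<sigma> ((?P ^^ k) x))))"
      by (rule sum_infinite_places[OF K int_poly_iterate_mem[OF x]])
    also have "\<dots> = (\<Sum>\<sigma> \<in> embeddings K. log_plus (cmod ((?P ^^ k) (\<sigma> x))))"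
      using embedded_subfield.int_poly_iterate[OF number_field_embedding[OF K] x] by (intro sum.cong refl) simp
    finally show ?thesis
      unfolding weil_height_def finite_height_sum_iterate[OF K x monic]
      using deg by (simp add: add_divide_distrib sum_divide_distrib mult.commute)
  qed
  have "(\<lambda>k. weil_height K ((?P ^^ k) x) / ?d ^ k) \<longlonglongrightarrow>
      ((\<Sum>\<sigma> \<in> embeddings K. g (\<sigma> x)) + finite_height_sum K x) / real (field_degree K)"
    unfolding weil divide_inverse[of _ "real (field_degree K)"]
    by (intro tendsto_mult_right tendsto_add tendsto_sum escape tendsto_const)
  moreover have "Polynomial.degree (complex_poly p) = Polynomial.degree p"
    by (simp add: degree_map_poly)
  ultimately show ?thesis
    unfolding canonical_height_def by (simp add: limI)
qed


section \<open>The limit of canonical heights\<close>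

theorem corollary1:
  fixes E :: "complex set"
    and a :: "nat \<Rightarrow> complex"
    and P :: "nat \<Rightarrow> int poly"
    and K :: "complex set"
    and \<alpha> :: complex
  assumes "compact E"
    and "cnj ` E = E"
    and "dirichlet_regular E"
    and "log_capacity E = 1"
    and "inj a"
    and "\<And>n. algebraic_int (a n)"
    and "\<And>n. is_minimal_poly (map_poly of_int (P n)) (a n)"
    and "(\<lambda>n. max_dist (galois_conjugates (P n)) E) \<longlonglongrightarrow> 0"
    and "number_field K"
    and "\<alpha> \<in> K"
  shows "((\<lambda>n. canonical_height K (complex_poly (P n)) \<alpha>) \<longlongrightarrow> rumely_height E K \<alpha>)
           (inf sequentially (principal {n. Polynomial.degree (P n) \<ge> 2}))"
proof -
  note minimal = assms(7)
  note esc = escape_rate_tendsto_green[OF assms(1,3,4,5,7,8)]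
  note facts = galois_conjugates_facts[OF minimal]
  let ?g = "\<lambda>n z. escape_rate (complex_poly (P n)) z"
  have "eventually (\<lambda>n. 1 \<le> Polynomial.degree (P n)) sequentially"
    using log_plus_poly_tendsto_green(2)[OF assms(1,3,4,5,7,8)] unfolding filterlim_at_top by blast
  with esc(2) have eq: "eventually (\<lambda>n. ((\<Sum>\<sigma> \<in> embeddings K. ?g n (\<sigma> \<alpha>)) + finite_height_sum K \<alpha>) / real (field_degree K)
      = canonical_height K (complex_poly (P n)) \<alpha>) sequentially"
  proof eventually_elim
    case (elim n)
    then show ?case
      by (intro canonical_height_eq[OF assms(9,10) facts(1), symmetric]) auto
  qed
  have "(\<lambda>n. ((\<Sum>\<sigma> \<in> embeddings K. ?g n (\<sigma> \<alpha>)) + finite_height_sum K \<alpha>) / real (field_degree K))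
      \<longlonglongrightarrow> rumely_height E K \<alpha>"
    unfolding rumely_height_def divide_inverse
    by (intro tendsto_mult_right tendsto_add tendsto_sum esc(1) tendsto_const)
  then have "(\<lambda>n. canonical_height K (complex_poly (P n)) \<alpha>) \<longlonglongrightarrow> rumely_height E K \<alpha>"
    using eq by (rule Lim_transform_eventually)
  \<comment> \<open>The degrees tend to infinity, so the limit holds along all n; restricting the
    filter to degrees at least 2 preserves it.\<close>
  then show ?thesis
    by (rule tendsto_mono[OF inf_le1])
qed

end
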